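(* Let $G=H^{(3)}$ be the Hanoi Towers group on three pegs, and let $f$ be the polynomial $f(x)=x^2-x-3$. (1) For every $n\ge1$, the spectrum of $\Gamma_n$, as a set, has $3\cdot 2^{n-1}-1$ elements and is equal (after re-scaling by $3$) to $$\{3\}\ \cup\ \bigcup_{i=0}^{n-1}f^{-i}(0)\ \cup\ \bigcup_{j=0}^{n-2}f^{-j}(-2).$$ The multiplicity of each of the $2^i$ eigenvalues in $f^{-i}(0)$, $i=0,\dots,n-1$, is $a_{n-i}$, and the multiplicity of each of the $2^j$ eigenvalues in $f^{-j}(-2)$, $j=0,\dots,n-2$, is $b_{n-j}$, where $a_i=\frac{3^{i-1}+3}{2}$ and $b_j=\frac{3^{j-1}-1}{2}$ for $i,j\ge1$. (2) The spectrum of $\Gamma_{000\dots}$, as a set, is equal (after re-scaling by $3$) to $$\overline{\{3\}\ \cup\ \bigcup_{i=0}^{\infty}f^{-i}\{0,-2\}}=\overline{\bigcup_{i=0}^{\infty}f^{-i}\{0\}}.$$ It consists of a set of isolated points $I=\bigcup_{i=0}^{\infty}f^{-i}\{0\}$ and its set of accumulation points $J$, which is the Julia set of the polynomial $f$ and is a Cantor set. (3) The KNS spectral measure (after re-scaling by $3$) is discrete, concentrated on $\bigcup_{i=0}^{\infty}f^{-i}\{0,-2\}$, and the measure of each of the eigenvalues in $f^{-i}\{0,-2\}$ is $\frac{1}{6\cdot 3^i}$, $i=0,1,\dots$.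
   Context: Let $X=\{0,1,2\}$ and let $X^*$ be the set of finite words over $X$, viewed as a $3$-regular rooted tree $\mathcal{T}$ whose level $n$ consists of the $3^n$ words of length $n$; the boundary $\partial\mathcal{T}$ is the set of infinite words over $X$. For $\{i,j\}\subset X$, $i<j$, let $a_{(ij)}$ be the automorphism of $\mathcal{T}$ defined recursively by (fixing the empty word and) $$a_{(ij)}(iw)=jw,\qquad a_{(ij)}(jw)=iw,\qquad a_{(ij)}(xw)=x\,a_{(ij)}(w)\ \text{ for } x\notin\{i,j\};$$ the same formulas describe its action on infinite words. The Hanoi Towers group on three pegs is $H^{(3)}=\langle S\rangle$ with $S=\{a_{(01)},a_{(02)},a_{(12)}\}$; write $a=a_{(01)}$, $b=a_{(02)}$, $c=a_{(12)}$ (each is an involution, so $S=S^{-1}$). The Schreier graph $\Gamma_n$ is the $3$-regular graph (with loops) of the action of $H^{(3)}$ with generators $S$ on level $n$ of $\mathcal{T}$: its vertices are the words of length $n$, and for each $s\in S$ each vertex $v$ is joined to $s(v)$. The Schreier graph $\Gamma_{000\dots}$ is the analogous $3$-regular graph of the action on the orbit of the infinite word $000\dots\in\partial\mathcal{T}$. The adjacency matrix of $\Gamma_n$ is $T_n=\rho_n(a)+\rho_n(b)+\rho_n(c)$, where $\rho_n$ is the $3^n$-dimensional permutation representation of $H^{(3)}$ on level $n$ (so each loop contributes $1$ to the diagonal). The Markov operator is $M_n=\frac13T_n$. Similarly $T$ is the adjacency operator of $\Gamma_{000\dots}$, i.e. the sum of the three permutation operators of $a,b,c$ on $\ell^2$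 of the orbit of $000\dots$, and $M=\frac13T$. The spectrum of $\Gamma_n$ (respectively $\Gamma_{000\dots}$) is by definition the spectrum of $M_n$ (respectively $M$); "after re-scaling by $3$" means that the spectrum of $T_n$ (respectively $T$) is described instead. The KNS spectral measure $\nu$ is the (weak) limit of the counting measures $\nu_n$ on $\Gamma_n$, where $\nu_n(B)=m(B)/3^n$ and $m(B)$ is the number of eigenvalues of $\Gamma_n$, counted with multiplicity, in $B$ (here, after re-scaling by $3$, the eigenvalues of $T_n$). $f^{-i}(Y)$ denotes the preimage of the set (or point) $Y$ under the $i$-th iterate of $f$, with $f^{-0}(Y)=Y$; an empty union (such as the one over $0\le j\le n-2$ when $n=1$) is the empty set. The overline denotes closure. *)

theory Defs
  imports
    "HOL-Probability.Weak_Convergence"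
    "HOL-Library.Stream"
    "HOL-Algebra.Bij"
    "HOL-Algebra.Generated_Groups"
    "Jordan_Normal_Form.Spectral_Radius"
begin

section \<open>The Hanoi Towers group and its action\<close>

text \<open>Words and boundary points are lists and streams of natural numbers; the letters that matter
  are 0, 1, 2. All other letters are fixed by the generators.\<close>

fun hanoi_move :: "nat \<Rightarrow> nat \<Rightarrow> nat list \<Rightarrow> nat list" where
  "hanoi_move i j [] = []"
| "hanoi_move i j (x # w) =
     (if x = i then j # w else if x = j then i # w else x # hanoi_move i j w)"

primcorec hanoi_move_inf :: "nat \<Rightarrow> nat \<Rightarrow> nat stream \<Rightarrow> nat stream" where
  "hanoi_move_inf i j w =
     (if shd w = i then j ## stl w else if shd w = j then i ## stl w
      else shd w ## hanoi_move_inf i j (stl w))"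

text \<open>The group is realised by its action on infinite words, which is faithful because a tree
  automorphism is determined by its action on the boundary.\<close>

definition hanoi_group :: "(nat stream \<Rightarrow> nat stream) set" where
  "hanoi_group = generate (BijGroup UNIV)
     {hanoi_move_inf 0 1, hanoi_move_inf 0 2, hanoi_move_inf 1 2}"

definition hanoi_orbit :: "nat stream \<Rightarrow> nat stream set" where
  "hanoi_orbit w = {g w |g. g \<in> hanoi_group}"

section \<open>The finite Schreier graphs\<close>

text \<open>The words of length \<open>n\<close> over \<open>{0, 1, 2}\<close> in lexicographic order; they index the rows and
  columns of the matrices below.\<close>

definition level_words :: "nat \<Rightarrow> nat list list" where
  "level_words n = product_lists (replicate n [0, 1, 2])"

definition perm_mat :: "nat \<Rightarrow> (nat list \<Rightarrow> nat list) \<Rightarrow> complex mat" where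
  "perm_mat n g = mat (3 ^ n) (3 ^ n)
     (\<lambda>(k, l). if level_words n ! k = g (level_words n ! l) then 1 else 0)"

definition schreier_mat :: "nat \<Rightarrow> complex mat" where
  "schreier_mat n =
     perm_mat n (hanoi_move 0 1) + perm_mat n (hanoi_move 0 2) + perm_mat n (hanoi_move 1 2)"

text \<open>Algebraic multiplicity; it agrees with the geometric one since \<^term>\<open>schreier_mat n\<close> is real
  symmetric.\<close>

definition eig_mult :: "nat \<Rightarrow> complex \<Rightarrow> nat" where
  "eig_mult n x = Polynomial.order x (char_poly (schreier_mat n))"

section \<open>The infinite Schreier graph\<close>

definition ell2 :: "'v set \<Rightarrow> ('v \<Rightarrow> complex) set" where
  "ell2 V = {x. (\<forall>v. v \<notin> V \<longrightarrow> x v = 0) \<and> (\<lambda>v. (cmod (x v))\<^sup>2) summable_on V}"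

definition ell2_norm :: "'v set \<Rightarrow> ('v \<Rightarrow> complex) \<Rightarrow> real" where
  "ell2_norm V x = sqrt (\<Sum>\<^sub>\<infinity>v\<in>V. (cmod (x v))\<^sup>2)"

definition bounded_op_ell2 :: "'v set \<Rightarrow> (('v \<Rightarrow> complex) \<Rightarrow> ('v \<Rightarrow> complex)) \<Rightarrow> bool" where
  "bounded_op_ell2 V A \<longleftrightarrow>
     (\<forall>x\<in>ell2 V. A x \<in> ell2 V) \<and>
     (\<forall>x\<in>ell2 V. \<forall>y\<in>ell2 V. A (\<lambda>v. x v + y v) = (\<lambda>v. A x v + A y v)) \<and>
     (\<forall>c. \<forall>x\<in>ell2 V. A (\<lambda>v. c * x v) = (\<lambda>v. c * A x v)) \<and>
     (\<exists>C. \<forall>x\<in>ell2 V. ell2_norm V (A x) \<le> C * ell2_norm V x)"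

text \<open>The complex numbers \<open>z\<close> for which \<open>z - A\<close> has no bounded two-sided inverse \<open>R\<close>.\<close>

definition spectrum_ell2 :: "'v set \<Rightarrow> (('v \<Rightarrow> complex) \<Rightarrow> ('v \<Rightarrow> complex)) \<Rightarrow> complex set" where
  "spectrum_ell2 V A = {z. \<not> (\<exists>R. bounded_op_ell2 V R \<and>
     (\<forall>x\<in>ell2 V. R (\<lambda>v. z * x v - A x v) = x \<and> (\<lambda>v. z * R x v - A (R x) v) = x))}"

text \<open>The permutation operator of \<open>g\<close> sends the delta function at \<open>w\<close> to the one at \<open>g w\<close>.
  As \<^term>\<open>hanoi_orbit w\<close> is invariant under the generators, functions vanishing outside it are
  mapped to such functions.\<close>

definition perm_op :: "('v \<Rightarrow> 'v) \<Rightarrow> ('v \<Rightarrow> complex) \<Rightarrow> ('v \<Rightarrow> complex)" where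
  "perm_op g x = (\<lambda>v. x (inv_into UNIV g v))"

definition schreier_op :: "(nat stream \<Rightarrow> complex) \<Rightarrow> (nat stream \<Rightarrow> complex)" where
  "schreier_op x = (\<lambda>v. perm_op (hanoi_move_inf 0 1) x v + perm_op (hanoi_move_inf 0 2) x v
                 + perm_op (hanoi_move_inf 1 2) x v)"

definition spectrum_000 :: "complex set" where
  "spectrum_000 = spectrum_ell2 (hanoi_orbit (sconst 0)) schreier_op"

section \<open>The polynomial, Julia sets and Cantor sets\<close>

definition hanoi_poly :: "'a::comm_ring_1 \<Rightarrow> 'a" where
  "hanoi_poly x = x\<^sup>2 - x - 3"

text \<open>Normality of a family of holomorphic functions on a connected open set, as maps to the
  Riemann sphere: every sequence in the family has a subsequence that converges locally uniformly
  to a holomorphic function or to \<open>\<infinity>\<close>.\<close>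

definition normal_family_on :: "complex set \<Rightarrow> (complex \<Rightarrow> complex) set \<Rightarrow> bool" where
  "normal_family_on U F \<longleftrightarrow>
     (\<forall>s::nat \<Rightarrow> complex \<Rightarrow> complex. range s \<subseteq> F \<longrightarrow>
        (\<exists>r::nat \<Rightarrow> nat. strict_mono r \<and>
           ((\<exists>g. g holomorphic_on U \<and>
               (\<forall>K. compact K \<longrightarrow> K \<subseteq> U \<longrightarrow> uniform_limit K (\<lambda>n. s (r n)) g sequentially)) \<or>
            (\<forall>K. compact K \<longrightarrow> K \<subseteq> U \<longrightarrow>
               (\<forall>B. \<forall>\<^sub>F n in sequentially. \<forall>z\<in>K. B \<le> cmod (s (r n) z))))))"

definition fatou_set :: "(complex \<Rightarrow> complex) \<Rightarrow> complex set" where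
  "fatou_set p = {z. \<exists>U. open U \<and> connected U \<and> z \<in> U \<and> normal_family_on U (range (\<lambda>n. p ^^ n))}"

text \<open>For a polynomial of degree at least 2 the point \<open>\<infinity>\<close> lies in the Fatou set, so the complement
  may be taken in the plane rather than in the sphere.\<close>

definition julia_set :: "(complex \<Rightarrow> complex) \<Rightarrow> complex set" where
  "julia_set p = - fatou_set p"

definition cantor_set :: "'a::topological_space set \<Rightarrow> bool" where
  "cantor_set C \<longleftrightarrow> C homeomorphic (UNIV :: (nat \<Rightarrow> bool) set)"

section \<open>The KNS spectral measure\<close>

text \<open>\<^term>\<open>schreier_mat n\<close> is real symmetric, so all its eigenvalues are counted by the real ones.\<close>

definition counting_measure :: "nat \<Rightarrow> real measure" where
  "counting_measure n = measure_of UNIV (sets borel)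
     (\<lambda>B. ennreal ((\<Sum>x | x \<in> B \<and> complex_of_real x \<in> spectrum (schreier_mat n).
                      real (eig_mult n (complex_of_real x))) / 3 ^ n))"

definition kns_measure :: "real measure \<Rightarrow> bool" where
  "kns_measure \<nu> \<longleftrightarrow> real_distribution \<nu> \<and> weak_conv_m counting_measure \<nu>"

definition discrete_measure :: "'a measure \<Rightarrow> bool" where
  "discrete_measure M \<longleftrightarrow> (\<exists>A\<in>sets M. countable A \<and> emeasure M (space M - A) = 0)"

end

theory Submission
  imports Defs "HOL-Real_Asymp.Real_Asymp" "HOL-Probability.Probability_Mass_Function"
begin

text \<open>Everything rests on one identity. Prepending a letter turns each vertex \<open>u\<close> of a Schreier graph into a
  triangle with vertices \<open>0u\<close>, \<open>1u\<close>, \<open>2u\<close>. Let \<open>U\<close> be the lift \<open>(U \<phi>)(ku) = \<phi>(u)\<close>, let \<open>U*\<close> be its adjoint, which sums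
  over the first letter, and let \<open>P\<close> be the permutation operator of \<open>ku \<mapsto> k a_ij(u)\<close>, where
  \<open>{i, j, k} = {0, 1, 2}\<close>. Then

    \<open>T' = U U* - 1 + P\<close>, \<open>U* U = 3\<close>, \<open>P\<^sup>2 = 1\<close>, \<open>U* P U = T\<close>,

  where \<open>T\<close> is the adjacency operator and \<open>T'\<close> is the one on words that are longer by one letter; on the
  orbit of \<open>000...\<close> both coincide. With \<open>y = z + 1\<close> and \<open>d = y\<^sup>2 - 1 = z (z + 2)\<close>, the operator \<open>y - P\<close> has
  the inverse \<open>G = (y + P) / d\<close> when \<open>d \<noteq> 0\<close>, so \<open>z - T' = (y - P) (1 - G U U*)\<close>, while
  \<open>1 - U* G U = (d - 3 y - T) / d = (f(z) - T) / d\<close>. Since \<open>1 - A B\<close> and \<open>1 - B A\<close> have the same determinant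
  and are invertible at the same time, \<open>z\<close> is in the spectrum of \<open>T'\<close> iff \<open>f(z)\<close> is in the spectrum of
  \<open>T\<close>, for all \<open>z\<close> other than 0 and -2.

  For the finite graphs, the determinant version (lemma \<open>schreier_mat_resolvent_det\<close>) and the characteristic
  polynomial of the involution \<open>P\<close>, whose trace is 3, give a recursion for the multiplicities
  (lemma \<open>eig_mult_Suc\<close>); it starts from the single eigenvalue 3 of the one-vertex graph, a fixed point
  of \<open>f\<close> with the other preimage -2.

  For the infinite graph, the resolvent version (lemma \<open>spectral_decimation\<close>) makes the spectrum invariant under \<open>f\<close>
  and its inverse off \<open>{0, -2}\<close>. It contains 0, by an explicit finitely supported eigenvector, and it is
  closed and bounded, by the Neumann series. So it contains the backward
  orbit of 0 and each other point of it has a bounded forward orbit or hits -2, which is mapped to 3.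

  The dynamics of \<open>f\<close> is explicit. Orbits that leave the disc of centre 1/2 and radius 5/2 escape; a point
  whose orbit stays in the disc is real, because the imaginary part at least doubles along such an orbit. The set of these points is
  therefore contained in the interval from -2 to 3, has empty interior and is the Julia set. On that interval the two inverse branches of \<open>f\<close>
  are contractions with disjoint images, so itineraries identify the Julia set with the Cantor
  space, and the preimages of 0, an escaping point, accumulate exactly on the Julia set.

  The limit measure is the law of a uniformly chosen point of the \<open>i\<close>-th preimage of \<open>{0, -2}\<close>, where \<open>i\<close> is geometric with
  parameter 1/3. The distribution functions of the counting measures converge to its
  distribution function at every point, since the error terms sum to \<open>O((2/3)\<^sup>n)\<close>.\<close>

section \<open>Dynamics of the polynomial\<close>

lemma hanoi_poly_shift: "hanoi_poly z - 1/2 = (z - 1/2)\<^sup>2 - 15/4" for z :: "'a::field_char_0"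
  by (simp add: hanoi_poly_def power2_eq_square field_simps)

lemma hanoi_poly_of_real: "hanoi_poly (of_real x :: complex) = of_real (hanoi_poly x)"
  by (simp add: hanoi_poly_def)

lemma hanoi_poly_iter_of_real:
  "(hanoi_poly ^^ n) (of_real x :: complex) = of_real ((hanoi_poly ^^ n) x)"
  by (induction n) (simp_all add: hanoi_poly_of_real)

lemma continuous_on_hanoi_poly_iter:
  "continuous_on S (hanoi_poly ^^ n :: 'a \<Rightarrow> 'a::real_normed_field)"
proof (induction n)
  case (Suc n)
  have "continuous_on S (\<lambda>z. ((hanoi_poly ^^ n) z)\<^sup>2 - (hanoi_poly ^^ n) z - 3)"
    by (intro continuous_intros Suc)
  then show ?case by (simp add: hanoi_poly_def[of "(hanoi_poly ^^ n) _"])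
qed (simp add: id_def)

lemma holomorphic_on_hanoi_poly_iter: "(hanoi_poly ^^ n) holomorphic_on S"
proof (induction n)
  case (Suc n)
  have "(\<lambda>z. ((hanoi_poly ^^ n) z)\<^sup>2 - (hanoi_poly ^^ n) z - 3) holomorphic_on S"
    by (intro holomorphic_intros Suc)
  then show ?case by (simp add: hanoi_poly_def[of "(hanoi_poly ^^ n) _"])
qed (simp add: id_def)

subsection \<open>Escaping points and the filled Julia set\<close>

text \<open>In the coordinate \<open>w = z - 1/2\<close> the map is \<open>w \<mapsto> w\<^sup>2 - 15/4\<close>, with 5/2 as a fixed point of derivative 5.
  Outside of the disc of radius 5/2 the distance to the disc grows at least by that factor.\<close>

lemma hanoi_escape_step:
  assumes "5/2 + r \<le> cmod (z - 1/2)" "0 \<le> r"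
  shows "5/2 + 5 * r \<le> cmod (hanoi_poly z - 1/2)"
proof -
  have "(5/2 + r)\<^sup>2 \<le> (cmod (z - 1/2))\<^sup>2"
    using assms by (intro power_mono) auto
  also have "\<dots> = cmod ((z - 1/2)\<^sup>2)" by (simp add: norm_power)
  also have "\<dots> \<le> cmod ((z - 1/2)\<^sup>2 - 15/4) + cmod (15/4)"
    using norm_triangle_ineq[of "(z - 1/2)\<^sup>2 - 15/4" "15/4"] by simp
  finally have "(5/2 + r)\<^sup>2 - 15/4 \<le> cmod (hanoi_poly z - 1/2)"
    by (simp add: hanoi_poly_shift)
  moreover have "(5/2 + r)\<^sup>2 - 15/4 = 5/2 + 5 * r + r\<^sup>2"
    by (simp add: power2_eq_square field_simps)
  ultimately show ?thesis by (smt (verit) zero_le_power2)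
qed

lemma hanoi_escape_iter:
  assumes "5/2 + r \<le> cmod (z - 1/2)" "0 \<le> r"
  shows "5/2 + 5 ^ n * r \<le> cmod ((hanoi_poly ^^ n) z - 1/2)"
proof (induction n)
  case (Suc n)
  then show ?case using hanoi_escape_step[OF Suc] assms by (simp add: mult_ac)
qed (use assms in simp)

text \<open>The points whose whole forward orbit stays in the closed disc of centre 1/2 and radius 5/2. Since
  orbits that leave this disc escape to infinity, this is the filled Julia set; as it turns out to
  have empty interior, it is also the Julia set.\<close>

definition hanoi_filled_julia :: "complex set" where
  "hanoi_filled_julia = {z. \<forall>n. cmod ((hanoi_poly ^^ n) z - 1/2) \<le> 5/2}"

lemma hanoi_filled_julia_forward:
  "z \<in> hanoi_filled_julia \<Longrightarrow> hanoi_poly z \<in> hanoi_filled_julia"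
  unfolding hanoi_filled_julia_def by (simp del: funpow.simps flip: funpow_Suc_right[THEN fun_cong, unfolded comp_def])

lemma hanoi_filled_julia_iter:
  "z \<in> hanoi_filled_julia \<Longrightarrow> (hanoi_poly ^^ n) z \<in> hanoi_filled_julia"
  by (induction n) (auto intro: hanoi_filled_julia_forward)

text \<open>Escape is uniform on a neighbourhood.\<close>

lemma hanoi_escape:
  assumes "5/2 < cmod ((hanoi_poly ^^ N) z - 1/2)"
  shows "\<exists>e>0. \<exists>r>0. \<forall>w\<in>ball z e. \<forall>m. 5/2 + 5 ^ m * r \<le> cmod ((hanoi_poly ^^ (m + N)) w - 1/2)"
proof -
  define h where "h = (\<lambda>w. cmod ((hanoi_poly ^^ N) w - 1/2))"
  define r where "r = (h z - 5/2) / 2"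
  have r: "r > 0" using assms by (simp add: r_def h_def)
  have "continuous_on UNIV h"
    unfolding h_def by (intro continuous_intros continuous_on_hanoi_poly_iter)
  then have "\<exists>e>0. \<forall>w. dist w z < e \<longrightarrow> dist (h w) (h z) < r"
    using r by (auto simp: continuous_on_iff)
  then obtain e where e: "e > 0" "\<And>w. dist w z < e \<Longrightarrow> dist (h w) (h z) < r" by blast
  have "5/2 + 5 ^ m * r \<le> cmod ((hanoi_poly ^^ (m + N)) w - 1/2)" if "w \<in> ball z e" for w m
  proof -
    have "dist (h w) (h z) < r" using that e by (simp add: dist_commute)
    then have "5/2 + r \<le> h w" by (simp add: r_def dist_real_def abs_real_def field_simps split: if_splits)
    then show ?thesis using hanoi_escape_iter[of r "(hanoi_poly ^^ N) w" m] r
      by (simp add: h_def funpow_add)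
  qed
  with e r show ?thesis by blast
qed

lemma hanoi_escape_unbounded:
  assumes "z \<notin> hanoi_filled_julia"
  shows "\<exists>n. B < cmod ((hanoi_poly ^^ n) z)"
proof -
  obtain N where "5/2 < cmod ((hanoi_poly ^^ N) z - 1/2)"
    using assms by (auto simp: hanoi_filled_julia_def not_le)
  from hanoi_escape[OF this] obtain e r where er: "e > 0" "r > 0"
    "\<And>m w. w \<in> ball z e \<Longrightarrow> 5/2 + 5 ^ m * r \<le> cmod ((hanoi_poly ^^ (m + N)) w - 1/2)" by blast
  obtain m where "(\<bar>B\<bar> + 1) / r < 5 ^ m" using real_arch_pow[of 5] by auto
  then have "\<bar>B\<bar> + 1 < 5 ^ m * r" using er by (simp add: field_simps)
  moreover have "5/2 + 5 ^ m * r \<le> cmod ((hanoi_poly ^^ (m + N)) z - 1/2)" using er by simp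
  moreover have "cmod ((hanoi_poly ^^ (m + N)) z - 1/2) \<le> cmod ((hanoi_poly ^^ (m + N)) z) + 1/2"
    using norm_triangle_ineq4[of "(hanoi_poly ^^ (m + N)) z" "1/2"] by simp
  ultimately show ?thesis by (intro exI[of _ "m + N"]) linarith
qed

text \<open>If \<open>w\<^sup>2 - 15/4\<close> has modulus at most 5/2, then the real part of \<open>w\<^sup>2\<close> is at least 5/4; the bound 1
  suffices below.\<close>

lemma hanoi_filled_julia_Re:
  assumes "z \<in> hanoi_filled_julia"
  shows "1 + (Im z)\<^sup>2 \<le> (Re z - 1/2)\<^sup>2"
proof -
  have "cmod ((hanoi_poly ^^ 1) z - 1/2) \<le> 5/2"
    using assms unfolding hanoi_filled_julia_def by blast
  then have "cmod ((z - 1/2)\<^sup>2 - 15/4) \<le> 5/2"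
    by (simp add: hanoi_poly_shift)
  then have "\<bar>Re ((z - 1/2)\<^sup>2 - 15/4)\<bar> \<le> 5/2" using abs_Re_le_cmod order_trans by blast
  moreover have "Re ((z - 1/2)\<^sup>2 - 15/4) = (Re z - 1/2)\<^sup>2 - (Im z)\<^sup>2 - 15/4"
    by (simp add: Re_power2)
  ultimately show ?thesis by (simp only: abs_le_iff) (simp add: field_simps)
qed

lemma hanoi_filled_julia_Im_growth:
  assumes "z \<in> hanoi_filled_julia"
  shows "2 ^ n * \<bar>Im z\<bar> \<le> \<bar>Im ((hanoi_poly ^^ n) z)\<bar>"
proof (induction n)
  case (Suc n)
  let ?w = "(hanoi_poly ^^ n) z"
  have "1 \<le> (Re ?w - 1/2)\<^sup>2"
    using hanoi_filled_julia_Re[OF hanoi_filled_julia_iter[OF assms, of n]]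
    by (smt (verit) zero_le_power2)
  then have "1 \<le> \<bar>Re ?w - 1/2\<bar>" by (metis abs_square_less_1 not_le)
  then have "2 * \<bar>Im ?w\<bar> \<le> \<bar>2 * (Re ?w - 1/2)\<bar> * \<bar>Im ?w\<bar>"
    by (intro mult_right_mono) auto
  also have "\<dots> = \<bar>Im (hanoi_poly ?w)\<bar>"
    by (simp add: hanoi_poly_def Im_power2 algebra_simps flip: abs_mult)
  finally show ?case using Suc by simp
qed simp

text \<open>The imaginary part of \<open>f z\<close> is \<open>2 (Re z - 1/2) (Im z)\<close>, so it at least doubles along an orbit that
  stays in the disc, and such an orbit is real.\<close>

lemma hanoi_filled_julia_Im: "z \<in> hanoi_filled_julia \<Longrightarrow> Im z = 0"
proof (rule ccontr)
  assume z: "z \<in> hanoi_filled_julia" and "Im z \<noteq> 0"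
  then obtain n where "5/2 / \<bar>Im z\<bar> < 2 ^ n" using real_arch_pow[of 2] by auto
  then have "5/2 < 2 ^ n * \<bar>Im z\<bar>" using \<open>Im z \<noteq> 0\<close> by (simp add: field_simps)
  also have "\<dots> \<le> \<bar>Im ((hanoi_poly ^^ n) z)\<bar>" by (rule hanoi_filled_julia_Im_growth[OF z])
  also have "\<dots> \<le> cmod ((hanoi_poly ^^ n) z - 1/2)"
    using abs_Im_le_cmod[of "(hanoi_poly ^^ n) z - 1/2"] by simp
  also have "\<dots> \<le> 5/2" using z by (simp add: hanoi_filled_julia_def)
  finally show False by simp
qed

lemma of_real_in_hanoi_filled_julia:
  "of_real x \<in> hanoi_filled_julia \<longleftrightarrow> (\<forall>n. (hanoi_poly ^^ n) x \<in> {-2..3})"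
proof -
  have "cmod ((hanoi_poly ^^ n) (of_real x) - 1/2) = \<bar>(hanoi_poly ^^ n) x - 1/2\<bar>" for n
  proof -
    have "(hanoi_poly ^^ n) (of_real x) - 1/2 = complex_of_real ((hanoi_poly ^^ n) x - 1/2)"
      by (simp add: hanoi_poly_iter_of_real)
    then show ?thesis by (simp only: norm_of_real)
  qed
  moreover have "\<bar>t - 1/2\<bar> \<le> 5/2 \<longleftrightarrow> t \<in> {-2..3}" for t :: real
    unfolding atLeastAtMost_iff by arith
  ultimately show ?thesis by (simp add: hanoi_filled_julia_def)
qed

lemma hanoi_filled_julia_cases:
  assumes "z \<in> hanoi_filled_julia"
  obtains x where "z = of_real x" "\<And>n. (hanoi_poly ^^ n) x \<in> {-2..3}"
proof -
  have "z = of_real (Re z)" using hanoi_filled_julia_Im[OF assms] by (simp add: complex_eq_iff)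
  with assms that show thesis by (metis of_real_in_hanoi_filled_julia)
qed

lemma compact_hanoi_filled_julia: "compact hanoi_filled_julia"
proof -
  have eq: "hanoi_filled_julia = (\<Inter>n. (\<lambda>z. cmod ((hanoi_poly ^^ n) z - 1/2)) -` {..5/2})"
    by (auto simp: hanoi_filled_julia_def)
  have "closed hanoi_filled_julia"
    unfolding eq
    by (intro closed_INT ballI closed_vimage closed_atMost continuous_intros
        continuous_on_hanoi_poly_iter)
  moreover have "hanoi_filled_julia \<subseteq> cball (1/2) (5/2)"
    by (auto simp: hanoi_filled_julia_def dist_norm norm_minus_commute dest: spec[of _ 0])
  then have "bounded hanoi_filled_julia" using bounded_cball bounded_subset by blast
  ultimately show ?thesis by (simp add: compact_eq_bounded_closed)
qed

subsection \<open>Inverse branches on the invariant interval\<close>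

lemma hanoi_poly_preimage_real:
  assumes "hanoi_poly z = complex_of_real y" "y \<in> {-2..3}"
  shows "\<exists>x\<in>{-2..3}. z = of_real x"
proof -
  have sq: "(z - 1/2)\<^sup>2 = of_real (y + 13/4)"
    using assms(1) hanoi_poly_shift[of z] by (simp add: algebra_simps)
  have "Re ((z - 1/2)\<^sup>2) = y + 13/4" "Im ((z - 1/2)\<^sup>2) = 0" by (simp_all add: sq)
  then have 1: "(Re z - 1/2)\<^sup>2 - (Im z)\<^sup>2 = y + 13/4" "Re z = 1/2 \<or> Im z = 0"
    by (auto simp: Re_power2 Im_power2)
  have "Im z = 0"
  proof (rule ccontr)
    assume "Im z \<noteq> 0"
    then have "Re z - 1/2 = 0" using 1(2) by simp
    then have "y + 13/4 = - (Im z)\<^sup>2" using 1(1) by (simp only: 1(1)[symmetric]) simp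
    moreover have "0 < y + 13/4" using assms(2) by simp
    ultimately show False using zero_le_power2[of "Im z"] by linarith
  qed
  moreover from this 1(1) have "(Re z - 1/2)\<^sup>2 = y + 13/4" by simp
  then have "(Re z - 1/2)\<^sup>2 \<le> (5/2)\<^sup>2" using assms(2) by (simp only:) (simp add: power_divide)
  then have "\<bar>Re z - 1/2\<bar> \<le> \<bar>5/2\<bar>" by (simp only: abs_le_square_iff)
  then have "Re z \<in> {-2..3}" unfolding atLeastAtMost_iff by arith
  ultimately show ?thesis by (intro bexI[of _ "Re z"]) (auto simp: complex_eq_iff)
qed

lemma hanoi_poly_iter_preimage_real:
  assumes "(hanoi_poly ^^ n) z = complex_of_real y" "y \<in> {-2..3}"
  shows "\<exists>x\<in>{-2..3}. z = of_real x"
  using assms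
proof (induction n arbitrary: z)
  case (Suc n)
  then obtain x where "x \<in> {-2..3}" "hanoi_poly z = of_real x"
    by (metis funpow_simps_right(2) o_apply)
  then show ?case using hanoi_poly_preimage_real by blast
qed auto

lemma hanoi_poly_branch:
  fixes y :: real
  assumes "y \<in> {-2..3}"
  shows "\<exists>x\<in>{-2..3}. hanoi_poly x = y \<and> (1/2 < x \<longleftrightarrow> P)"
proof -
  define s where "s = sqrt (y + 13/4)"
  have s2: "s\<^sup>2 = y + 13/4" using assms by (simp add: s_def)
  have s: "0 < s" using assms by (simp add: s_def)
  have "s\<^sup>2 \<le> (5/2)\<^sup>2" using s2 assms by (simp add: power2_eq_square)
  then have s': "s \<le> 5/2" using s by (simp add: abs_le_square_iff[symmetric])
  have 1: "hanoi_poly (1/2 + s) = y" "hanoi_poly (1/2 - s) = y"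
    using s2 by (simp_all add: hanoi_poly_def power2_eq_square field_simps)
  show ?thesis
  proof (cases P)
    case True
    then show ?thesis using s s' 1 by (intro bexI[of _ "1/2 + s"]) auto
  next
    case False
    then show ?thesis using s s' 1 by (intro bexI[of _ "1/2 - s"]) auto
  qed
qed

text \<open>On either side of the critical point 1/2, the map expands distances at least by the factor 2 between points
  whose images lie in the interval.\<close>

lemma hanoi_poly_expand:
  fixes x w :: real
  assumes "hanoi_poly x \<in> {-2..3}" "hanoi_poly w \<in> {-2..3}" "1/2 < x \<longleftrightarrow> 1/2 < w"
  shows "2 * \<bar>x - w\<bar> \<le> \<bar>hanoi_poly x - hanoi_poly w\<bar>"
proof -
  have far: "1 \<le> \<bar>t - 1/2\<bar>" if "hanoi_poly t \<in> {-2..3}" for t :: real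
  proof -
    have "(t - 1/2)\<^sup>2 = hanoi_poly t + 13/4" using hanoi_poly_shift[of t] by simp
    then have "1 \<le> (t - 1/2)\<^sup>2" using that by simp
    then show ?thesis by (metis abs_square_less_1 not_le)
  qed
  have "2 \<le> \<bar>x + w - 1\<bar>"
    using far[OF assms(1)] far[OF assms(2)] assms(3) by (auto simp: abs_real_def split: if_splits)
  then have "2 * \<bar>x - w\<bar> \<le> \<bar>x + w - 1\<bar> * \<bar>x - w\<bar>" by (intro mult_right_mono) auto
  also have "\<dots> = \<bar>hanoi_poly x - hanoi_poly w\<bar>"
    by (simp add: hanoi_poly_def power2_eq_square algebra_simps flip: abs_mult)
  finally show ?thesis .
qed

text \<open>An itinerary records on which side of the critical point 1/2 each iterate lies. Every finite
  itinerary occurs on the way to every point of the interval, and it determines the starting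
  point up to an error that decays geometrically.\<close>

lemma hanoi_poly_itinerary_exists:
  fixes y :: real
  assumes "y \<in> {-2..3}"
  shows "\<exists>x. (hanoi_poly ^^ n) x = y \<and> (\<forall>i\<le>n. (hanoi_poly ^^ i) x \<in> {-2..3}) \<and>
     (\<forall>i<n. 1/2 < (hanoi_poly ^^ i) x \<longleftrightarrow> s i)"
proof (induction n arbitrary: s)
  case 0
  then show ?case using assms by auto
next
  case (Suc n)
  from Suc[of "\<lambda>i. s (Suc i)"] obtain x' where x': "(hanoi_poly ^^ n) x' = y"
    "\<And>i. i \<le> n \<Longrightarrow> (hanoi_poly ^^ i) x' \<in> {-2..3}"
    "\<And>i. i < n \<Longrightarrow> 1/2 < (hanoi_poly ^^ i) x' \<longleftrightarrow> s (Suc i)" by blast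
  have "x' \<in> {-2..3}" using x'(2)[of 0] by simp
  from hanoi_poly_branch[OF this, of "s 0"] obtain x where
    x: "x \<in> {-2..3}" "hanoi_poly x = x'" "1/2 < x \<longleftrightarrow> s 0" by blast
  have step: "(hanoi_poly ^^ Suc i) x = (hanoi_poly ^^ i) x'" for i
    using x by (metis funpow_simps_right(2) o_apply)
  have "(hanoi_poly ^^ i) x \<in> {-2..3}" if "i \<le> Suc n" for i
    using that x x'(2) step by (cases i) (auto simp del: funpow.simps simp: funpow_0)
  moreover have "1/2 < (hanoi_poly ^^ i) x \<longleftrightarrow> s i" if "i < Suc n" for i
    using that x x'(3) step by (cases i) (auto simp del: funpow.simps simp: funpow_0)
  ultimately show ?case using step[of n] x'(1) by blast
qed

lemma hanoi_poly_itinerary_contract: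
  fixes x w :: real
  assumes "\<forall>i\<le>n. (hanoi_poly ^^ i) x \<in> {-2..3}" "\<forall>i\<le>n. (hanoi_poly ^^ i) w \<in> {-2..3}"
    "\<forall>i<n. 1/2 < (hanoi_poly ^^ i) x \<longleftrightarrow> 1/2 < (hanoi_poly ^^ i) w"
  shows "\<bar>x - w\<bar> \<le> 5 / 2 ^ n"
proof -
  have "2 ^ k * \<bar>x - w\<bar> \<le> \<bar>(hanoi_poly ^^ k) x - (hanoi_poly ^^ k) w\<bar>" if "k \<le> n" for k
    using that
  proof (induction k)
    case (Suc k)
    have "2 ^ Suc k * \<bar>x - w\<bar> \<le> 2 * \<bar>(hanoi_poly ^^ k) x - (hanoi_poly ^^ k) w\<bar>"
      using Suc by simp
    also have "\<dots> \<le> \<bar>hanoi_poly ((hanoi_poly ^^ k) x) - hanoi_poly ((hanoi_poly ^^ k) w)\<bar>"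
      using Suc.prems assms(1)[rule_format, of "Suc k"] assms(2)[rule_format, of "Suc k"] assms(3)
      by (intro hanoi_poly_expand) auto
    finally show ?case by simp
  qed simp
  from this[of n] have "2 ^ n * \<bar>x - w\<bar> \<le> \<bar>(hanoi_poly ^^ n) x - (hanoi_poly ^^ n) w\<bar>" by simp
  also have "\<dots> \<le> 5" using assms(1)[rule_format, of n] assms(2)[rule_format, of n] by auto
  finally show ?thesis by (simp add: field_simps)
qed

subsection \<open>Preimages of the points 0 and -2\<close>

lemma cmod_of_real_minus_half: "cmod (complex_of_real x - 1/2) = \<bar>x - 1/2\<bar>"
proof -
  have "complex_of_real x - 1/2 = complex_of_real (x - 1/2)" by simp
  then show ?thesis by (simp only: norm_of_real)
qed

lemma real_below_interval_escape:
  fixes x :: real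
  assumes "x < -2"
  shows "(hanoi_poly ^^ n) x \<notin> {-2..3}"
proof -
  define r where "r = - 2 - x"
  have r: "r > 0" using assms by (simp add: r_def)
  have "5/2 + r \<le> cmod (of_real x - 1/2)"
    unfolding cmod_of_real_minus_half using assms by (simp add: r_def)
  from hanoi_escape_iter[OF this, of n] r
  have "5/2 < cmod ((hanoi_poly ^^ n) (of_real x) - 1/2)"
    by (smt (verit) zero_less_mult_iff zero_less_power)
  also have "cmod ((hanoi_poly ^^ n) (of_real x) - 1/2) = \<bar>(hanoi_poly ^^ n) x - 1/2\<bar>"
    by (simp only: hanoi_poly_iter_of_real cmod_of_real_minus_half)
  finally show ?thesis unfolding atLeastAtMost_iff by arith
qed

lemma hanoi_poly_iter_0_outside: "(hanoi_poly ^^ Suc n) (0::real) \<notin> {-2..3}"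
  using real_below_interval_escape[of "-3" n] by (simp add: funpow_swap1 hanoi_poly_def)

lemma hanoi_poly_iter_3: "(hanoi_poly ^^ n) (3 :: 'a::comm_ring_1) = 3"
  by (induction n) (simp_all add: hanoi_poly_def)

lemma hanoi_poly_iter_minus2: "(hanoi_poly ^^ Suc n) (-2 :: 'a::comm_ring_1) = 3"
  using hanoi_poly_iter_3[of n] by (simp add: funpow_swap1 hanoi_poly_def)

lemma hanoi_poly_vimage_real:
  fixes y :: real
  assumes "y \<in> {-2..3}"
  shows "card (hanoi_poly -` {y}) = 2" "hanoi_poly -` {y} \<subseteq> {-2..3}"
proof -
  define s where "s = sqrt (y + 13/4)"
  have s: "0 < s" "s\<^sup>2 = y + 13/4" using assms by (auto simp: s_def)
  have "hanoi_poly x = y \<longleftrightarrow> x = 1/2 + s \<or> x = 1/2 - s" for x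
  proof -
    have "hanoi_poly x = y \<longleftrightarrow> (x - 1/2)\<^sup>2 = s\<^sup>2"
      using s(2) hanoi_poly_shift[of x] by auto
    also have "\<dots> \<longleftrightarrow> x = 1/2 + s \<or> x = 1/2 - s"
      by (auto simp: power2_eq_iff)
    finally show ?thesis .
  qed
  then have eq: "hanoi_poly -` {y} = {1/2 + s, 1/2 - s}" by auto
  show "card (hanoi_poly -` {y}) = 2" unfolding eq using s(1) by simp
  have "s\<^sup>2 \<le> (5/2)\<^sup>2" using s(2) assms by (simp add: power2_eq_square)
  then have "s \<le> 5/2" using s(1) by (simp add: abs_le_square_iff[symmetric])
  then show "hanoi_poly -` {y} \<subseteq> {-2..3}" unfolding eq using s(1) by auto
qed

lemma card_hanoi_poly_iter_vimage_real:
  fixes y :: real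
  assumes "y \<in> {-2..3}"
  shows "card ((hanoi_poly ^^ n) -` {y}) = 2 ^ n \<and> (hanoi_poly ^^ n) -` {y} \<subseteq> {-2..3}"
proof (induction n)
  case 0
  then show ?case using assms by (simp add: vimage_def)
next
  case (Suc n)
  let ?V = "(hanoi_poly ^^ n) -` {y}"
  have eq: "(hanoi_poly ^^ Suc n) -` {y} = (\<Union>u\<in>?V. hanoi_poly -` {u})"
    by (auto simp: funpow_swap1)
  have "finite ?V" using Suc card_ge_0_finite by fastforce
  moreover have "finite (hanoi_poly -` {u})" if "u \<in> ?V" for u
    using hanoi_poly_vimage_real(1)[of u] Suc that by (intro card_ge_0_finite) auto
  ultimately have "card ((hanoi_poly ^^ Suc n) -` {y}) = (\<Sum>u\<in>?V. card (hanoi_poly -` {u}))"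
    unfolding eq by (intro card_UN_disjoint) auto
  also have "\<dots> = (\<Sum>u\<in>?V. 2)"
    using Suc hanoi_poly_vimage_real(1) by (intro sum.cong) auto
  also have "\<dots> = 2 ^ Suc n" using Suc by simp
  finally show ?case using Suc hanoi_poly_vimage_real(2) unfolding eq by blast
qed

lemma finite_hanoi_poly_iter_vimage_real:
  fixes y :: real
  assumes "y \<in> {-2..3}"
  shows "finite ((hanoi_poly ^^ n) -` {y})"
  using card_hanoi_poly_iter_vimage_real[OF assms, of n] by (intro card_ge_0_finite) simp

lemma hanoi_poly_iter_vimage_of_real:
  assumes "y \<in> {-2..3}"
  shows "(hanoi_poly ^^ n) -` {complex_of_real y} = of_real ` ((hanoi_poly ^^ n) -` {y})"
proof (intro equalityI subsetI)
  fix z :: complex assume "z \<in> (hanoi_poly ^^ n) -` {complex_of_real y}"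
  then have z: "(hanoi_poly ^^ n) z = of_real y" by simp
  from hanoi_poly_iter_preimage_real[OF this assms] obtain x where "z = of_real x" by blast
  with z show "z \<in> of_real ` ((hanoi_poly ^^ n) -` {y})" by (simp add: hanoi_poly_iter_of_real)
qed (auto simp: hanoi_poly_iter_of_real)

lemma card_hanoi_poly_iter_vimage:
  assumes "y \<in> {-2..3}"
  shows "card ((hanoi_poly ^^ n) -` {complex_of_real y}) = 2 ^ n"
  unfolding hanoi_poly_iter_vimage_of_real[OF assms]
  using card_hanoi_poly_iter_vimage_real[OF assms, of n]
  by (simp add: card_image inj_on_def)

lemma finite_hanoi_poly_iter_vimage:
  assumes "y \<in> {-2..3}"
  shows "finite ((hanoi_poly ^^ n) -` {complex_of_real y})"
  unfolding hanoi_poly_iter_vimage_of_real[OF assms]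
  using finite_hanoi_poly_iter_vimage_real[OF assms] by simp

text \<open>The backward orbit of 0.\<close>

definition hanoi_zeros :: "complex set" where
  "hanoi_zeros = (\<Union>i. (hanoi_poly ^^ i) -` {0})"

lemma hanoi_zeros_not_filled: "z \<in> hanoi_zeros \<Longrightarrow> z \<notin> hanoi_filled_julia"
proof
  assume "z \<in> hanoi_zeros" "z \<in> hanoi_filled_julia"
  then obtain i where "(hanoi_poly ^^ i) z = 0" by (auto simp: hanoi_zeros_def)
  then have "complex_of_real 0 \<in> hanoi_filled_julia"
    using hanoi_filled_julia_iter[OF \<open>z \<in> hanoi_filled_julia\<close>, of i] by simp
  then show False
    using hanoi_poly_iter_0_outside[of 0] unfolding of_real_in_hanoi_filled_julia by blast
qed

lemma three_in_hanoi_filled_julia: "3 \<in> hanoi_filled_julia"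
  using of_real_in_hanoi_filled_julia[of 3] by (simp add: hanoi_poly_iter_3)

lemma hanoi_filled_julia_backward:
  assumes "(hanoi_poly ^^ i) z \<in> hanoi_filled_julia"
  shows "z \<in> hanoi_filled_julia"
proof (rule ccontr)
  assume "z \<notin> hanoi_filled_julia"
  then obtain N where "5/2 < cmod ((hanoi_poly ^^ N) z - 1/2)"
    by (auto simp: hanoi_filled_julia_def not_le)
  from hanoi_escape[OF this] obtain r where r: "r > 0"
    "\<And>m. 5/2 + 5 ^ m * r \<le> cmod ((hanoi_poly ^^ (m + N)) z - 1/2)"
    by (metis centre_in_ball)
  have "cmod ((hanoi_poly ^^ N) ((hanoi_poly ^^ i) z) - 1/2) \<le> 5/2"
    using assms by (simp add: hanoi_filled_julia_def)
  moreover have "(hanoi_poly ^^ N) ((hanoi_poly ^^ i) z) = (hanoi_poly ^^ (i + N)) z"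
    by (simp add: funpow_add add.commute[of i N])
  ultimately show False using r(2)[of i] r(1) by (smt (verit) mult_pos_pos zero_less_power)
qed

lemma minus2_preimage_in_hanoi_filled_julia:
  assumes "(hanoi_poly ^^ i) z = -2"
  shows "z \<in> hanoi_filled_julia"
proof (rule hanoi_filled_julia_backward)
  have "hanoi_poly (-2) = (3::complex)" by (simp add: hanoi_poly_def)
  then show "(hanoi_poly ^^ Suc i) z \<in> hanoi_filled_julia"
    using assms three_in_hanoi_filled_julia by simp
qed

subsection \<open>Accumulation points of the backward orbit\<close>

text \<open>Near a point that has left the disc after \<open>N\<close> steps, no iterate from the \<open>N\<close>-th on vanishes, so
  only finitely many preimages of 0 are nearby.\<close>

lemma islimpt_hanoi_zeros_imp_filled:
  assumes "z islimpt hanoi_zeros"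
  shows "z \<in> hanoi_filled_julia"
proof (rule ccontr)
  assume "z \<notin> hanoi_filled_julia"
  then obtain N where "5/2 < cmod ((hanoi_poly ^^ N) z - 1/2)"
    by (auto simp: hanoi_filled_julia_def not_le)
  from hanoi_escape[OF this] obtain e r where er: "e > 0" "r > 0"
    "\<And>m w. w \<in> ball z e \<Longrightarrow> 5/2 + 5 ^ m * r \<le> cmod ((hanoi_poly ^^ (m + N)) w - 1/2)" by blast
  have "hanoi_zeros \<inter> ball z e \<subseteq> (\<Union>i<N. (hanoi_poly ^^ i) -` {0})"
  proof
    fix w assume w: "w \<in> hanoi_zeros \<inter> ball z e"
    then obtain i where i: "(hanoi_poly ^^ i) w = 0" by (auto simp: hanoi_zeros_def)
    have "i < N"
    proof (rule ccontr)
      assume "\<not> i < N"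
      then have "5/2 + 5 ^ (i - N) * r \<le> cmod (0 - 1/2)" using er(3)[of w "i - N"] w i by simp
      moreover have "0 < 5 ^ (i - N) * r" using er(2) by simp
      ultimately show False by (simp add: norm_divide)
    qed
    with i show "w \<in> (\<Union>i<N. (hanoi_poly ^^ i) -` {0})" by blast
  qed
  moreover have "finite (\<Union>i<N. (hanoi_poly ^^ i) -` {0::complex})"
    using finite_hanoi_poly_iter_vimage[of 0] by auto
  ultimately have "finite (hanoi_zeros \<inter> ball z e)" by (rule finite_subset)
  with assms er(1) show False by (auto simp: islimpt_eq_infinite_ball)
qed

text \<open>A preimage of 0 that follows the itinerary of \<open>z\<close> for \<open>n\<close> steps lies within \<open>5 / 2\<^sup>n\<close> of \<open>z\<close>.\<close>

lemma filled_imp_islimpt_hanoi_zeros: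
  assumes "z \<in> hanoi_filled_julia"
  shows "z islimpt hanoi_zeros"
  unfolding islimpt_approachable
proof (intro allI impI)
  fix e :: real assume "e > 0"
  obtain x where x: "z = of_real x" "\<And>n. (hanoi_poly ^^ n) x \<in> {-2..3}"
    using hanoi_filled_julia_cases[OF assms] by blast
  obtain n where "5 / e < 2 ^ n" using real_arch_pow[of 2] by auto
  then have n: "5 / 2 ^ n < e" using \<open>e > 0\<close> by (simp add: field_simps)
  obtain w :: real where w: "(hanoi_poly ^^ n) w = 0" "\<forall>i\<le>n. (hanoi_poly ^^ i) w \<in> {-2..3}"
     "\<forall>i<n. 1/2 < (hanoi_poly ^^ i) w \<longleftrightarrow> 1/2 < (hanoi_poly ^^ i) x"
    using hanoi_poly_itinerary_exists[of 0 n "\<lambda>i. 1/2 < (hanoi_poly ^^ i) x"] by auto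
  have "\<bar>w - x\<bar> \<le> 5 / 2 ^ n"
    using w x by (intro hanoi_poly_itinerary_contract) auto
  with n have "dist (complex_of_real w) z < e" by (simp add: x dist_norm flip: of_real_diff)
  moreover have "complex_of_real w \<in> hanoi_zeros"
    using w(1) hanoi_poly_iter_of_real[of n w] by (auto simp: hanoi_zeros_def)
  moreover from this assms have "complex_of_real w \<noteq> z" using hanoi_zeros_not_filled by blast
  ultimately show "\<exists>x'\<in>hanoi_zeros. x' \<noteq> z \<and> dist x' z < e" by blast
qed

lemma islimpt_hanoi_zeros: "z islimpt hanoi_zeros \<longleftrightarrow> z \<in> hanoi_filled_julia"
  using islimpt_hanoi_zeros_imp_filled filled_imp_islimpt_hanoi_zeros by blast

lemma closure_hanoi_zeros: "closure hanoi_zeros = hanoi_zeros \<union> hanoi_filled_julia"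
  by (simp add: closure_def islimpt_hanoi_zeros)

lemma islimpt_closure_hanoi_zeros:
  "z islimpt closure hanoi_zeros \<longleftrightarrow> z \<in> hanoi_filled_julia"
  by (simp add: limpt_of_closure islimpt_hanoi_zeros)

lemma closure_hanoi_backward_orbits:
  "closure ({3} \<union> (\<Union>i. (hanoi_poly ^^ i) -` {0, -2})) = closure hanoi_zeros"
proof (rule antisym)
  have "{3} \<union> (\<Union>i. (hanoi_poly ^^ i) -` {0, -2}) \<subseteq> closure hanoi_zeros"
    unfolding closure_hanoi_zeros
    using three_in_hanoi_filled_julia minus2_preimage_in_hanoi_filled_julia
    by (auto simp: hanoi_zeros_def)
  then show "closure ({3} \<union> (\<Union>i. (hanoi_poly ^^ i) -` {0, -2})) \<subseteq> closure hanoi_zeros"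
    by (meson closed_closure closure_minimal)
  show "closure hanoi_zeros \<subseteq> closure ({3} \<union> (\<Union>i. (hanoi_poly ^^ i) -` {0, -2}))"
    by (intro closure_mono) (auto simp: hanoi_zeros_def)
qed

subsection \<open>The Julia set\<close>

text \<open>A sequence of iterates either repeats one iterate infinitely often, or its indices tend to
  infinity and it diverges uniformly near an escaping point.\<close>

lemma not_filled_imp_fatou:
  assumes "z \<notin> hanoi_filled_julia"
  shows "z \<in> fatou_set hanoi_poly"
proof -
  obtain N where "5/2 < cmod ((hanoi_poly ^^ N) z - 1/2)"
    using assms by (auto simp: hanoi_filled_julia_def not_le)
  from hanoi_escape[OF this] obtain e r where er: "e > 0" "r > 0"
    "\<And>m w. w \<in> ball z e \<Longrightarrow> 5/2 + 5 ^ m * r \<le> cmod ((hanoi_poly ^^ (m + N)) w - 1/2)" by blast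
  have "normal_family_on (ball z e) (range (\<lambda>n. hanoi_poly ^^ n))"
    unfolding normal_family_on_def
  proof (intro allI impI)
    fix s :: "nat \<Rightarrow> complex \<Rightarrow> complex"
    assume "range s \<subseteq> range (\<lambda>n. hanoi_poly ^^ n)"
    then have "\<forall>n. \<exists>k. s n = hanoi_poly ^^ k" by auto
    then obtain k where k: "\<And>n. s n = hanoi_poly ^^ k n" by metis
    show "\<exists>r::nat \<Rightarrow> nat. strict_mono r \<and>
           ((\<exists>g. g holomorphic_on ball z e \<and>
               (\<forall>K. compact K \<longrightarrow> K \<subseteq> ball z e \<longrightarrow> uniform_limit K (\<lambda>n. s (r n)) g sequentially)) \<or>
            (\<forall>K. compact K \<longrightarrow> K \<subseteq> ball z e \<longrightarrow>
               (\<forall>B. \<forall>\<^sub>F n in sequentially. \<forall>z\<in>K. B \<le> cmod (s (r n) z))))"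
    proof (cases "\<exists>m. infinite {n. k n = m}")
      case True
      then obtain m where "infinite {n. k n = m}" by blast
      then obtain q :: "nat \<Rightarrow> nat" where q: "strict_mono q" "\<forall>n. q n \<in> {n. k n = m}"
        using infinite_enumerate by blast
      then have "(\<lambda>n. s (q n)) = (\<lambda>n. hanoi_poly ^^ m)" using k by auto
      then show ?thesis using q(1) holomorphic_on_hanoi_poly_iter uniform_limit_const by metis
    next
      case False
      have "\<forall>\<^sub>F n in sequentially. \<forall>w\<in>K. B \<le> cmod (s n w)" if K: "K \<subseteq> ball z e" for K B
      proof -
        obtain M where "(\<bar>B\<bar> + 1) / r < 5 ^ M" using real_arch_pow[of 5] by auto
        then have M: "\<bar>B\<bar> + 1 < 5 ^ M * r" using er by (simp add: field_simps)
        have "{n. k n < M + N} = (\<Union>m\<in>{..<M + N}. {n. k n = m})" by auto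
        moreover have "finite (\<Union>m\<in>{..<M + N}. {n. k n = m})"
          by (rule finite_UN_I) (use False in auto)
        ultimately have "finite {n. k n < M + N}" by (simp only:)
        then have "\<forall>\<^sub>F n in cofinite. M + N \<le> k n"
          by (simp add: eventually_cofinite not_le)
        then have "\<forall>\<^sub>F n in sequentially. M + N \<le> k n"
          by (simp only: cofinite_eq_sequentially)
        then show ?thesis
        proof eventually_elim
          case (elim n)
          show ?case
          proof
            fix w assume "w \<in> K"
            let ?v = "(hanoi_poly ^^ k n) w"
            have "5/2 + 5 ^ (k n - N) * r \<le> cmod (?v - 1/2)"
              using er(3)[of w "k n - N"] \<open>w \<in> K\<close> K elim by auto
            moreover have "5 ^ M * r \<le> 5 ^ (k n - N) * r"
              using elim er(2) by (intro mult_right_mono power_increasing) auto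
            moreover have "cmod (?v - 1/2) \<le> cmod ?v + 1/2"
              using norm_triangle_ineq4[of ?v "1/2"] by simp
            ultimately show "B \<le> cmod (s n w)" using M unfolding k by linarith
          qed
        qed
      qed
      then show ?thesis by (intro exI[of _ id]) (auto simp: strict_mono_id)
    qed
  qed
  with er(1) show ?thesis unfolding fatou_set_def
    by (intro CollectI exI[of _ "ball z e"]) auto
qed

lemma filled_imp_not_fatou:
  assumes "z \<in> hanoi_filled_julia"
  shows "z \<notin> fatou_set hanoi_poly"
proof
  assume "z \<in> fatou_set hanoi_poly"
  then obtain U where U: "open U" "z \<in> U"
    and normal: "normal_family_on U (range (\<lambda>n. hanoi_poly ^^ n))"
    by (auto simp: fatou_set_def)
  obtain q :: "nat \<Rightarrow> nat" where q: "strict_mono q" and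
    lim: "(\<exists>g. g holomorphic_on U \<and>
               (\<forall>K. compact K \<longrightarrow> K \<subseteq> U \<longrightarrow> uniform_limit K (\<lambda>n. hanoi_poly ^^ (q n)) g sequentially)) \<or>
          (\<forall>K. compact K \<longrightarrow> K \<subseteq> U \<longrightarrow>
               (\<forall>B. \<forall>\<^sub>F n in sequentially. \<forall>z\<in>K. B \<le> cmod ((hanoi_poly ^^ (q n)) z)))"
    using normal[unfolded normal_family_on_def, rule_format, of "\<lambda>n. hanoi_poly ^^ n"] by auto
  from lim show False
  proof
    assume "\<exists>g. g holomorphic_on U \<and>
               (\<forall>K. compact K \<longrightarrow> K \<subseteq> U \<longrightarrow> uniform_limit K (\<lambda>n. hanoi_poly ^^ (q n)) g sequentially)"
    then obtain g where g: "\<And>K. compact K \<Longrightarrow> K \<subseteq> U \<Longrightarrow>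
      uniform_limit K (\<lambda>n. hanoi_poly ^^ (q n)) g sequentially" by blast
    obtain d where d: "d > 0" "cball z d \<subseteq> U" using U open_contains_cball by blast
    \<comment> \<open>Points off the real axis escape, so a finite limit function is impossible near them.\<close>
    define w where "w = z + \<i> * of_real d"
    have "Im w \<noteq> 0" using hanoi_filled_julia_Im[OF assms] d(1) by (simp add: w_def)
    then have "w \<notin> hanoi_filled_julia" using hanoi_filled_julia_Im by blast
    then obtain N where "5/2 < cmod ((hanoi_poly ^^ N) w - 1/2)"
      by (auto simp: hanoi_filled_julia_def not_le)
    from hanoi_escape[OF this] obtain r where r: "r > 0"
      "\<And>m. 5/2 + 5 ^ m * r \<le> cmod ((hanoi_poly ^^ (m + N)) w - 1/2)"
      by (metis centre_in_ball)
    have "w \<in> U" using d by (auto simp: w_def dist_norm norm_mult intro!: subsetD[OF d(2)])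
    then have "uniform_limit {w} (\<lambda>n. hanoi_poly ^^ (q n)) g sequentially" by (intro g) auto
    then have "(\<lambda>n. (hanoi_poly ^^ (q n)) w) \<longlonglongrightarrow> g w"
      by (rule tendsto_uniform_limitI) simp
    then have "Bseq (\<lambda>n. (hanoi_poly ^^ (q n)) w)" by (simp add: convergentI convergent_imp_Bseq)
    then obtain B where B: "\<And>n. cmod ((hanoi_poly ^^ (q n)) w) \<le> B" by (auto simp: Bseq_def)
    obtain M where "(\<bar>B\<bar> + 1) / r < 5 ^ M" using real_arch_pow[of 5] by auto
    then have M: "\<bar>B\<bar> + 1 < 5 ^ M * r" using r by (simp add: field_simps)
    let ?k = "q (M + N)"
    have k: "M + N \<le> ?k" using q by (simp add: seq_suble)
    then have "5/2 + 5 ^ (?k - N) * r \<le> cmod ((hanoi_poly ^^ ?k) w - 1/2)"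
      using r(2)[of "?k - N"] by simp
    moreover have "5 ^ M * r \<le> 5 ^ (?k - N) * r"
      using k r(1) by (intro mult_right_mono power_increasing) auto
    moreover have "cmod ((hanoi_poly ^^ ?k) w - 1/2) \<le> cmod ((hanoi_poly ^^ ?k) w) + 1/2"
      using norm_triangle_ineq4[of "(hanoi_poly ^^ ?k) w" "1/2"] by simp
    ultimately show False using M B[of "M + N"] by linarith
  next
    assume H: "\<forall>K. compact K \<longrightarrow> K \<subseteq> U \<longrightarrow>
               (\<forall>B. \<forall>\<^sub>F n in sequentially. \<forall>z\<in>K. B \<le> cmod ((hanoi_poly ^^ (q n)) z))"
    have "\<forall>\<^sub>F n in sequentially. \<forall>v\<in>{z}. 4 \<le> cmod ((hanoi_poly ^^ (q n)) v)"
      using U(2) by (intro H[rule_format, of "{z}" 4]) auto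
    then obtain n where n: "4 \<le> cmod ((hanoi_poly ^^ (q n)) z)"
      by (auto simp: eventually_sequentially)
    have "cmod ((hanoi_poly ^^ (q n)) z - 1/2) \<le> 5/2"
      using assms by (simp add: hanoi_filled_julia_def)
    moreover have "cmod ((hanoi_poly ^^ (q n)) z) \<le> cmod ((hanoi_poly ^^ (q n)) z - 1/2) + 1/2"
      using norm_triangle_sub[of "(hanoi_poly ^^ (q n)) z" "1/2"] by simp
    ultimately show False using n by linarith
  qed
qed

lemma julia_set_hanoi_poly: "julia_set hanoi_poly = hanoi_filled_julia"
  unfolding julia_set_def using not_filled_imp_fatou filled_imp_not_fatou by blast

subsection \<open>Symbolic coding of the Julia set\<close>

text \<open>The itinerary of a point with respect to the critical point 1/2; it is a homeomorphism from the filled Julia set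
  to the Cantor space.\<close>

definition hanoi_itinerary :: "complex \<Rightarrow> nat \<Rightarrow> bool" where
  "hanoi_itinerary z n \<longleftrightarrow> 1/2 < Re ((hanoi_poly ^^ n) z)"

lemma hanoi_filled_julia_Re_neq:
  assumes "z \<in> hanoi_filled_julia"
  shows "Re ((hanoi_poly ^^ n) z) \<noteq> 1/2"
  using hanoi_filled_julia_Re[OF hanoi_filled_julia_iter[OF assms, of n]]
  by (smt (verit) zero_le_power2 power_zero_numeral)

lemma continuous_on_Re_hanoi_poly_iter:
  "continuous_on S (\<lambda>z. Re ((hanoi_poly ^^ n) z))"
  by (intro continuous_intros continuous_on_hanoi_poly_iter)

lemma continuous_on_hanoi_itinerary: "continuous_on hanoi_filled_julia hanoi_itinerary"
proof (rule continuous_on_coordinatewise_then_product)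
  fix n
  have op: "open {y. 1/2 < Re ((hanoi_poly ^^ n) y)}" "open {y. Re ((hanoi_poly ^^ n) y) < 1/2}"
    by (intro open_Collect_less continuous_on_const continuous_on_Re_hanoi_poly_iter)+
  show "continuous_on hanoi_filled_julia (\<lambda>z. hanoi_itinerary z n)"
    unfolding continuous_on_topological
  proof (intro ballI allI impI)
    fix x B assume x: "x \<in> hanoi_filled_julia" and B: "hanoi_itinerary x n \<in> B"
    show "\<exists>A. open A \<and> x \<in> A \<and> (\<forall>y\<in>hanoi_filled_julia. y \<in> A \<longrightarrow> hanoi_itinerary y n \<in> B)"
    proof (cases "hanoi_itinerary x n")
      case True
      then show ?thesis using op(1) B by (intro exI[of _ "{y. 1/2 < Re ((hanoi_poly ^^ n) y)}"])
          (auto simp: hanoi_itinerary_def)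
    next
      case False
      then have "Re ((hanoi_poly ^^ n) x) < 1/2"
        using hanoi_filled_julia_Re_neq[OF x, of n] by (simp add: hanoi_itinerary_def)
      then show ?thesis using op(2) B False
        by (intro exI[of _ "{y. Re ((hanoi_poly ^^ n) y) < 1/2}"]) (auto simp: hanoi_itinerary_def)
    qed
  qed
qed

lemma surj_hanoi_itinerary: "hanoi_itinerary ` hanoi_filled_julia = UNIV"
proof (intro equalityI subsetI UNIV_I)
  fix s :: "nat \<Rightarrow> bool"
  define F where "F n = hanoi_filled_julia \<inter>
    (\<Inter>i\<in>{..<n}. if s i then {z. 1/2 \<le> Re ((hanoi_poly ^^ i) z)} else {z. Re ((hanoi_poly ^^ i) z) \<le> 1/2})" for n
  have "compact (F n)" for n
    unfolding F_def
    by (intro compact_Int_closed compact_hanoi_filled_julia closed_INT)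
      (auto intro!: closed_Collect_le continuous_on_Re_hanoi_poly_iter continuous_intros)
  moreover have "F n \<noteq> {}" for n
  proof -
    obtain w where w: "(hanoi_poly ^^ n) w = 3" "\<forall>i\<le>n. (hanoi_poly ^^ i) w \<in> {-2..3::real}"
     "\<forall>i<n. 1/2 < (hanoi_poly ^^ i) w \<longleftrightarrow> s i"
      using hanoi_poly_itinerary_exists[of 3 n s] by auto
    have "(hanoi_poly ^^ n) (complex_of_real w) = 3" using w(1) by (simp add: hanoi_poly_iter_of_real)
    then have "(hanoi_poly ^^ n) (complex_of_real w) \<in> hanoi_filled_julia"
      by (simp only: three_in_hanoi_filled_julia)
    then have "complex_of_real w \<in> hanoi_filled_julia" by (rule hanoi_filled_julia_backward)
    moreover have "complex_of_real w \<in> (if s i then {z. 1/2 \<le> Re ((hanoi_poly ^^ i) z)}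
        else {z. Re ((hanoi_poly ^^ i) z) \<le> 1/2})" if "i < n" for i
    proof -
      have "Re ((hanoi_poly ^^ i) (complex_of_real w)) = (hanoi_poly ^^ i) w"
        by (simp only: hanoi_poly_iter_of_real Re_complex_of_real)
      moreover have "1/2 < (hanoi_poly ^^ i) w \<longleftrightarrow> s i" using w(3) that by blast
      ultimately show ?thesis by (cases "s i") simp_all
    qed
    ultimately have "complex_of_real w \<in> F n" unfolding F_def by blast
    then show ?thesis by blast
  qed
  moreover have "F n \<subseteq> F m" if "m \<le> n" for m n
  proof -
    have "{..<m} \<subseteq> {..<n}" using that by auto
    then show ?thesis unfolding F_def by (intro Int_mono subset_refl INF_superset_mono)
  qed
  ultimately have "\<Inter>(range F) \<noteq> {}" by (rule compact_nest)
  then obtain z where z: "\<And>n. z \<in> F n" by auto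
  have zK: "z \<in> hanoi_filled_julia" using z[of 0] by (simp add: F_def)
  have "hanoi_itinerary z i = s i" for i
  proof -
    have "z \<in> (if s i then {z. 1/2 \<le> Re ((hanoi_poly ^^ i) z)}
        else {z. Re ((hanoi_poly ^^ i) z) \<le> 1/2})"
      using z[of "Suc i"] unfolding F_def by blast
    then show ?thesis
      using hanoi_filled_julia_Re_neq[OF zK, of i] by (cases "s i") (auto simp: hanoi_itinerary_def)
  qed
  then show "s \<in> hanoi_itinerary ` hanoi_filled_julia" using zK by blast
qed

lemma hanoi_itinerary_prefix_dist:
  assumes z: "z \<in> hanoi_filled_julia" and w: "w \<in> hanoi_filled_julia"
    and eq: "\<forall>i<n. hanoi_itinerary z i = hanoi_itinerary w i"
  shows "dist z w \<le> 5 / 2 ^ n"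
proof -
  obtain x y where x: "z = of_real x" "\<And>n. (hanoi_poly ^^ n) x \<in> {-2..3}"
    and y: "w = of_real y" "\<And>n. (hanoi_poly ^^ n) y \<in> {-2..3}"
    using hanoi_filled_julia_cases[OF z] hanoi_filled_julia_cases[OF w] by metis
  have "\<forall>i<n. 1/2 < (hanoi_poly ^^ i) x \<longleftrightarrow> 1/2 < (hanoi_poly ^^ i) y"
    using eq by (simp add: hanoi_itinerary_def x y hanoi_poly_iter_of_real)
  then have "\<bar>x - y\<bar> \<le> 5 / 2 ^ n"
    using x(2) y(2) by (intro hanoi_poly_itinerary_contract) auto
  then show ?thesis by (simp add: x y dist_norm flip: of_real_diff)
qed

lemma inj_on_hanoi_itinerary: "inj_on hanoi_itinerary hanoi_filled_julia"
proof (rule inj_onI)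
  fix z w assume "z \<in> hanoi_filled_julia" "w \<in> hanoi_filled_julia"
    and "hanoi_itinerary z = hanoi_itinerary w"
  then have "dist z w \<le> 5 / 2 ^ n" for n
    by (intro hanoi_itinerary_prefix_dist) auto
  moreover have "(\<lambda>n. 5 / 2 ^ n :: real) \<longlonglongrightarrow> 0" by real_asymp
  ultimately have "dist z w \<le> 0" by (meson LIMSEQ_le_const)
  then show "z = w" by simp
qed

lemma cantor_set_hanoi_filled_julia: "cantor_set hanoi_filled_julia"
proof -
  \<comment> \<open>The inverse is continuous because points with a common prefix of the itinerary are close.\<close>
  define g where "g = inv_into hanoi_filled_julia hanoi_itinerary"
  have gK: "g s \<in> hanoi_filled_julia" and it_g: "hanoi_itinerary (g s) = s" for s
    unfolding g_def by (simp_all add: inv_into_into f_inv_into_f surj_hanoi_itinerary)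
  have g_it: "g (hanoi_itinerary z) = z" if "z \<in> hanoi_filled_julia" for z
    unfolding g_def by (rule inv_into_f_f[OF inj_on_hanoi_itinerary that])
  have "continuous_on UNIV g"
    unfolding continuous_on_topological
  proof (intro ballI allI impI)
    fix s B assume "open B" "g s \<in> B"
    then obtain e where e: "e > 0" "ball (g s) e \<subseteq> B" using open_contains_ball by blast
    obtain n where "5 / e < 2 ^ n" using real_arch_pow[of 2] by auto
    then have n: "5 / 2 ^ n < e" using e(1) by (simp add: field_simps)
    define A where "A = (\<Inter>i\<in>{..<n}. (\<lambda>t::nat \<Rightarrow> bool. t i) -` {s i})"
    have "open A" unfolding A_def
      by (intro open_INT ballI open_vimage continuous_on_product_coordinates open_discrete) auto
    moreover have "g t \<in> B" if "t \<in> A" for t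
    proof -
      have "dist (g s) (g t) \<le> 5 / 2 ^ n"
        using that by (intro hanoi_itinerary_prefix_dist gK) (auto simp: it_g A_def)
      then show ?thesis using n e(2) by auto
    qed
    ultimately show "\<exists>A. open A \<and> s \<in> A \<and> (\<forall>y\<in>UNIV. y \<in> A \<longrightarrow> g y \<in> B)"
      by (intro exI[of _ A]) (auto simp: A_def)
  qed
  then have "homeomorphism hanoi_filled_julia UNIV hanoi_itinerary g"
    using continuous_on_hanoi_itinerary surj_hanoi_itinerary gK it_g g_it
    unfolding homeomorphism_def by (auto simp: image_iff) (metis g_it)+
  then show ?thesis unfolding cantor_set_def homeomorphic_def by blast
qed

section \<open>The finite Schreier graphs\<close>

subsection \<open>Two facts on determinants\<close>

text \<open>Sylvester's determinant identity: both sides are the determinant of the block matrix with rows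
  \<open>1 A\<close> and \<open>B 1\<close>.\<close>

lemma det_one_minus_mult_commute:
  fixes A B :: "'a::idom mat"
  assumes A: "A \<in> carrier_mat m n" and B: "B \<in> carrier_mat n m"
  shows "det (1\<^sub>m m - A * B) = det (1\<^sub>m n - B * A)"
proof -
  let ?L = "four_block_mat (1\<^sub>m m) (0\<^sub>m m n) B (1\<^sub>m n)"
  have AB: "A * B \<in> carrier_mat m m" and BA: "B * A \<in> carrier_mat n n" using A B by auto
  have 1: "four_block_mat (1\<^sub>m m) A B (1\<^sub>m n) = ?L * four_block_mat (1\<^sub>m m) A (0\<^sub>m n m) (1\<^sub>m n - B * A)"
    using A B BA
    by (subst mult_four_block_mat[of _ m m _ n _ n _ _ m _ n])
      (auto intro!: cong_four_block_mat)
  have 2: "four_block_mat (1\<^sub>m m) A B (1\<^sub>m n) = four_block_mat (1\<^sub>m m - A * B) A (0\<^sub>m n m) (1\<^sub>m n) * ?L"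
    using A B AB
    by (subst mult_four_block_mat[of _ m m _ n _ n _ _ m _ n])
      (auto intro!: cong_four_block_mat)
  have dL: "det ?L = 1"
    using B by (subst det_four_block_mat_upper_right_zero[of _ m _ n]) auto
  have carr: "?L \<in> carrier_mat (m + n) (m + n)"
    "four_block_mat (1\<^sub>m m) A (0\<^sub>m n m) (1\<^sub>m n - B * A) \<in> carrier_mat (m + n) (m + n)"
    "four_block_mat (1\<^sub>m m - A * B) A (0\<^sub>m n m) (1\<^sub>m n) \<in> carrier_mat (m + n) (m + n)"
    using A B by (auto intro!: four_block_carrier_mat)
  have "det (1\<^sub>m n - B * A) = det (four_block_mat (1\<^sub>m m) A (0\<^sub>m n m) (1\<^sub>m n - B * A))"
    by (simp only: det_four_block_mat_lower_left_zero[OF one_carrier_mat A refl minus_carrier_mat[OF BA]]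
        det_one mult_1_left)
  also have "\<dots> = det (four_block_mat (1\<^sub>m m) A B (1\<^sub>m n))"
    by (simp only: 1 det_mult[OF carr(1,2)] dL mult_1_left)
  also have "\<dots> = det (four_block_mat (1\<^sub>m m - A * B) A (0\<^sub>m n m) (1\<^sub>m n))"
    by (simp only: 2 det_mult[OF carr(3,1)] dL mult_1_right)
  also have "\<dots> = det (1\<^sub>m m - A * B)"
    by (simp only: det_four_block_mat_lower_left_zero[OF minus_carrier_mat[OF AB] A refl one_carrier_mat]
        det_one mult_1_right)
  finally show ?thesis by simp
qed

lemma trace_mult_commute:
  fixes A B :: "'a::comm_semiring_0 mat"
  assumes A: "A \<in> carrier_mat n n" and B: "B \<in> carrier_mat n n"
  shows "(\<Sum>i<n. (A * B) $$ (i, i)) = (\<Sum>i<n. (B * A) $$ (i, i))"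
proof -
  have "(\<Sum>i<n. (A * B) $$ (i, i)) = (\<Sum>i<n. \<Sum>k<n. A $$ (i, k) * B $$ (k, i))"
    using A B by (intro sum.cong) (auto simp: scalar_prod_def atLeast0LessThan)
  also have "\<dots> = (\<Sum>k<n. \<Sum>i<n. A $$ (i, k) * B $$ (k, i))" by (rule sum.swap)
  also have "\<dots> = (\<Sum>k<n. (B * A) $$ (k, k))"
    using A B by (intro sum.cong) (auto simp: scalar_prod_def atLeast0LessThan mult.commute)
  finally show ?thesis .
qed

text \<open>The eigenvalues of an involution are 1 and -1, and the trace tells how often each occurs.\<close>

lemma char_poly_involution:
  fixes A :: "complex mat"
  assumes A: "A \<in> carrier_mat n n" and inv: "A * A = 1\<^sub>m n"
    and tr: "(\<Sum>i<n. A $$ (i, i)) = of_nat t"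
  shows "\<exists>q. n = 2 * q + t \<and> char_poly A = [:-1, 1:] ^ (q + t) * [:1, 1:] ^ q"
proof -
  obtain es where es: "char_poly A = (\<Prod>e\<leftarrow>es. [:- e, 1:])" "length es = n"
    using char_poly_factorized[OF A] by blast
  obtain B P Q where BPQ: "schur_decomposition A es = (B, P, Q)" by (metis prod_cases3)
  from schur_decomposition[OF A es(1) BPQ] have sim: "similar_mat_wit A B P Q"
    and diag: "diag_mat B = es" by auto
  have carr: "B \<in> carrier_mat n n" "P \<in> carrier_mat n n" "Q \<in> carrier_mat n n"
    and eq: "P * Q = 1\<^sub>m n" "Q * P = 1\<^sub>m n" "A = P * B * Q"
    using sim A unfolding similar_mat_wit_def by (auto simp: Let_def)
  have "(\<Sum>i<n. A $$ (i, i)) = (\<Sum>i<n. (Q * (P * B)) $$ (i, i))"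
    unfolding eq(3) using carr by (intro trace_mult_commute) auto
  also have "Q * (P * B) = B"
    using carr eq(2) by (simp flip: assoc_mult_mat[of Q n n P n B n])
  also have "(\<Sum>i<n. B $$ (i, i)) = sum_list (diag_mat B)"
    using carr(1) by (simp add: diag_mat_def sum_list_sum_nth atLeast0LessThan)
  finally have sum: "sum_list es = of_nat t" using tr diag by simp
  have pm: "e = 1 \<or> e = -1" if "e \<in> set es" for e
  proof -
    have "poly (char_poly A) e = 0"
      using that unfolding es(1) poly_prod_list by (simp add: prod_list_zero_iff image_iff)
    then have "eigenvalue A e" using eigenvalue_root_char_poly[OF A] by simp
    then obtain v where v: "v \<in> carrier_vec n" "v \<noteq> 0\<^sub>v n" "A *\<^sub>v v = e \<cdot>\<^sub>v v"
      using A unfolding eigenvalue_def eigenvector_def by auto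
    have "v = (A * A) *\<^sub>v v" using v inv by simp
    also have "\<dots> = A *\<^sub>v (A *\<^sub>v v)" using A v(1) by (simp add: assoc_mult_mat_vec)
    also have "\<dots> = (e * e) \<cdot>\<^sub>v v" using A v by (simp add: mult_mat_vec smult_smult_assoc)
    finally have ev: "(e * e) \<cdot>\<^sub>v v = v" ..
    obtain i where i: "i < n" "v $ i \<noteq> 0" using v(1,2) by (metis eq_vecI carrier_vecD index_zero_vec)
    have "e * e * v $ i = v $ i" using arg_cong[OF ev, of "\<lambda>u. u $ i"] i v(1) by simp
    then have "e * e = 1" using i by simp
    then show ?thesis by (simp add: square_eq_1_iff)
  qed
  have "\<exists>p q. length es = p + q \<and> sum_list es = of_nat p - of_nat q \<and>
    (\<Prod>e\<leftarrow>es. [:- e, 1:]) = [:-1, 1:] ^ p * [:1, 1:] ^ q"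
    using pm
  proof (induction es)
    case (Cons e es)
    then obtain p q where pq: "length es = p + q" "sum_list es = of_nat p - of_nat q"
      "(\<Prod>e\<leftarrow>es. [:- e, 1:]) = [:-1, 1:] ^ p * [:1, 1:] ^ q" by auto
    from Cons.prems[of e] consider "e = 1" | "e = -1" by auto
    then show ?case
    proof cases
      case 1
      then have "length (e # es) = Suc p + q \<and> sum_list (e # es) = of_nat (Suc p) - of_nat q \<and>
        (\<Prod>e\<leftarrow>e # es. [:- e, 1:]) = [:-1, 1:] ^ Suc p * [:1, 1:] ^ q"
        using pq by (simp add: mult_ac del: mult_pCons_left mult_pCons_right)
      then show ?thesis by blast
    next
      case 2
      then have "length (e # es) = p + Suc q \<and> sum_list (e # es) = of_nat p - of_nat (Suc q) \<and>
        (\<Prod>e\<leftarrow>e # es. [:- e, 1:]) = [:-1, 1:] ^ p * [:1, 1:] ^ Suc q"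
        using pq by (simp add: mult_ac del: mult_pCons_left mult_pCons_right)
      then show ?thesis by blast
    qed
  qed auto
  then obtain p q where pq: "n = p + q" "sum_list es = of_nat p - of_nat q"
    "char_poly A = [:-1, 1:] ^ p * [:1, 1:] ^ q" using es by auto
  have "of_nat p = (of_nat (q + t) :: complex)" using pq(2) sum by (simp add: algebra_simps)
  then have "p = q + t" by (simp only: of_nat_eq_iff)
  then show ?thesis using pq by (intro exI[of _ q]) simp
qed

subsection \<open>Matrices indexed by words\<close>

text \<open>The words of length \<open>n\<close> over \<open>{0, 1, 2}\<close>.\<close>

abbreviation words :: "nat \<Rightarrow> nat list set" where
  "words n \<equiv> set (level_words n)"

lemma level_words_0 [simp]: "level_words 0 = [[]]"
  by (simp add: level_words_def)

lemma level_words_Suc: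
  "level_words (Suc n) =
    map ((#) 0) (level_words n) @ map ((#) 1) (level_words n) @ map ((#) 2) (level_words n)"
  by (simp add: level_words_def)

lemma length_level_words [simp]: "length (level_words n) = 3 ^ n"
  by (induction n) (simp_all add: level_words_Suc)

lemma distinct_level_words [simp]: "distinct (level_words n)"
  by (induction n) (auto simp: level_words_Suc distinct_map)

lemma Cons_in_words_iff: "k # u \<in> words (Suc n) \<longleftrightarrow> k \<in> {0, 1, 2} \<and> u \<in> words n"
  by (auto simp: level_words_Suc)

lemma words_Suc_cases:
  assumes "w \<in> words (Suc n)"
  obtains k u where "w = k # u" "k \<in> {0, 1, 2}" "u \<in> words n"
  using assms by (auto simp: level_words_Suc)

lemma words_iff: "w \<in> words n \<longleftrightarrow> length w = n \<and> set w \<subseteq> {0, 1, 2}"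
proof (induction n arbitrary: w)
  case (Suc n)
  then show ?case by (cases w) (auto simp: level_words_Suc)
qed auto

lemma sum_words_Suc:
  "(\<Sum>w\<in>words (Suc n). F w) = (\<Sum>u\<in>words n. F (0 # u) + F (1 # u) + (F (2 # u) :: 'a::comm_monoid_add))"
proof -
  have "words (Suc n) = (#) 0 ` words n \<union> ((#) 1 ` words n \<union> (#) 2 ` words n)"
    by (simp add: level_words_Suc)
  also have "(\<Sum>w\<in>\<dots>. F w) = (\<Sum>w\<in>(#) 0 ` words n. F w) + ((\<Sum>w\<in>(#) 1 ` words n. F w) + (\<Sum>w\<in>(#) 2 ` words n. F w))"
    by (subst sum.union_disjoint, auto)+
  also have "\<dots> = (\<Sum>u\<in>words n. F (0 # u)) + ((\<Sum>u\<in>words n. F (1 # u)) + (\<Sum>u\<in>words n. F (2 # u)))"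
    by (subst (1 2 3) sum.reindex) (auto simp: inj_on_def)
  finally show ?thesis by (simp add: sum.distrib add.assoc)
qed

text \<open>The matrix of a function of two words of lengths \<open>m\<close> and \<open>n\<close>, in lexicographic order. It lets sums
  over indices be handled as sums over words.\<close>

definition word_mat :: "nat \<Rightarrow> nat \<Rightarrow> (nat list \<Rightarrow> nat list \<Rightarrow> 'a) \<Rightarrow> 'a mat" where
  "word_mat m n F = mat (3 ^ m) (3 ^ n) (\<lambda>(i, j). F (level_words m ! i) (level_words n ! j))"

lemma word_mat_carrier [simp]: "word_mat m n F \<in> carrier_mat (3 ^ m) (3 ^ n)"
  by (simp add: word_mat_def)

lemma word_mat_cong:
  assumes "\<And>u v. u \<in> words m \<Longrightarrow> v \<in> words n \<Longrightarrow> F u v = G u v"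
  shows "word_mat m n F = word_mat m n G"
  unfolding word_mat_def by (intro eq_matI) (auto simp: assms)

lemma sum_nth_level_words: "(\<Sum>i<3 ^ n. F (level_words n ! i)) = (\<Sum>w\<in>words n. F w)"
  by (intro sum.reindex_bij_betw bij_betw_nth) auto

lemma word_mat_mult:
  fixes F G :: "nat list \<Rightarrow> nat list \<Rightarrow> 'a::comm_semiring_0"
  shows "word_mat m k F * word_mat k n G = word_mat m n (\<lambda>u v. \<Sum>w\<in>words k. F u w * G w v)"
  by (intro eq_matI)
    (auto simp: word_mat_def scalar_prod_def atLeast0LessThan sum_nth_level_words[of "\<lambda>w. F _ w * G w _"])

lemma word_mat_add: "word_mat m n F + word_mat m n G = word_mat m n (\<lambda>u v. F u v + G u v)"
  by (intro eq_matI) (auto simp: word_mat_def)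

lemma word_mat_minus: "word_mat m n F - word_mat m n G = word_mat m n (\<lambda>u v. F u v - G u v)"
  by (intro eq_matI) (auto simp: word_mat_def)

lemma word_mat_smult: "c \<cdot>\<^sub>m word_mat m n F = word_mat m n (\<lambda>u v. c * F u v)"
  by (intro eq_matI) (auto simp: word_mat_def)

lemma word_mat_one: "1\<^sub>m (3 ^ n) = word_mat n n (\<lambda>u v. of_bool (u = v))"
  by (intro eq_matI) (auto simp: word_mat_def nth_eq_iff_index_eq)

subsection \<open>Self-similarity of the adjacency matrices\<close>

lemma hanoi_move_in_words:
  assumes "i \<in> {0, 1, 2}" "j \<in> {0, 1, 2}" "w \<in> words n"
  shows "hanoi_move i j w \<in> words n"
proof -
  have "length (hanoi_move i j w) = length w" by (induction w) auto
  moreover have "set (hanoi_move i j w) \<subseteq> {i, j} \<union> set w" by (induction w) auto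
  ultimately show ?thesis using assms by (auto simp: words_iff)
qed

lemma hanoi_move_involutive [simp]: "hanoi_move i j (hanoi_move i j w) = w"
  by (induction w) auto

text \<open>The generator that moves the two letters other than \<open>k\<close>; it is \<open>a_ij\<close> with \<open>{i, j, k} = {0, 1, 2}\<close>
  (values of \<open>k\<close> above 2 never matter).\<close>

definition opposite_move :: "nat \<Rightarrow> nat list \<Rightarrow> nat list" where
  "opposite_move k = (if k = 0 then hanoi_move 1 2 else if k = 1 then hanoi_move 0 2 else hanoi_move 0 1)"

text \<open>The involution \<open>ku \<mapsto> k a_ij(u)\<close>: each word is acted on by the one generator that keeps its first
  letter.\<close>

fun tail_move :: "nat list \<Rightarrow> nat list" where
  "tail_move [] = []"
| "tail_move (k # u) = k # opposite_move k u"

lemma opposite_move_involutive [simp]: "opposite_move k (opposite_move k u) = u"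
  by (simp add: opposite_move_def)

lemma tail_move_involutive [simp]: "tail_move (tail_move w) = w"
  by (cases w) auto

lemma opposite_move_in_words: "u \<in> words n \<Longrightarrow> opposite_move k u \<in> words n"
  by (simp add: opposite_move_def hanoi_move_in_words)

lemma tail_move_in_words: "w \<in> words n \<Longrightarrow> tail_move w \<in> words n"
  by (cases n) (auto elim!: words_Suc_cases simp: Cons_in_words_iff opposite_move_in_words)

lemma schreier_mat_word_mat:
  "schreier_mat n = word_mat n n (\<lambda>u v. of_bool (u = hanoi_move 0 1 v) +
     of_bool (u = hanoi_move 0 2 v) + of_bool (u = hanoi_move 1 2 v))"
  unfolding schreier_mat_def perm_mat_def word_mat_def
  by (intro eq_matI) auto

text \<open>The matrices of \<open>U\<close>, of \<open>U*\<close> and of \<open>P\<close>. The first two relate words of length \<open>n\<close> to words of length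
  \<open>n + 1\<close>; the last acts on words of length \<open>n\<close>.\<close>

definition lift_mat :: "nat \<Rightarrow> complex mat" where
  "lift_mat n = word_mat (Suc n) n (\<lambda>w u. of_bool (tl w = u))"

definition fold_mat :: "nat \<Rightarrow> complex mat" where
  "fold_mat n = word_mat n (Suc n) (\<lambda>u w. of_bool (tl w = u))"

definition tail_mat :: "nat \<Rightarrow> complex mat" where
  "tail_mat n = word_mat n n (\<lambda>w v. of_bool (w = tail_move v))"

lemma tail_mat_carrier [simp]: "tail_mat n \<in> carrier_mat (3 ^ n) (3 ^ n)"
  by (simp add: tail_mat_def)

lemma lift_mat_carrier [simp]: "lift_mat n \<in> carrier_mat (3 ^ Suc n) (3 ^ n)"
  unfolding lift_mat_def by (rule word_mat_carrier)

lemma fold_mat_carrier [simp]: "fold_mat n \<in> carrier_mat (3 ^ n) (3 ^ Suc n)"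
  unfolding fold_mat_def by (rule word_mat_carrier)

lemma tail_mat_square: "tail_mat n * tail_mat n = 1\<^sub>m (3 ^ n)"
  unfolding tail_mat_def word_mat_mult word_mat_one
proof (rule word_mat_cong)
  fix u v assume uv: "u \<in> words n" "v \<in> words n"
  have "(\<Sum>w\<in>words n. of_bool (u = tail_move w) * of_bool (w = tail_move v)) =
    (\<Sum>w\<in>words n. if w = tail_move v then of_bool (u = tail_move w) else (0::complex))"
    by (intro sum.cong) auto
  also have "\<dots> = of_bool (u = v)" using tail_move_in_words[OF uv(2)] by simp
  finally show "(\<Sum>w\<in>words n. of_bool (u = tail_move w) * of_bool (w = tail_move v)) = (of_bool (u = v) :: complex)" .
qed

lemma fold_mat_lift_mat: "fold_mat n * lift_mat n = 3 \<cdot>\<^sub>m 1\<^sub>m (3 ^ n)"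
  unfolding fold_mat_def lift_mat_def word_mat_mult word_mat_one word_mat_smult
proof (rule word_mat_cong)
  fix u v assume uv: "u \<in> words n" "v \<in> words n"
  have "(\<Sum>w\<in>words (Suc n). of_bool (tl w = u) * of_bool (tl w = v)) =
    (\<Sum>w\<in>words n. if w = u then 3 * of_bool (u = v) else (0::complex))"
    unfolding sum_words_Suc by (intro sum.cong) auto
  then show "(\<Sum>w\<in>words (Suc n). of_bool (tl w = u) * of_bool (tl w = v)) = 3 * (of_bool (u = v) :: complex)"
    using uv by simp
qed

lemma lift_mat_fold_mat:
  "lift_mat n * fold_mat n = word_mat (Suc n) (Suc n) (\<lambda>w v. of_bool (tl w = tl v))"
  unfolding fold_mat_def lift_mat_def word_mat_mult
proof (rule word_mat_cong)
  fix w v assume wv: "w \<in> words (Suc n)" "v \<in> words (Suc n)"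
  then have "tl w \<in> words n" by (auto elim!: words_Suc_cases)
  have "(\<Sum>u\<in>words n. of_bool (tl w = u) * of_bool (tl v = u)) =
    (\<Sum>u\<in>words n. if u = tl w then of_bool (tl w = tl v) else (0::complex))"
    by (intro sum.cong) auto
  then show "(\<Sum>u\<in>words n. of_bool (tl w = u) * of_bool (tl v = u)) = (of_bool (tl w = tl v) :: complex)"
    using \<open>tl w \<in> words n\<close> by simp
qed

lemma fold_tail_lift_mat: "fold_mat n * (tail_mat (Suc n) * lift_mat n) = schreier_mat n"
proof -
  have "tail_mat (Suc n) * lift_mat n = word_mat (Suc n) n (\<lambda>w u. of_bool (tl (tail_move w) = u))"
    unfolding tail_mat_def lift_mat_def word_mat_mult
  proof (rule word_mat_cong)
    fix w u assume w: "w \<in> words (Suc n)" and u: "u \<in> words n"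
    have "w = tail_move v \<longleftrightarrow> v = tail_move w" for v by auto
    then have "(\<Sum>v\<in>words (Suc n). of_bool (w = tail_move v) * of_bool (tl v = u)) =
      (\<Sum>v\<in>words (Suc n). if v = tail_move w then of_bool (tl v = u) else (0::complex))"
      by (intro sum.cong) auto
    then show "(\<Sum>v\<in>words (Suc n). of_bool (w = tail_move v) * of_bool (tl v = u)) =
      (of_bool (tl (tail_move w) = u) :: complex)"
      using tail_move_in_words[OF w] by simp
  qed
  then show ?thesis unfolding fold_mat_def schreier_mat_word_mat
  proof (simp only: word_mat_mult, intro word_mat_cong)
    fix u v assume u: "u \<in> words n" and v: "v \<in> words n"
    have iff: "hanoi_move i j u = v \<longleftrightarrow> u = hanoi_move i j v" for i j by auto
    have "(\<Sum>w\<in>words (Suc n). of_bool (tl w = u) * of_bool (tl (tail_move w) = v)) =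
      (\<Sum>w\<in>words n. if w = u then of_bool (u = hanoi_move 0 1 v) +
         of_bool (u = hanoi_move 0 2 v) + of_bool (u = hanoi_move 1 2 v) else (0::complex))"
      unfolding sum_words_Suc by (intro sum.cong) (auto simp: opposite_move_def iff)
    then show "(\<Sum>w\<in>words (Suc n). of_bool (tl w = u) * of_bool (tl (tail_move w) = v)) =
      (of_bool (u = hanoi_move 0 1 v) +
         of_bool (u = hanoi_move 0 2 v) + of_bool (u = hanoi_move 1 2 v) :: complex)"
      using u by simp
  qed
qed

text \<open>Two distinct words with the same tail are exchanged by exactly one generator, and the remaining generator acts by
  \<open>tail_move\<close>.\<close>

lemma schreier_mat_Suc:
  "schreier_mat (Suc n) = lift_mat n * fold_mat n - 1\<^sub>m (3 ^ Suc n) + tail_mat (Suc n)"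
  unfolding lift_mat_fold_mat schreier_mat_word_mat tail_mat_def word_mat_one word_mat_minus word_mat_add
proof (rule word_mat_cong)
  fix u v assume "u \<in> words (Suc n)" "v \<in> words (Suc n)"
  then obtain k l u' v' where "u = k # u'" "v = l # v'" "k \<in> {0, 1, 2}" "l \<in> {0, 1, 2}"
    by (metis words_Suc_cases)
  then show "of_bool (u = hanoi_move 0 1 v) + of_bool (u = hanoi_move 0 2 v) +
      of_bool (u = hanoi_move 1 2 v) =
    of_bool (tl u = tl v) - of_bool (u = v) + (of_bool (u = tail_move v) :: complex)"
    by (auto simp: opposite_move_def)
qed

text \<open>A generator fixes only the constant word in the third letter; hence \<open>P\<close> has trace 3.\<close>

lemma hanoi_move_fixed_iff:
  assumes "{i, j, k} = {0, 1, 2}" "set w \<subseteq> {0, 1, 2}"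
  shows "hanoi_move i j w = w \<longleftrightarrow> w = replicate (length w) k"
  using assms(2)
proof (induction w)
  case (Cons x w)
  have card: "card {i, j, k} = 3" unfolding assms(1) by simp
  have d: "i \<noteq> j" "i \<noteq> k" "j \<noteq> k"
    using card by (auto simp: card_insert_if split: if_splits)
  have "x \<in> {i, j, k}" using Cons.prems unfolding assms(1) by simp
  then show ?case using Cons d by auto
qed simp

lemma trace_tail_mat: "(\<Sum>i<3 ^ Suc n. tail_mat (Suc n) $$ (i, i)) = of_nat 3"
proof -
  have "(\<Sum>i<3 ^ Suc n. tail_mat (Suc n) $$ (i, i)) =
    (\<Sum>i<3 ^ Suc n. of_bool (level_words (Suc n) ! i = tail_move (level_words (Suc n) ! i)))"
    by (intro sum.cong) (auto simp: tail_mat_def word_mat_def)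
  also have "\<dots> = (\<Sum>w\<in>words (Suc n). of_bool (w = tail_move w))"
    by (rule sum_nth_level_words)
  also have "\<dots> = (\<Sum>u\<in>words n. (if u = replicate n 0 then 1 else 0) +
      (if u = replicate n 1 then 1 else 0) + (if u = replicate n 2 then 1 else 0))"
    unfolding sum_words_Suc
  proof (intro sum.cong refl)
    fix u assume "u \<in> words n"
    then have u: "set u \<subseteq> {0, 1, 2}" "length u = n" by (auto simp: words_iff)
    have "hanoi_move 1 2 u = u \<longleftrightarrow> u = replicate n 0" "hanoi_move 0 2 u = u \<longleftrightarrow> u = replicate n 1"
      "hanoi_move 0 1 u = u \<longleftrightarrow> u = replicate n 2"
      using hanoi_move_fixed_iff[of 1 2 0 u] hanoi_move_fixed_iff[of 0 2 1 u]
        hanoi_move_fixed_iff[of 0 1 2 u] u by auto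
    then show "of_bool (0 # u = tail_move (0 # u)) + of_bool (1 # u = tail_move (1 # u)) +
        of_bool (2 # u = tail_move (2 # u)) =
      (if u = replicate n 0 then 1 else 0) + (if u = replicate n 1 then 1 else 0) +
       (if u = replicate n 2 then 1 else (0::complex))"
      by (simp add: opposite_move_def eq_commute[of u "hanoi_move _ _ u"])
  qed
  also have "\<dots> = of_nat 3"
    by (simp add: sum.distrib words_iff set_replicate_conv_if)
  finally show ?thesis .
qed

lemma char_poly_tail_mat:
  "\<exists>q. 3 ^ Suc n = 2 * q + 3 \<and> char_poly (tail_mat (Suc n)) = [:-1, 1:] ^ (q + 3) * [:1, 1:] ^ q"
  by (rule char_poly_involution[OF tail_mat_carrier tail_mat_square trace_tail_mat])

lemma schreier_mat_carrier [simp]: "schreier_mat n \<in> carrier_mat (3 ^ n) (3 ^ n)"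
  by (simp add: schreier_mat_word_mat)

lemma poly_char_poly_eq_det:
  fixes A :: "'a::field mat"
  assumes "A \<in> carrier_mat n n"
  shows "poly (char_poly A) x = det (x \<cdot>\<^sub>m 1\<^sub>m n - A)"
proof -
  have "- char_matrix A x = x \<cdot>\<^sub>m 1\<^sub>m n - A"
    using assms by (intro eq_matI) (auto simp: char_matrix_def)
  then show ?thesis using char_poly_matrix[OF assms] by simp
qed

lemma minus_minus_mat_regroup:
  fixes A B C :: "'a::ring_1 mat"
  assumes "A \<in> carrier_mat n n" "B \<in> carrier_mat n n"
  shows "((x + 1) \<cdot>\<^sub>m 1\<^sub>m n - A) - B = x \<cdot>\<^sub>m 1\<^sub>m n - (B - 1\<^sub>m n + A)"
  using assms by (intro eq_matI) (auto simp: algebra_simps)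

text \<open>The determinant form of the spectral decimation, by Sylvester's identity.\<close>

lemma schreier_mat_resolvent_det:
  fixes x :: complex
  assumes x: "x \<noteq> 0" "x \<noteq> -2"
  shows "poly (char_poly (schreier_mat (Suc n))) x * ((x + 1)\<^sup>2 - 1) ^ 3 ^ n =
    poly (char_poly (tail_mat (Suc n))) (x + 1) * poly (char_poly (schreier_mat n)) (hanoi_poly x)"
proof -
  define y where "y = x + 1"
  define d where "d = y\<^sup>2 - 1"
  have "d = x * (x + 2)" by (simp add: d_def y_def power2_eq_square algebra_simps)
  then have d: "d \<noteq> 0" using x by (simp add: eq_neg_iff_add_eq_0)
  let ?M = "3 ^ Suc n :: nat" and ?N = "3 ^ n :: nat"
  let ?I = "1\<^sub>m ?M :: complex mat" and ?J = "1\<^sub>m ?N :: complex mat"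
  let ?U = "lift_mat n" and ?V = "fold_mat n" and ?P = "tail_mat (Suc n)"
  have U: "?U \<in> carrier_mat ?M ?N" and V: "?V \<in> carrier_mat ?N ?M" and P: "?P \<in> carrier_mat ?M ?M"
    and I: "?I \<in> carrier_mat ?M ?M" and J: "?J \<in> carrier_mat ?N ?N"
    and T: "schreier_mat n \<in> carrier_mat ?N ?N"
    by (rule lift_mat_carrier fold_mat_carrier tail_mat_carrier one_carrier_mat schreier_mat_carrier)+
  \<comment> \<open>The product \<open>C D\<close> is the scalar \<open>d\<close>, so that \<open>D / d\<close> is the inverse of \<open>y - P\<close>.\<close>
  define C where "C = y \<cdot>\<^sub>m ?I - ?P"
  define D where "D = y \<cdot>\<^sub>m ?I + ?P"
  have C: "C \<in> carrier_mat ?M ?M" unfolding C_def using I P by (intro minus_carrier_mat)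
  have D: "D \<in> carrier_mat ?M ?M" unfolding D_def using I P by (intro add_carrier_mat)
  have yI: "y \<cdot>\<^sub>m ?I \<in> carrier_mat ?M ?M" by (intro smult_carrier_mat I)
  have yP: "y \<cdot>\<^sub>m ?P \<in> carrier_mat ?M ?M" by (intro smult_carrier_mat P)
  have "C * D = (y \<cdot>\<^sub>m ?I) * D - ?P * D"
    unfolding C_def by (rule minus_mult_distrib_mat[OF yI P D])
  also have "(y \<cdot>\<^sub>m ?I) * D = y \<cdot>\<^sub>m D"
    by (simp only: mult_smult_assoc_mat[OF I D] left_mult_one_mat[OF D])
  also have "?P * D = ?P * (y \<cdot>\<^sub>m ?I) + ?P * ?P"
    unfolding D_def by (rule mult_add_distrib_mat[OF P yI P])
  also have "\<dots> = y \<cdot>\<^sub>m ?P + ?I"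
    by (simp only: mult_smult_distrib[OF P I] right_mult_one_mat[OF P] tail_mat_square)
  also have "y \<cdot>\<^sub>m D - (y \<cdot>\<^sub>m ?P + ?I) = d \<cdot>\<^sub>m ?I"
    unfolding D_def d_def using P
    by (intro eq_matI) (auto simp: power2_eq_square algebra_simps simp del: power_Suc)
  finally have CD: "C * D = d \<cdot>\<^sub>m ?I" .
  define A where "A = (1 / d) \<cdot>\<^sub>m (D * ?U)"
  have DU: "D * ?U \<in> carrier_mat ?M ?N" using D U by (rule mult_carrier_mat)
  have A: "A \<in> carrier_mat ?M ?N" unfolding A_def by (intro smult_carrier_mat DU)
  have AV: "A * ?V \<in> carrier_mat ?M ?M" using A V by (rule mult_carrier_mat)
  have UV: "?U * ?V \<in> carrier_mat ?M ?M" using U V by (rule mult_carrier_mat)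
  have "C * (A * ?V) = (C * A) * ?V" using C A V by (simp only: assoc_mult_mat)
  also have "C * A = (1 / d) \<cdot>\<^sub>m ((C * D) * ?U)"
    unfolding A_def by (simp only: mult_smult_distrib[OF C DU] assoc_mult_mat[OF C D U])
  also have "(C * D) * ?U = d \<cdot>\<^sub>m ?U"
    unfolding CD by (simp only: mult_smult_assoc_mat[OF I U] left_mult_one_mat[OF U])
  also have "(1 / d) \<cdot>\<^sub>m (d \<cdot>\<^sub>m ?U) = ?U"
    using d by (intro eq_matI) auto
  finally have CAV: "C * (A * ?V) = ?U * ?V" .
  have "C * (?I - A * ?V) = C - ?U * ?V"
    by (simp only: mult_minus_distrib_mat[OF C I AV] right_mult_one_mat[OF C] CAV)
  also have "\<dots> = x \<cdot>\<^sub>m ?I - schreier_mat (Suc n)"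
    unfolding C_def y_def schreier_mat_Suc by (rule minus_minus_mat_regroup[OF P UV])
  finally have fac: "x \<cdot>\<^sub>m ?I - schreier_mat (Suc n) = C * (?I - A * ?V)" ..
  have PU: "?P * ?U \<in> carrier_mat ?M ?N" using P U by (rule mult_carrier_mat)
  have yU: "y \<cdot>\<^sub>m ?U \<in> carrier_mat ?M ?N" by (intro smult_carrier_mat U)
  have "?V * A = (1 / d) \<cdot>\<^sub>m (?V * (D * ?U))"
    unfolding A_def by (rule mult_smult_distrib[OF V DU])
  also have "D * ?U = y \<cdot>\<^sub>m ?U + ?P * ?U"
    unfolding D_def by (simp only: add_mult_distrib_mat[OF yI P U] mult_smult_assoc_mat[OF I U]
        left_mult_one_mat[OF U])
  also have "?V * (y \<cdot>\<^sub>m ?U + ?P * ?U) = y \<cdot>\<^sub>m (3 \<cdot>\<^sub>m ?J) + schreier_mat n"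
    by (simp only: mult_add_distrib_mat[OF V yU PU] mult_smult_distrib[OF V U] fold_mat_lift_mat
        fold_tail_lift_mat)
  finally have VA: "?V * A = (1 / d) \<cdot>\<^sub>m (y \<cdot>\<^sub>m (3 \<cdot>\<^sub>m ?J) + schreier_mat n)" .
  have poly: "d - 3 * y = hanoi_poly x"
    by (simp add: d_def y_def hanoi_poly_def power2_eq_square algebra_simps)
  have "?J - ?V * A = (1 / d) \<cdot>\<^sub>m (hanoi_poly x \<cdot>\<^sub>m ?J - schreier_mat n)"
    unfolding VA poly[symmetric] using d
    by (intro eq_matI) (auto simp: field_simps carrier_matD[OF T])
  moreover have "dim_col (hanoi_poly x \<cdot>\<^sub>m ?J - schreier_mat n) = ?N"
    by (simp add: carrier_matD(2)[OF T])
  ultimately have "det (?J - ?V * A) = (1 / d) ^ ?N * poly (char_poly (schreier_mat n)) (hanoi_poly x)"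
    by (simp only: det_smult poly_char_poly_eq_det[OF T])
  moreover have "det (?I - A * ?V) = det (?J - ?V * A)"
    by (rule det_one_minus_mult_commute[OF A V])
  moreover have "poly (char_poly (schreier_mat (Suc n))) x = det C * det (?I - A * ?V)"
    unfolding poly_char_poly_eq_det[OF schreier_mat_carrier] fac
    using C minus_carrier_mat[OF AV] by (rule det_mult)
  moreover have "det C = poly (char_poly ?P) y"
    unfolding C_def by (rule poly_char_poly_eq_det[OF P, symmetric])
  ultimately show ?thesis using d by (simp add: d_def y_def power_divide)
qed

subsection \<open>Multiplicities of the eigenvalues\<close>

lemma char_poly_schreier_mat_0: "char_poly (schreier_mat 0) = [:-3, 1:]"
proof -
  have "schreier_mat 0 = mat 1 1 (\<lambda>_. 3)"
    by (intro eq_matI) (auto simp: schreier_mat_word_mat word_mat_def)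
  moreover have "det (x \<cdot>\<^sub>m 1\<^sub>m 1 - mat 1 1 (\<lambda>_. 3)) = x - 3" for x :: complex
    by (subst det_single) (auto intro!: minus_carrier_mat mat_carrier)
  ultimately have "poly (char_poly (schreier_mat 0)) x = poly [:-3, 1:] x" for x
    using poly_char_poly_eq_det[of "mat 1 1 (\<lambda>_. 3)" 1 x] by simp
  then show ?thesis by (simp add: poly_eq_poly_eq_iff[symmetric] fun_eq_iff)
qed

lemma hanoi_poly_poly: "poly [:-3, -1, 1:] x = hanoi_poly x"
  by (simp add: hanoi_poly_def power2_eq_square algebra_simps)

text \<open>Here \<open>q + 3\<close> and \<open>q\<close> are the multiplicities of the eigenvalues 1 and -1 of \<open>P\<close>. The identity holds at all
  points other than 0 and -2, hence as an identity of polynomials.\<close>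

lemma char_poly_schreier_mat_Suc:
  "\<exists>q. 3 ^ Suc n = 2 * q + 3 \<and>
    char_poly (schreier_mat (Suc n)) * ([:0, 1:] * [:2, 1:]) ^ 3 ^ n =
    [:0, 1:] ^ (q + 3) * [:2, 1:] ^ q * (char_poly (schreier_mat n) \<circ>\<^sub>p [:-3, -1, 1:])"
proof -
  obtain q where q: "3 ^ Suc n = 2 * q + 3"
    "char_poly (tail_mat (Suc n)) = [:-1, 1:] ^ (q + 3) * [:1, 1:] ^ q"
    using char_poly_tail_mat by blast
  let ?p1 = "char_poly (schreier_mat (Suc n)) * ([:0, 1:] * [:2, 1:]) ^ 3 ^ n"
  let ?p2 = "[:0, 1:] ^ (q + 3) * [:2, 1:] ^ q * (char_poly (schreier_mat n) \<circ>\<^sub>p [:-3, -1, 1:])"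
  have "poly ?p1 x = poly ?p2 x" if "x \<noteq> 0" "x \<noteq> -2" for x
  proof -
    have "poly ([:0, 1:] * [:2, 1:]) x = (x + 1)\<^sup>2 - 1"
      by (simp add: power2_eq_square algebra_simps)
    then have "poly ?p1 x = poly (char_poly (schreier_mat (Suc n))) x * ((x + 1)\<^sup>2 - 1) ^ 3 ^ n"
      by (simp only: poly_mult poly_power)
    also have "\<dots> = poly (char_poly (tail_mat (Suc n))) (x + 1) * poly (char_poly (schreier_mat n)) (hanoi_poly x)"
      using that by (rule schreier_mat_resolvent_det)
    also have "\<dots> = poly ?p2 x"
      unfolding q(2) poly_mult poly_power poly_pcompose hanoi_poly_poly by (simp add: add.commute)
    finally show ?thesis .
  qed
  then have "- {0, -2} \<subseteq> {x. poly (?p1 - ?p2) x = 0}" by auto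
  moreover have "infinite (- {0, -2 :: complex})"
    by (simp add: infinite_UNIV_char_0 Compl_eq_Diff_UNIV)
  ultimately have "?p1 - ?p2 = 0"
    using poly_roots_finite[of "?p1 - ?p2"] finite_subset by blast
  then show ?thesis using q(1) by (intro exI[of _ q]) simp
qed

text \<open>Away from the critical point, composition with \<open>f\<close> preserves the order of vanishing.\<close>

lemma order_pcompose_hanoi_poly:
  fixes p :: "complex poly"
  assumes "p \<noteq> 0" "x \<noteq> 1/2"
  shows "Polynomial.order x (p \<circ>\<^sub>p [:-3, -1, 1:]) = Polynomial.order (hanoi_poly x) p"
proof -
  obtain r where r: "p = [:- hanoi_poly x, 1:] ^ Polynomial.order (hanoi_poly x) p * r"
    "\<not> [:- hanoi_poly x, 1:] dvd r"
    using order_decomp[OF assms(1)] by blast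
  let ?k = "Polynomial.order (hanoi_poly x) p"
  have "poly [:- hanoi_poly x - 3, -1, 1:] z = poly ([:- x, 1:] * [:x - 1, 1:]) z" for z
    by (simp add: hanoi_poly_def power2_eq_square algebra_simps)
  then have fac: "[:- hanoi_poly x - 3, -1, 1:] = [:- x, 1:] * [:x - 1, 1:]"
    by (metis poly_eq_poly_eq_iff ext)
  have lin: "[:- hanoi_poly x, 1:] \<circ>\<^sub>p [:-3, -1, 1:] = [:- x, 1:] * [:x - 1, 1:]"
    unfolding fac[symmetric] by (simp add: pcompose_pCons)
  have comp: "p \<circ>\<^sub>p [:-3, -1, 1:] = [:- x, 1:] ^ ?k * ([:x - 1, 1:] ^ ?k * (r \<circ>\<^sub>p [:-3, -1, 1:]))"
    by (subst r(1)) (simp only: pcompose_mult pcompose_hom.hom_power lin power_mult_distrib mult.assoc)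
  have "poly r (hanoi_poly x) \<noteq> 0" using r(2) by (simp add: poly_eq_0_iff_dvd)
  then have nz: "poly ([:x - 1, 1:] ^ ?k * (r \<circ>\<^sub>p [:-3, -1, 1:])) x \<noteq> 0"
    using assms(2) unfolding poly_mult poly_power poly_pcompose hanoi_poly_poly by (auto simp: field_simps)
  then have "[:x - 1, 1:] ^ ?k * (r \<circ>\<^sub>p [:-3, -1, 1:]) \<noteq> 0" by (metis poly_0)
  then have nz2: "[:- x, 1:] ^ ?k * ([:x - 1, 1:] ^ ?k * (r \<circ>\<^sub>p [:-3, -1, 1:])) \<noteq> 0"
    by (simp only: mult_eq_0_iff de_Morgan_disj power_eq_0_iff pCons_eq_0_iff) simp
  from order_mult[OF nz2] show ?thesis
    by (simp only: comp order_power_n_n order_0I[OF nz] add_0_right)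
qed

lemma char_poly_schreier_mat_nonzero: "char_poly (schreier_mat n) \<noteq> 0"
  using degree_monic_char_poly[OF schreier_mat_carrier, of n] by auto

lemma eig_mult_0: "eig_mult 0 x = of_bool (x = 3)"
proof (cases "x = 3")
  case True
  then show ?thesis using order_power_n_n[of "3::complex" 1]
    by (simp add: eig_mult_def char_poly_schreier_mat_0)
next
  case False
  then show ?thesis by (simp add: eig_mult_def char_poly_schreier_mat_0 order_0I)
qed

text \<open>The recursion for the multiplicities, doubled and with the negative term moved to the left so that it can be
  stated for natural numbers.\<close>

lemma eig_mult_Suc:
  assumes "x \<noteq> 1/2"
  shows "2 * eig_mult (Suc n) x + of_bool (x = - 2) * 3 =
    2 * eig_mult n (hanoi_poly x) + of_bool (x = 0) * (3 ^ n + 3) + of_bool (x = -2) * 3 ^ n"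
proof -
  obtain q where q: "3 ^ Suc n = 2 * q + 3"
    "char_poly (schreier_mat (Suc n)) * ([:0, 1:] * [:2, 1:]) ^ 3 ^ n =
    [:0, 1:] ^ (q + 3) * [:2, 1:] ^ q * (char_poly (schreier_mat n) \<circ>\<^sub>p [:-3, -1, 1:])"
    using char_poly_schreier_mat_Suc by blast
  have o0: "Polynomial.order x ([:0, 1:] ^ k) = of_bool (x = 0) * k" for k
    using order_power_n_n[of 0 k] by (cases "x = 0") (auto intro: order_0I)
  have o2: "Polynomial.order x ([:2, 1:] ^ k) = of_bool (x = -2) * k" for k
    using order_power_n_n[of "-2" k]
    by (cases "x = -2") (auto intro!: order_0I simp: add_eq_0_iff)
  have nz: "char_poly (schreier_mat n) \<circ>\<^sub>p [:-3, -1, 1:] \<noteq> 0"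
    using char_poly_schreier_mat_nonzero by (simp add: pcompose_eq_0_iff)
  have nzl: "[:0, 1:] ^ k \<noteq> (0 :: complex poly)" "[:2, 1:] ^ k \<noteq> (0 :: complex poly)" for k by auto
  have "Polynomial.order x (char_poly (schreier_mat (Suc n)) * ([:0, 1:] * [:2, 1:]) ^ 3 ^ n) =
    eig_mult (Suc n) x + (of_bool (x = 0) * 3 ^ n + of_bool (x = -2) * 3 ^ n)"
    by (simp only: power_mult_distrib order_mult mult_eq_0_iff nzl char_poly_schreier_mat_nonzero
        simp_thms o0 o2 eig_mult_def not_False_eq_True)
  moreover have "Polynomial.order x ([:0, 1:] ^ (q + 3) * [:2, 1:] ^ q * (char_poly (schreier_mat n) \<circ>\<^sub>p [:-3, -1, 1:])) =
    of_bool (x = 0) * (q + 3) + of_bool (x = -2) * q + eig_mult n (hanoi_poly x)"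
    by (simp only: order_mult mult_eq_0_iff nzl nz simp_thms o0 o2 eig_mult_def not_False_eq_True
        order_pcompose_hanoi_poly[OF char_poly_schreier_mat_nonzero assms])
  ultimately have "eig_mult (Suc n) x + (of_bool (x = 0) * 3 ^ n + of_bool (x = -2) * 3 ^ n) =
    of_bool (x = 0) * (q + 3) + of_bool (x = -2) * q + eig_mult n (hanoi_poly x)"
    using q(2) by simp
  then show ?thesis using q(1) by (cases "x = 0"; cases "x = -2") auto
qed

lemma eig_mult_eq_0_iff: "eig_mult n x = 0 \<longleftrightarrow> poly (char_poly (schreier_mat n)) x \<noteq> 0"
  unfolding eig_mult_def using char_poly_schreier_mat_nonzero order_root by metis

lemma spectrum_schreier_mat: "spectrum (schreier_mat n) = {x. eig_mult n x \<noteq> 0}"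
  by (simp add: spectrum_root_char_poly[OF schreier_mat_carrier] eig_mult_eq_0_iff)

lemma eig_mult_eq_0_outside:
  assumes "\<nexists>y. y \<in> {-2..3} \<and> x = complex_of_real y"
  shows "eig_mult n x = 0"
  using assms
proof (induction n arbitrary: x)
  case 0
  then have "x \<noteq> 3" by (auto dest: spec[of _ 3])
  then show ?case by (simp add: eig_mult_0)
next
  case (Suc n)
  have ne: "x \<noteq> complex_of_real y" if "y \<in> {-2..3}" for y
    using Suc.prems that by blast
  have "x \<noteq> 0" "x \<noteq> -2" "x \<noteq> 1/2" using ne[of 0] ne[of "-2"] ne[of "1/2"] by auto
  moreover have "eig_mult n (hanoi_poly x) = 0"
    using Suc.prems hanoi_poly_preimage_real by (intro Suc.IH) blast
  ultimately show ?case using eig_mult_Suc[of x n] by simp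
qed

text \<open>At the critical point itself both multiplicities vanish: \<open>f(1/2) = -13/4\<close> lies outside of the interval.\<close>

lemma eig_mult_Suc':
  "2 * eig_mult (Suc n) x + of_bool (x = - 2) * 3 =
    2 * eig_mult n (hanoi_poly x) + of_bool (x = 0) * (3 ^ n + 3) + of_bool (x = -2) * 3 ^ n"
proof (cases "x = 1/2")
  case True
  have "hanoi_poly x = of_real (-13/4)" unfolding True hanoi_poly_def by (simp add: power2_eq_square)
  then have 0: "eig_mult n (hanoi_poly x) = 0"
    by (intro eig_mult_eq_0_outside) (simp only: of_real_eq_iff, simp)
  have nz: "poly (char_poly (schreier_mat n)) (hanoi_poly x) \<noteq> 0" "x \<noteq> 0" "2 + x \<noteq> 0"
    using 0 by (simp_all only: eig_mult_eq_0_iff) (simp_all add: True)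
  obtain q where q: "char_poly (schreier_mat (Suc n)) * ([:0, 1:] * [:2, 1:]) ^ 3 ^ n =
    [:0, 1:] ^ (q + 3) * [:2, 1:] ^ q * (char_poly (schreier_mat n) \<circ>\<^sub>p [:-3, -1, 1:])"
    using char_poly_schreier_mat_Suc by blast
  have "poly ([:0, 1:] ^ (q + 3) * [:2, 1:] ^ q * (char_poly (schreier_mat n) \<circ>\<^sub>p [:-3, -1, 1:])) x \<noteq> 0"
    using nz unfolding poly_mult poly_power poly_pcompose hanoi_poly_poly by simp
  then have "poly (char_poly (schreier_mat (Suc n))) x \<noteq> 0"
    unfolding q[symmetric] by simp
  then have "eig_mult (Suc n) x = 0" using eig_mult_eq_0_iff[of "Suc n" x] by blast
  with 0 True show ?thesis by (simp only:) (simp add: field_simps)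
next
  case False
  then show ?thesis by (rule eig_mult_Suc)
qed

lemma hanoi_poly_iter_0_complex:
  assumes "y \<in> {-2..3}"
  shows "(hanoi_poly ^^ Suc n) 0 \<noteq> complex_of_real y"
proof
  assume "(hanoi_poly ^^ Suc n) 0 = complex_of_real y"
  then have "complex_of_real ((hanoi_poly ^^ Suc n) 0) = complex_of_real y"
    using hanoi_poly_iter_of_real[of "Suc n" 0] by (simp only: of_real_0)
  then have "(hanoi_poly ^^ Suc n) 0 = y" by (simp only: of_real_eq_iff)
  with assms hanoi_poly_iter_0_outside[of n] show False by simp
qed

lemma eig_mult_zero_orbit:
  assumes "(hanoi_poly ^^ i) x = 0" "i < n"
  shows "2 * eig_mult n x = 3 ^ (n - i - 1) + 3"
  using assms
proof (induction n arbitrary: i x)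
  case (Suc n)
  show ?case
  proof (cases i)
    case 0
    then have "x = 0" using Suc.prems by simp
    moreover have "eig_mult n (complex_of_real (-3)) = 0"
      by (intro eig_mult_eq_0_outside) (simp only: of_real_eq_iff, simp)
    ultimately show ?thesis using eig_mult_Suc'[of n 0] 0 by (simp add: hanoi_poly_def)
  next
    case (Suc i')
    have "x \<noteq> 0" using hanoi_poly_iter_0_complex[of 0 i'] Suc.prems(1) Suc by auto
    moreover have "x \<noteq> -2" using hanoi_poly_iter_minus2[of i', where 'a = complex] Suc.prems(1) Suc by auto
    moreover have "(hanoi_poly ^^ i') (hanoi_poly x) = 0"
      using Suc.prems(1) Suc by (simp only: funpow_Suc_right o_apply)
    then have "2 * eig_mult n (hanoi_poly x) = 3 ^ (n - i' - 1) + 3"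
      using Suc.prems(2) Suc by (intro Suc.IH) auto
    ultimately show ?thesis using eig_mult_Suc'[of n x] Suc by simp
  qed
qed simp

lemma eig_mult_3: "eig_mult n 3 = 1"
proof (induction n)
  case (Suc n)
  then show ?case using eig_mult_Suc'[of n 3] by (simp add: hanoi_poly_def)
qed (simp add: eig_mult_0)

lemma eig_mult_minus2_orbit:
  assumes "(hanoi_poly ^^ j) x = -2" "j < n"
  shows "2 * eig_mult n x + 1 = 3 ^ (n - j - 1)"
  using assms
proof (induction n arbitrary: j x)
  case (Suc n)
  show ?case
  proof (cases j)
    case 0
    then have "x = -2" using Suc.prems by simp
    then show ?thesis using eig_mult_Suc'[of n "-2"] eig_mult_3[of n] 0 by (simp add: hanoi_poly_def)
  next
    case (Suc j')
    have "x \<noteq> 0" using hanoi_poly_iter_0_complex[of "-2" j'] Suc.prems(1) Suc by auto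
    moreover have "x \<noteq> -2" using hanoi_poly_iter_minus2[of j', where 'a = complex] Suc.prems(1) Suc by auto
    moreover have "(hanoi_poly ^^ j') (hanoi_poly x) = -2"
      using Suc.prems(1) Suc by (simp only: funpow_Suc_right o_apply)
    then have "2 * eig_mult n (hanoi_poly x) + 1 = 3 ^ (n - j' - 1)"
      using Suc.prems(2) Suc by (intro Suc.IH) auto
    ultimately show ?thesis using eig_mult_Suc'[of n x] Suc by simp
  qed
qed simp

lemma real_eig_mult_zero_orbit:
  assumes "(hanoi_poly ^^ i) x = 0" "i < n"
  shows "real (eig_mult n x) = (3 ^ (n - i - 1) + 3) / 2"
proof -
  have "real (2 * eig_mult n x) = real (3 ^ (n - i - 1) + 3)"
    using eig_mult_zero_orbit[OF assms] by (simp only:)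
  then show ?thesis by simp
qed

lemma real_eig_mult_minus2_orbit:
  assumes "(hanoi_poly ^^ j) x = -2" "j < n"
  shows "real (eig_mult n x) = (3 ^ (n - j - 1) - 1) / 2"
proof -
  have "real (2 * eig_mult n x + 1) = real (3 ^ (n - j - 1))"
    using eig_mult_minus2_orbit[OF assms] by (simp only:)
  then show ?thesis by simp
qed

lemma eig_mult_nonzero_cases:
  assumes "eig_mult n x \<noteq> 0"
  shows "x = 3 \<or> (\<exists>i<n. (hanoi_poly ^^ i) x = 0) \<or> (\<exists>j<n - 1. (hanoi_poly ^^ j) x = -2)"
  using assms
proof (induction n arbitrary: x)
  case 0
  then show ?case by (auto simp: eig_mult_0 split: if_splits)
next
  case (Suc n)
  consider "x = 0" | "x = -2" | "x \<noteq> 0" "x \<noteq> -2" by blast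
  then show ?case
  proof cases
    case 1
    then show ?thesis by (intro disjI2 disjI1 exI[of _ 0]) simp
  next
    case 2
    then have "2 * eig_mult (Suc n) x + 1 = 3 ^ n" using eig_mult_minus2_orbit[of 0 x "Suc n"] by simp
    then have "n \<noteq> 0" using Suc.prems by (intro notI) simp
    then show ?thesis using 2 by (intro disjI2 exI[of _ 0]) simp
  next
    case 3
    then have "eig_mult n (hanoi_poly x) \<noteq> 0" using eig_mult_Suc'[of n x] Suc.prems by simp
    from Suc.IH[OF this] show ?thesis
    proof (elim disjE exE conjE)
      assume "hanoi_poly x = 3"
      then have "(x - 3) * (x + 2) = 0" by (simp add: hanoi_poly_def power2_eq_square algebra_simps)
      then show ?thesis using 3 by (simp add: eq_neg_iff_add_eq_0)
    next
      fix i assume "i < n" "(hanoi_poly ^^ i) (hanoi_poly x) = 0"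
      then show ?thesis by (intro disjI2 disjI1 exI[of _ "Suc i"]) (simp add: funpow_swap1)
    next
      fix j assume "j < n - 1" "(hanoi_poly ^^ j) (hanoi_poly x) = -2"
      then show ?thesis by (intro disjI2 exI[of _ "Suc j"] conjI) (linarith, simp add: funpow_swap1)
    qed
  qed
qed

lemma spectrum_schreier_mat_eq:
  "spectrum (schreier_mat n) =
     {3} \<union> (\<Union>i\<in>{..<n}. (hanoi_poly ^^ i) -` {0}) \<union> (\<Union>j\<in>{..<n - 1}. (hanoi_poly ^^ j) -` {-2})"
proof (intro equalityI subsetI)
  fix x assume "x \<in> spectrum (schreier_mat n)"
  then have "eig_mult n x \<noteq> 0" by (simp add: spectrum_schreier_mat)
  from eig_mult_nonzero_cases[OF this]
  show "x \<in> {3} \<union> (\<Union>i\<in>{..<n}. (hanoi_poly ^^ i) -` {0}) \<union> (\<Union>j\<in>{..<n - 1}. (hanoi_poly ^^ j) -` {-2})"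
    by auto
next
  fix x :: complex assume "x \<in> {3} \<union> (\<Union>i\<in>{..<n}. (hanoi_poly ^^ i) -` {0}) \<union> (\<Union>j\<in>{..<n - 1}. (hanoi_poly ^^ j) -` {-2})"
  then consider "x = 3" | i where "i < n" "(hanoi_poly ^^ i) x = 0" |
    j where "j < n - 1" "(hanoi_poly ^^ j) x = -2" by auto
  then have "eig_mult n x \<noteq> 0"
  proof cases
    case 1
    then show ?thesis by (simp add: eig_mult_3)
  next
    case 2
    then show ?thesis using eig_mult_zero_orbit[of i x n] by (intro notI) simp
  next
    case 3
    then have "2 * eig_mult n x + 1 = 3 ^ (n - j - 1)" by (intro eig_mult_minus2_orbit) auto
    moreover have "(3 :: nat) ^ 1 \<le> 3 ^ (n - j - 1)" using 3 by (intro power_increasing) auto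
    then have "3 \<le> (3 :: nat) ^ (n - j - 1)" by (simp only: power_one_right)
    ultimately show ?thesis by (intro notI) linarith
  qed
  then show "x \<in> spectrum (schreier_mat n)" by (simp add: spectrum_schreier_mat)
qed

text \<open>Neither 0 nor -2 returns to \<open>{0, -2}\<close>: the first escapes and the second is mapped to the fixed point 3. So an orbit visits
  \<open>{0, -2}\<close> at most once.\<close>

lemma hanoi_poly_iter_value_unique:
  fixes x :: complex
  assumes "i \<le> j" "(hanoi_poly ^^ i) x \<in> {0, -2}" "(hanoi_poly ^^ j) x \<in> {0, -2}"
  shows "i = j"
proof (rule ccontr)
  assume "i \<noteq> j"
  then obtain k where k: "j = Suc k + i" using assms(1) by (metis add.commute add_Suc le_neq_implies_less less_imp_Suc_add)
  then have "(hanoi_poly ^^ j) x = (hanoi_poly ^^ Suc k) ((hanoi_poly ^^ i) x)"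
    by (simp only: funpow_add o_apply)
  moreover have "(hanoi_poly ^^ Suc k) 0 \<notin> {0, -2 :: complex}"
    using hanoi_poly_iter_0_complex[of 0 k] hanoi_poly_iter_0_complex[of "-2" k] by auto
  moreover have "(hanoi_poly ^^ Suc k) (-2) \<notin> {0, -2 :: complex}"
    unfolding hanoi_poly_iter_minus2 by simp
  ultimately show False using assms(2,3) by (metis empty_iff insert_iff)
qed

lemma card_spectrum_schreier_mat:
  assumes "n \<ge> 1"
  shows "card (spectrum (schreier_mat n)) = 3 * 2 ^ (n - 1) - 1"
proof -
  let ?A = "\<lambda>i. (hanoi_poly ^^ i) -` {0 :: complex}" and ?B = "\<lambda>i. (hanoi_poly ^^ i) -` {-2 :: complex}"
  have fin: "finite (?A i)" "finite (?B i)" for i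
    using finite_hanoi_poly_iter_vimage[of 0 i] finite_hanoi_poly_iter_vimage[of "-2" i] by auto
  have card: "card (?A i) = 2 ^ i" "card (?B i) = 2 ^ i" for i
    using card_hanoi_poly_iter_vimage[of 0 i] card_hanoi_poly_iter_vimage[of "-2" i] by auto
  have uniq: "i = j" if "(hanoi_poly ^^ i) x \<in> {0, -2}" "(hanoi_poly ^^ j) x \<in> {0, -2}" for i j and x :: complex
    using that hanoi_poly_iter_value_unique[of i j x] hanoi_poly_iter_value_unique[of j i x]
    by (cases "i \<le> j") auto
  have sum2: "(\<Sum>i<k. 2 ^ i) = (2::nat) ^ k - 1" for k
    using sum_power2[of k] by (simp only: atLeast0LessThan)
  have cA: "card (\<Union>i\<in>{..<n}. ?A i) = 2 ^ n - 1"
  proof (subst card_UN_disjoint)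
    show "\<forall>i\<in>{..<n}. \<forall>j\<in>{..<n}. i \<noteq> j \<longrightarrow> ?A i \<inter> ?A j = {}" using uniq by blast
  qed (use fin in \<open>auto simp: card sum2\<close>)
  have cB: "card (\<Union>i\<in>{..<n - 1}. ?B i) = 2 ^ (n - 1) - 1"
  proof (subst card_UN_disjoint)
    show "\<forall>i\<in>{..<n - 1}. \<forall>j\<in>{..<n - 1}. i \<noteq> j \<longrightarrow> ?B i \<inter> ?B j = {}" using uniq by blast
  qed (use fin in \<open>auto simp: card sum2\<close>)
  have disj: "(\<Union>i\<in>{..<n}. ?A i) \<inter> (\<Union>i\<in>{..<n - 1}. ?B i) = {}"
  proof (intro equals0I)
    fix x assume "x \<in> (\<Union>i\<in>{..<n}. ?A i) \<inter> (\<Union>i\<in>{..<n - 1}. ?B i)"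
    then obtain i j where ij: "(hanoi_poly ^^ i) x = 0" "(hanoi_poly ^^ j) x = -2" by auto
    then have "i = j" by (intro uniq) auto
    with ij show False by simp
  qed
  have "card ((\<Union>i\<in>{..<n}. ?A i) \<union> (\<Union>i\<in>{..<n - 1}. ?B i)) =
      card (\<Union>i\<in>{..<n}. ?A i) + card (\<Union>i\<in>{..<n - 1}. ?B i)"
    using fin disj by (intro card_Un_disjoint) auto
  then have "card ((\<Union>i\<in>{..<n}. ?A i) \<union> (\<Union>i\<in>{..<n - 1}. ?B i)) = (2 ^ n - 1) + (2 ^ (n - 1) - 1)"
    by (simp only: cA cB)
  moreover have "3 \<notin> (\<Union>i\<in>{..<n}. ?A i) \<union> (\<Union>i\<in>{..<n - 1}. ?B i)"
    by (simp add: hanoi_poly_iter_3)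
  ultimately have "card (insert 3 ((\<Union>i\<in>{..<n}. ?A i) \<union> (\<Union>i\<in>{..<n - 1}. ?B i))) =
    Suc ((2 ^ n - 1) + (2 ^ (n - 1) - 1))"
    using fin by (subst card_insert_disjoint) auto
  moreover have "Suc ((2 ^ n - 1) + (2 ^ (n - 1) - 1)) = 3 * 2 ^ (n - 1) - (1::nat)"
  proof -
    obtain m where m: "n = Suc m" using assms by (cases n) auto
    have k: "(2::nat) ^ n = 2 * 2 ^ m" "(2::nat) ^ (n - 1) = 2 ^ m" by (simp_all add: m)
    have "1 \<le> (2::nat) ^ m" by simp
    then show ?thesis unfolding k by arith
  qed
  ultimately show ?thesis unfolding spectrum_schreier_mat_eq by (simp only: Un_insert_left Un_empty_left)
qed

section \<open>The KNS spectral measure\<close>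

subsection \<open>Uniqueness of weak limits\<close>

text \<open>Two limits agree at all points that are atoms of neither, that is, off a countable set; right continuity does the rest.\<close>

lemma weak_conv_m_unique:
  assumes M: "real_distribution M" and N: "real_distribution N"
    and lim: "weak_conv_m \<mu> M" "weak_conv_m \<mu> N"
  shows "M = N"
proof (rule cdf_unique[OF M N], rule ext, rule ccontr)
  interpret M: real_distribution M by (rule M)
  interpret N: real_distribution N by (rule N)
  fix x assume ne: "cdf M x \<noteq> cdf N x"
  have agree: "cdf M t = cdf N t" if "measure M {t} = 0" "measure N {t} = 0" for t
  proof -
    have "isCont (cdf M) t" "isCont (cdf N) t" using that by (simp_all add: M.isCont_cdf N.isCont_cdf)
    then have "(\<lambda>n. cdf (\<mu> n) t) \<longlonglongrightarrow> cdf M t" "(\<lambda>n. cdf (\<mu> n) t) \<longlonglongrightarrow> cdf N t"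
      using lim by (auto simp: weak_conv_m_def weak_conv_def)
    then show ?thesis by (rule LIMSEQ_unique)
  qed
  have "((\<lambda>t. cdf M t - cdf N t) \<longlongrightarrow> cdf M x - cdf N x) (at_right x)"
    using M.cdf_is_right_cont[of x] N.cdf_is_right_cont[of x]
    unfolding continuous_within by (rule tendsto_diff)
  then have "\<forall>\<^sub>F t in at_right x. cdf M t - cdf N t \<noteq> 0"
    using ne by (intro tendsto_imp_eventually_ne) auto
  then obtain b where b: "b > x" "\<And>t. x < t \<Longrightarrow> t < b \<Longrightarrow> cdf M t \<noteq> cdf N t"
    unfolding eventually_at_right_field by auto
  have "{x<..<b} \<subseteq> {t. measure M {t} > 0} \<union> {t. measure N {t} > 0}"
  proof
    fix t assume "t \<in> {x<..<b}"
    then have "cdf M t \<noteq> cdf N t" using b(2) by simp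
    then have "measure M {t} \<noteq> 0 \<or> measure N {t} \<noteq> 0" using agree by blast
    then show "t \<in> {t. measure M {t} > 0} \<union> {t. measure N {t} > 0}"
      by (auto simp: less_le)
  qed
  moreover have "countable ({t. measure M {t} > 0} \<union> {t. measure N {t} > 0})"
    using M.countable_atoms N.countable_atoms by blast
  ultimately have "countable {x<..<b}" by (rule countable_subset)
  with b(1) show False using uncountable_open_interval[of x b] by blast
qed

subsection \<open>The limit measure\<close>

text \<open>The atoms of mass \<open>1 / (6 * 3^i)\<close>, as real numbers.\<close>

definition hanoi_level :: "nat \<Rightarrow> real set" where
  "hanoi_level i = (hanoi_poly ^^ i) -` {0, -2}"

lemma hanoi_level_Un: "hanoi_level i = (hanoi_poly ^^ i) -` {0} \<union> (hanoi_poly ^^ i) -` {-2}"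
  by (auto simp: hanoi_level_def)

lemma finite_hanoi_level [simp]: "finite (hanoi_level i)"
  unfolding hanoi_level_Un by (simp add: finite_hanoi_poly_iter_vimage_real)

lemma card_hanoi_level_Int:
  "card (hanoi_level i \<inter> B) = card ((hanoi_poly ^^ i) -` {0} \<inter> B) + card ((hanoi_poly ^^ i) -` {-2} \<inter> B)"
proof -
  have "hanoi_level i \<inter> B = ((hanoi_poly ^^ i) -` {0} \<inter> B) \<union> ((hanoi_poly ^^ i) -` {-2} \<inter> B)"
    by (auto simp: hanoi_level_def)
  then show ?thesis
    using finite_hanoi_poly_iter_vimage_real[of 0 i] finite_hanoi_poly_iter_vimage_real[of "-2" i]
    by (simp only:) (subst card_Un_disjoint, auto)
qed

lemma card_hanoi_level: "card (hanoi_level i) = 2 * 2 ^ i"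
  using card_hanoi_level_Int[of i UNIV] card_hanoi_poly_iter_vimage_real[of 0 i]
    card_hanoi_poly_iter_vimage_real[of "-2" i] by simp

lemma hanoi_level_nonempty [simp]: "hanoi_level i \<noteq> {}"
  using card_hanoi_level[of i] by (intro notI) simp

lemma hanoi_level_unique:
  assumes "x \<in> hanoi_level i" "x \<in> hanoi_level j"
  shows "i = j"
proof -
  have "(hanoi_poly ^^ k) (complex_of_real x) \<in> {0, -2}" if "x \<in> hanoi_level k" for k
    using that by (auto simp: hanoi_level_def hanoi_poly_iter_of_real)
  from this[OF assms(1)] this[OF assms(2)] show ?thesis
    using hanoi_poly_iter_value_unique[of i j "of_real x"] hanoi_poly_iter_value_unique[of j i "of_real x"]
    by (cases "i \<le> j") auto
qed

text \<open>A geometric index \<open>i\<close> has probability \<open>(1/3) (2/3)^i\<close>, and level \<open>i\<close> has \<open>2 * 2^i\<close> points, which leaves the mass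
  \<open>1 / (6 * 3^i)\<close> for each of them.\<close>

definition hanoi_pmf :: "real pmf" where
  "hanoi_pmf = bind_pmf (geometric_pmf (1/3)) (\<lambda>i. pmf_of_set (hanoi_level i))"

lemma hanoi_pmf_sums:
  "(\<lambda>i. real (card (hanoi_level i \<inter> B)) / (6 * 3 ^ i)) sums measure (measure_pmf hanoi_pmf) B"
proof -
  let ?c = "\<lambda>i. real (card (hanoi_level i \<inter> B)) / (6 * 3 ^ i)"
  have c: "pmf (geometric_pmf (1/3)) i * measure (measure_pmf (pmf_of_set (hanoi_level i))) B = ?c i" for i
    by (simp add: measure_pmf_of_set card_hanoi_level power_divide field_simps)
  have "emeasure (measure_pmf hanoi_pmf) B =
    (\<Sum>i. ennreal (pmf (geometric_pmf (1/3)) i) * emeasure (measure_pmf (pmf_of_set (hanoi_level i))) B)"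
    unfolding hanoi_pmf_def by (simp add: nn_integral_measure_pmf nn_integral_count_space_nat)
  also have "\<dots> = (\<Sum>i. ennreal (?c i))"
    unfolding c[symmetric] measure_pmf.emeasure_eq_measure
    by (intro suminf_cong ennreal_mult[symmetric] pmf_nonneg measure_nonneg)
  finally have eq: "ennreal (measure (measure_pmf hanoi_pmf) B) = (\<Sum>i. ennreal (?c i))"
    by (simp add: measure_pmf.emeasure_eq_measure)
  have summ: "summable ?c"
  proof (rule summable_suminf_not_top)
    show "(\<Sum>i. ennreal (?c i)) \<noteq> top_class.top" unfolding eq[symmetric] by simp
  qed simp
  then have "ennreal (measure (measure_pmf hanoi_pmf) B) = ennreal (suminf ?c)"
    unfolding eq by (intro suminf_ennreal2) auto
  then have "measure (measure_pmf hanoi_pmf) B = suminf ?c"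
    using summ by (subst (asm) ennreal_inj) (auto intro: suminf_nonneg)
  then show ?thesis using summ by (simp add: sums_iff)
qed

text \<open>The same distribution as a measure on the Borel sets, in place of all sets.\<close>

definition hanoi_kns :: "real measure" where
  "hanoi_kns = distr (measure_pmf hanoi_pmf) borel (\<lambda>x. x)"

lemma real_distribution_hanoi_kns: "real_distribution hanoi_kns"
  unfolding hanoi_kns_def by (rule prob_space.real_distribution_distr[OF measure_pmf.prob_space_axioms]) simp

lemma measure_hanoi_kns: "B \<in> sets borel \<Longrightarrow> measure hanoi_kns B = measure (measure_pmf hanoi_pmf) B"
  by (simp add: hanoi_kns_def measure_distr)

lemma measure_hanoi_kns_singleton:
  assumes "x \<in> hanoi_level i"
  shows "measure hanoi_kns {x} = 1 / (6 * 3 ^ i)"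
proof -
  have "(\<lambda>j. real (card (hanoi_level j \<inter> {x})) / (6 * 3 ^ j)) =
    (\<lambda>j. if j = i then 1 / (6 * 3 ^ j) else 0)"
  proof
    fix j
    have "hanoi_level j \<inter> {x} = (if j = i then {x} else {})"
      using assms hanoi_level_unique by auto
    then show "real (card (hanoi_level j \<inter> {x})) / (6 * 3 ^ j) = (if j = i then 1 / (6 * 3 ^ j) else 0)"
      by simp
  qed
  moreover have "(\<lambda>j. if j = i then 1 / (6 * 3 ^ j) else 0 :: real) sums (1 / (6 * 3 ^ i))"
    by (rule sums_single)
  ultimately have "(\<lambda>j. real (card (hanoi_level j \<inter> {x})) / (6 * 3 ^ j)) sums (1 / (6 * 3 ^ i))"
    by (simp only:)
  with hanoi_pmf_sums[of "{x}"] have "measure (measure_pmf hanoi_pmf) {x} = 1 / (6 * 3 ^ i)"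
    by (rule sums_unique2)
  then show ?thesis by (simp add: measure_hanoi_kns)
qed

lemma countable_hanoi_levels: "countable (\<Union>i. hanoi_level i)"
  by (rule countable_UN) (auto intro: countable_finite)

lemma hanoi_levels_borel: "(\<Union>i. hanoi_level i) \<in> sets borel"
  by (rule sets.countable[OF _ countable_hanoi_levels]) simp

lemma emeasure_hanoi_kns_complement: "emeasure hanoi_kns (UNIV - (\<Union>i. hanoi_level i)) = 0"
proof -
  interpret real_distribution hanoi_kns by (rule real_distribution_hanoi_kns)
  have "hanoi_level j \<inter> (UNIV - (\<Union>i. hanoi_level i)) = {}" for j by auto
  then have "(\<lambda>_. 0) sums measure (measure_pmf hanoi_pmf) (UNIV - (\<Union>i. hanoi_level i))"
    using hanoi_pmf_sums[of "UNIV - (\<Union>i. hanoi_level i)"] by simp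
  then have "measure (measure_pmf hanoi_pmf) (UNIV - (\<Union>i. hanoi_level i)) = 0"
    using sums_unique2 sums_zero by blast
  moreover have "UNIV - (\<Union>i. hanoi_level i) \<in> sets borel" using hanoi_levels_borel by (intro sets.Diff) auto
  ultimately show ?thesis by (simp add: emeasure_eq_measure measure_hanoi_kns)
qed

subsection \<open>Convergence of the counting measures\<close>

text \<open>The support of the counting measure at level \<open>n\<close>.\<close>

definition real_spectrum :: "nat \<Rightarrow> real set" where
  "real_spectrum n = {x. complex_of_real x \<in> spectrum (schreier_mat n)}"

lemma finite_real_spectrum: "finite (real_spectrum n)"
proof -
  have "finite (of_real -` spectrum (schreier_mat n) :: real set)"
    using card_finite_spectrum(1)[OF schreier_mat_carrier]
    by (intro finite_vimageI) (auto simp: inj_on_def)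
  then show ?thesis by (simp add: real_spectrum_def vimage_def)
qed

lemma counting_measure_eq_distr:
  "counting_measure n = distr (point_measure (real_spectrum n)
     (\<lambda>x. ennreal (real (eig_mult n (complex_of_real x)) / 3 ^ n))) borel (\<lambda>x. x)"
proof -
  let ?p = "\<lambda>x. real (eig_mult n (complex_of_real x)) / 3 ^ n"
  let ?N = "distr (point_measure (real_spectrum n) (\<lambda>x. ennreal (?p x))) borel (\<lambda>x. x)"
  have em: "emeasure ?N B = ennreal ((\<Sum>x | x \<in> B \<and> complex_of_real x \<in> spectrum (schreier_mat n).
      real (eig_mult n (complex_of_real x))) / 3 ^ n)" if "B \<in> sets borel" for B
  proof -
    have "emeasure ?N B = emeasure (point_measure (real_spectrum n) (\<lambda>x. ennreal (?p x))) (B \<inter> real_spectrum n)"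
      using that by (subst emeasure_distr) (auto simp: space_point_measure)
    also have "\<dots> = (\<Sum>x\<in>B \<inter> real_spectrum n. ennreal (?p x))"
      by (intro emeasure_point_measure_finite finite_real_spectrum) auto
    also have "\<dots> = ennreal (\<Sum>x\<in>B \<inter> real_spectrum n. ?p x)"
      by (intro sum_ennreal) auto
    also have "B \<inter> real_spectrum n = {x. x \<in> B \<and> complex_of_real x \<in> spectrum (schreier_mat n)}"
      by (auto simp: real_spectrum_def)
    finally show ?thesis by (simp add: sum_divide_distrib)
  qed
  have "counting_measure n = measure_of UNIV (sets borel) (emeasure ?N)"
    unfolding counting_measure_def
  proof (rule measure_of_eq)
    fix B assume "B \<in> sigma_sets UNIV (sets (borel :: real measure))"
    then have "B \<in> sets borel" using sets.sigma_sets_eq[of "borel :: real measure"] by simp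
    then show "ennreal ((\<Sum>x | x \<in> B \<and> complex_of_real x \<in> spectrum (schreier_mat n).
      real (eig_mult n (complex_of_real x))) / 3 ^ n) = emeasure ?N B" by (simp only: em)
  qed simp
  also have "\<dots> = ?N" using measure_of_of_measure[of ?N] by simp
  finally show ?thesis .
qed

lemma cdf_counting_measure:
  "cdf (counting_measure n) t =
    (\<Sum>x\<in>real_spectrum n \<inter> {..t}. real (eig_mult n (complex_of_real x))) / 3 ^ n"
proof -
  let ?p = "\<lambda>x. real (eig_mult n (complex_of_real x)) / 3 ^ n"
  have "emeasure (counting_measure n) {..t} =
    emeasure (point_measure (real_spectrum n) (\<lambda>x. ennreal (?p x))) ({..t} \<inter> real_spectrum n)"
    unfolding counting_measure_eq_distr by (subst emeasure_distr) (auto simp: space_point_measure)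
  also have "\<dots> = (\<Sum>x\<in>{..t} \<inter> real_spectrum n. ennreal (?p x))"
    by (intro emeasure_point_measure_finite finite_real_spectrum) auto
  also have "\<dots> = ennreal (\<Sum>x\<in>{..t} \<inter> real_spectrum n. ?p x)"
    by (intro sum_ennreal) auto
  finally have "measure (counting_measure n) {..t} = (\<Sum>x\<in>{..t} \<inter> real_spectrum n. ?p x)"
    by (simp add: measure_def sum_nonneg)
  then show ?thesis by (simp add: cdf_def sum_divide_distrib Int_commute)
qed

lemma sum_eig_mult_real:
  fixes B :: "real set"
  defines "N \<equiv> \<lambda>i. real (card ((hanoi_poly ^^ i) -` {0} \<inter> B))"
    and "M \<equiv> \<lambda>i. real (card ((hanoi_poly ^^ i) -` {-2} \<inter> B))"
  shows "(\<Sum>x\<in>real_spectrum n \<inter> B. real (eig_mult n (complex_of_real x))) =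
    of_bool (3 \<in> B) + (\<Sum>i<n. N i * ((3 ^ (n - i - 1) + 3) / 2) + M i * ((3 ^ (n - i - 1) - 1) / 2))"
proof -
  let ?m = "\<lambda>x. real (eig_mult n (complex_of_real x))"
  let ?L = "(\<Union>i\<in>{..<n}. hanoi_level i \<inter> B)" and ?T = "{3} \<inter> B"
  have out: "eig_mult n (complex_of_real x) = 0" if "x \<in> (?T \<union> ?L) - (real_spectrum n \<inter> B)" for x
    using that by (auto simp: real_spectrum_def spectrum_schreier_mat)
  have sub: "real_spectrum n \<inter> B \<subseteq> ?T \<union> ?L"
  proof
    fix x assume x: "x \<in> real_spectrum n \<inter> B"
    then have "complex_of_real x = 3 \<or> (\<exists>i<n. (hanoi_poly ^^ i) (complex_of_real x) = 0) \<or>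
      (\<exists>j<n - 1. (hanoi_poly ^^ j) (complex_of_real x) = -2)"
      by (intro eig_mult_nonzero_cases) (auto simp: real_spectrum_def spectrum_schreier_mat)
    moreover have "complex_of_real x = 3 \<longleftrightarrow> x = 3" "(hanoi_poly ^^ i) (complex_of_real x) = 0 \<longleftrightarrow> (hanoi_poly ^^ i) x = 0"
      "(hanoi_poly ^^ i) (complex_of_real x) = -2 \<longleftrightarrow> (hanoi_poly ^^ i) x = -2" for i
    proof -
      show "complex_of_real x = 3 \<longleftrightarrow> x = 3"
        by (metis of_real_eq_iff of_real_numeral)
      show "(hanoi_poly ^^ i) (complex_of_real x) = 0 \<longleftrightarrow> (hanoi_poly ^^ i) x = 0"
        by (simp add: hanoi_poly_iter_of_real)
      show "(hanoi_poly ^^ i) (complex_of_real x) = -2 \<longleftrightarrow> (hanoi_poly ^^ i) x = -2"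
        unfolding hanoi_poly_iter_of_real by (metis of_real_eq_iff of_real_minus of_real_numeral)
    qed
    ultimately consider "x = 3" | i where "i < n" "(hanoi_poly ^^ i) x = 0" |
      j where "j < n - 1" "(hanoi_poly ^^ j) x = -2" by blast
    then show "x \<in> ?T \<union> ?L"
    proof cases
      case 1
      then show ?thesis using x by simp
    next
      case 2
      then show ?thesis using x by (auto simp: hanoi_level_def)
    next
      case 3
      then have "j < n" by simp
      then show ?thesis using x 3 by (auto simp: hanoi_level_def)
    qed
  qed
  have finL: "finite ?L" by auto
  have 3: "3 \<notin> hanoi_level i" for i by (simp add: hanoi_level_def hanoi_poly_iter_3)
  have "(\<Sum>x\<in>real_spectrum n \<inter> B. ?m x) = (\<Sum>x\<in>?T \<union> ?L. ?m x)"
    using sub out finL by (intro sum.mono_neutral_left) auto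
  also have "\<dots> = (\<Sum>x\<in>?T. ?m x) + (\<Sum>x\<in>?L. ?m x)"
    using finL 3 by (intro sum.union_disjoint) auto
  also have "(\<Sum>x\<in>?T. ?m x) = of_bool (3 \<in> B)"
    by (cases "3 \<in> B") (simp_all add: eig_mult_3)
  also have "(\<Sum>x\<in>?L. ?m x) = (\<Sum>i<n. \<Sum>x\<in>hanoi_level i \<inter> B. ?m x)"
    using hanoi_level_unique by (intro sum.UNION_disjoint) auto
  also have "\<dots> = (\<Sum>i<n. N i * ((3 ^ (n - i - 1) + 3) / 2) + M i * ((3 ^ (n - i - 1) - 1) / 2))"
  proof (intro sum.cong refl)
    fix i assume i: "i \<in> {..<n}"
    have fin: "finite ((hanoi_poly ^^ i) -` {0} \<inter> B)" "finite ((hanoi_poly ^^ i) -` {-2} \<inter> B)"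
      using finite_hanoi_poly_iter_vimage_real[of 0 i] finite_hanoi_poly_iter_vimage_real[of "-2" i] by auto
    have "hanoi_level i \<inter> B = ((hanoi_poly ^^ i) -` {0} \<inter> B) \<union> ((hanoi_poly ^^ i) -` {-2} \<inter> B)"
      by (auto simp: hanoi_level_def)
    then have "(\<Sum>x\<in>hanoi_level i \<inter> B. ?m x) =
      (\<Sum>x\<in>(hanoi_poly ^^ i) -` {0} \<inter> B. ?m x) + (\<Sum>x\<in>(hanoi_poly ^^ i) -` {-2} \<inter> B. ?m x)"
      using fin by (simp only:) (intro sum.union_disjoint, auto)
    also have "(\<Sum>x\<in>(hanoi_poly ^^ i) -` {0} \<inter> B. ?m x) =
      (\<Sum>x\<in>(hanoi_poly ^^ i) -` {0} \<inter> B. (3 ^ (n - i - 1) + 3) / 2)"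
      using i by (intro sum.cong real_eig_mult_zero_orbit) (auto simp: hanoi_poly_iter_of_real)
    also have "(\<Sum>x\<in>(hanoi_poly ^^ i) -` {-2} \<inter> B. ?m x) =
      (\<Sum>x\<in>(hanoi_poly ^^ i) -` {-2} \<inter> B. (3 ^ (n - i - 1) - 1) / 2)"
      using i by (intro sum.cong real_eig_mult_minus2_orbit) (auto simp: hanoi_poly_iter_of_real)
    finally show "(\<Sum>x\<in>hanoi_level i \<inter> B. ?m x) =
      N i * ((3 ^ (n - i - 1) + 3) / 2) + M i * ((3 ^ (n - i - 1) - 1) / 2)"
      by (simp add: N_def M_def)
  qed
  finally show ?thesis .
qed

text \<open>Let \<open>N i\<close> and \<open>M i\<close> count the points up to \<open>t\<close> in the \<open>i\<close>-th preimages of 0 and of -2. The distribution function of the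
  counting measure at \<open>t\<close> is the sum of the masses \<open>c i\<close> for \<open>i < n\<close>, which tends to the limit, and of an error
  \<open>e n\<close>.\<close>

lemma weak_conv_counting_measure: "weak_conv_m counting_measure hanoi_kns"
  unfolding weak_conv_m_def weak_conv_def
proof (intro allI impI)
  fix t :: real
  define N where "N i = real (card ((hanoi_poly ^^ i) -` {0} \<inter> {..t}))" for i
  define M where "M i = real (card ((hanoi_poly ^^ i) -` {-2} \<inter> {..t}))" for i
  define c where "c i = (N i + M i) / (6 * 3 ^ i)" for i
  define e where "e n = (of_bool (3 \<le> t) + (\<Sum>i<n. (3 * N i - M i) / 2)) / 3 ^ n" for n
  have bound: "0 \<le> N i \<and> N i \<le> 2 ^ i \<and> 0 \<le> M i \<and> M i \<le> 2 ^ i" for i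
  proof -
    have "card ((hanoi_poly ^^ i) -` {y} \<inter> {..t}) \<le> 2 ^ i" if "y \<in> {-2..3}" for y :: real
      using card_hanoi_poly_iter_vimage_real[OF that, of i] finite_hanoi_poly_iter_vimage_real[OF that, of i]
      by (metis card_mono inf_le1)
    from this[of 0] this[of "-2"] have "card ((hanoi_poly ^^ i) -` {0} \<inter> {..t}) \<le> 2 ^ i"
      "card ((hanoi_poly ^^ i) -` {-2} \<inter> {..t}) \<le> 2 ^ i" by auto
    then have "N i \<le> real (2 ^ i)" "M i \<le> real (2 ^ i)" unfolding N_def M_def by (simp_all only: of_nat_le_iff)
    then show ?thesis by (simp add: N_def M_def)
  qed
  have "cdf (counting_measure n) t = (\<Sum>i<n. c i) + e n" for n
  proof -
    have summand: "(N i * ((3 ^ (n - i - 1) + 3) / 2) + M i * ((3 ^ (n - i - 1) - 1) / 2)) / 3 ^ n =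
      c i + (3 * N i - M i) / 2 / 3 ^ n" if i: "i < n" for i
    proof -
      obtain k where k: "n = Suc (i + k)" using less_imp_Suc_add[OF i] by blast
      have p: "(3::real) ^ n = 3 * 3 ^ i * 3 ^ k" "(3::real) ^ (n - i - 1) = 3 ^ k"
        by (simp_all add: k power_add)
      show ?thesis unfolding p c_def by (simp add: field_simps)
    qed
    have "cdf (counting_measure n) t = (of_bool (3 \<le> t) +
      (\<Sum>i<n. N i * ((3 ^ (n - i - 1) + 3) / 2) + M i * ((3 ^ (n - i - 1) - 1) / 2))) / 3 ^ n"
      unfolding cdf_counting_measure sum_eig_mult_real N_def M_def by simp
    also have "\<dots> = of_bool (3 \<le> t) / 3 ^ n +
      (\<Sum>i<n. (N i * ((3 ^ (n - i - 1) + 3) / 2) + M i * ((3 ^ (n - i - 1) - 1) / 2)) / 3 ^ n)"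
      by (simp only: add_divide_distrib sum_divide_distrib)
    also have "\<dots> = of_bool (3 \<le> t) / 3 ^ n + (\<Sum>i<n. c i + (3 * N i - M i) / 2 / 3 ^ n)"
      using summand by simp
    also have "\<dots> = (\<Sum>i<n. c i) + e n"
      by (simp add: e_def sum.distrib add_divide_distrib sum_divide_distrib)
    finally show ?thesis .
  qed
  moreover have "e \<longlonglongrightarrow> 0"
  proof (rule Lim_null_comparison)
    show "(\<lambda>n. (1 + 3/2 * 2 ^ n) / 3 ^ n :: real) \<longlonglongrightarrow> 0" by real_asymp
    show "\<forall>\<^sub>F n in sequentially. norm (e n) \<le> (1 + 3/2 * 2 ^ n) / 3 ^ n"
    proof (intro always_eventually allI)
      fix n
      have "\<bar>\<Sum>i<n. (3 * N i - M i) / 2\<bar> \<le> (\<Sum>i<n. 3/2 * 2 ^ i)"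
      proof (rule order_trans[OF sum_abs], rule sum_mono)
        fix i show "\<bar>(3 * N i - M i) / 2\<bar> \<le> 3/2 * 2 ^ i" using bound[of i] by (simp add: abs_le_iff)
      qed
      also have "\<dots> = 3/2 * (2 ^ n - 1)"
        by (induction n) (simp_all add: field_simps)
      finally have "\<bar>of_bool (3 \<le> t)\<bar> + \<bar>\<Sum>i<n. (3 * N i - M i) / 2\<bar> \<le> 1 + 3/2 * (2 ^ n - 1)"
        by (intro add_mono) auto
      also have "\<dots> \<le> 1 + 3/2 * 2 ^ n" by simp
      finally have "\<bar>of_bool (3 \<le> t) + (\<Sum>i<n. (3 * N i - M i) / 2)\<bar> \<le> 1 + 3/2 * 2 ^ n"
        by (rule order_trans[OF abs_triangle_ineq])
      then show "norm (e n) \<le> (1 + 3/2 * 2 ^ n) / 3 ^ n"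
        unfolding e_def by (simp add: abs_divide divide_right_mono)
    qed
  qed
  moreover have "(\<lambda>n. \<Sum>i<n. c i) \<longlonglongrightarrow> cdf hanoi_kns t"
    using hanoi_pmf_sums[of "{..t}"]
    by (simp add: sums_def cdf_def measure_hanoi_kns c_def[abs_def] N_def M_def card_hanoi_level_Int)
  ultimately show "(\<lambda>n. cdf (counting_measure n) t) \<longlonglongrightarrow> cdf hanoi_kns t"
    using tendsto_add[of "\<lambda>n. \<Sum>i<n. c i" "cdf hanoi_kns t" sequentially e 0] by simp
qed

lemma kns_measure_iff: "kns_measure \<nu> \<longleftrightarrow> \<nu> = hanoi_kns"
  using weak_conv_m_unique weak_conv_counting_measure real_distribution_hanoi_kns
  unfolding kns_measure_def by blast

lemma discrete_hanoi_kns: "discrete_measure hanoi_kns"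
proof -
  have "space hanoi_kns = UNIV" "sets hanoi_kns = sets borel" by (simp_all add: hanoi_kns_def)
  then show ?thesis
    using countable_hanoi_levels hanoi_levels_borel emeasure_hanoi_kns_complement
    unfolding discrete_measure_def by (intro bexI[of _ "\<Union>i. hanoi_level i"]) auto
qed

section \<open>Bounded operators on square-summable functions\<close>

text \<open>Membership in \<open>ell2\<close> and the norm are controlled by the norms of finite restrictions. Most estimates below
  reduce to the triangle inequality for finite sums in this way.\<close>

lemma ell2_boundI:
  assumes "\<And>v. v \<notin> V \<Longrightarrow> x v = 0"
    and "\<And>F. finite F \<Longrightarrow> F \<subseteq> V \<Longrightarrow> L2_set (\<lambda>v. cmod (x v)) F \<le> C"
  shows "x \<in> ell2 V \<and> ell2_norm V x \<le> C"
proof -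
  have C: "0 \<le> C" using assms(2)[of "{}"] by simp
  have sum: "(\<Sum>v\<in>F. (cmod (x v))\<^sup>2) \<le> C\<^sup>2" if "finite F" "F \<subseteq> V" for F
    using assms(2)[OF that] C unfolding L2_set_def by (simp add: sqrt_le_D real_sqrt_le_iff real_le_lsqrt sum_nonneg)
  have summ: "(\<lambda>v. (cmod (x v))\<^sup>2) summable_on V"
    using sum by (intro nonneg_bdd_above_summable_on bdd_aboveI[of _ "C\<^sup>2"]) auto
  have "(\<Sum>\<^sub>\<infinity>v\<in>V. (cmod (x v))\<^sup>2) \<le> C\<^sup>2"
    using summ sum by (rule infsum_le_finite_sums)
  then have "ell2_norm V x \<le> C" unfolding ell2_norm_def using C by (simp add: real_le_lsqrt)
  with summ assms(1) show ?thesis by (simp add: ell2_def)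
qed

lemma ell2_outside: "x \<in> ell2 V \<Longrightarrow> v \<notin> V \<Longrightarrow> x v = 0"
  by (simp add: ell2_def)

lemma ell2_norm_nonneg [simp]: "0 \<le> ell2_norm V x"
  by (simp add: ell2_norm_def infsum_nonneg)

lemma L2_set_le_ell2_norm:
  assumes "x \<in> ell2 V" "finite F" "F \<subseteq> V"
  shows "L2_set (\<lambda>v. cmod (x v)) F \<le> ell2_norm V x"
  unfolding L2_set_def ell2_norm_def
  using assms by (intro real_sqrt_le_mono finite_sum_le_infsum) (auto simp: ell2_def)

lemma norm_le_ell2_norm:
  assumes "x \<in> ell2 V"
  shows "cmod (x v) \<le> ell2_norm V x"
proof (cases "v \<in> V")
  case True
  then show ?thesis using L2_set_le_ell2_norm[OF assms, of "{v}"] by (simp add: L2_set_def)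
qed (simp add: ell2_outside[OF assms])

lemma ell2_add:
  assumes "x \<in> ell2 V" "y \<in> ell2 V"
  shows "(\<lambda>v. x v + y v) \<in> ell2 V \<and> ell2_norm V (\<lambda>v. x v + y v) \<le> ell2_norm V x + ell2_norm V y"
proof (rule ell2_boundI)
  fix F assume F: "finite F" "F \<subseteq> V"
  have "L2_set (\<lambda>v. cmod (x v + y v)) F \<le> L2_set (\<lambda>v. cmod (x v) + cmod (y v)) F"
    by (intro L2_set_mono norm_triangle_ineq) auto
  also have "\<dots> \<le> L2_set (\<lambda>v. cmod (x v)) F + L2_set (\<lambda>v. cmod (y v)) F"
    by (rule L2_set_triangle_ineq)
  also have "\<dots> \<le> ell2_norm V x + ell2_norm V y"
    using assms F by (intro add_mono L2_set_le_ell2_norm)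
  finally show "L2_set (\<lambda>v. cmod (x v + y v)) F \<le> ell2_norm V x + ell2_norm V y" .
qed (use assms in \<open>simp add: ell2_outside\<close>)

lemma ell2_scale:
  assumes "x \<in> ell2 V"
  shows "(\<lambda>v. c * x v) \<in> ell2 V \<and> ell2_norm V (\<lambda>v. c * x v) \<le> cmod c * ell2_norm V x"
proof (rule ell2_boundI)
  fix F assume F: "finite F" "F \<subseteq> V"
  have "L2_set (\<lambda>v. cmod (c * x v)) F = cmod c * L2_set (\<lambda>v. cmod (x v)) F"
    by (simp add: norm_mult L2_set_right_distrib)
  also have "\<dots> \<le> cmod c * ell2_norm V x"
    using assms F by (intro mult_left_mono L2_set_le_ell2_norm) auto
  finally show "L2_set (\<lambda>v. cmod (c * x v)) F \<le> cmod c * ell2_norm V x" .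
qed (use assms in \<open>simp add: ell2_outside\<close>)

lemma ell2_lincomb:
  "x \<in> ell2 V \<Longrightarrow> y \<in> ell2 V \<Longrightarrow> (\<lambda>v. a * x v + b * y v) \<in> ell2 V"
  using ell2_add ell2_scale by blast

lemma ell2_zero: "(\<lambda>_. 0) \<in> ell2 V"
  by (simp add: ell2_def)

lemma bounded_op_ell2_I:
  assumes "\<And>x. x \<in> ell2 V \<Longrightarrow> A x \<in> ell2 V \<and> ell2_norm V (A x) \<le> C * ell2_norm V x"
    and "\<And>x y. x \<in> ell2 V \<Longrightarrow> y \<in> ell2 V \<Longrightarrow> A (\<lambda>v. x v + y v) = (\<lambda>v. A x v + A y v)"
    and "\<And>c x. x \<in> ell2 V \<Longrightarrow> A (\<lambda>v. c * x v) = (\<lambda>v. c * A x v)"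
  shows "bounded_op_ell2 V A"
  using assms unfolding bounded_op_ell2_def by blast

lemma bounded_op_ell2_in: "bounded_op_ell2 V A \<Longrightarrow> x \<in> ell2 V \<Longrightarrow> A x \<in> ell2 V"
  by (simp add: bounded_op_ell2_def)

lemma bounded_op_ell2_add:
  "bounded_op_ell2 V A \<Longrightarrow> x \<in> ell2 V \<Longrightarrow> y \<in> ell2 V \<Longrightarrow> A (\<lambda>v. x v + y v) = (\<lambda>v. A x v + A y v)"
  by (simp add: bounded_op_ell2_def)

lemma bounded_op_ell2_scale:
  "bounded_op_ell2 V A \<Longrightarrow> x \<in> ell2 V \<Longrightarrow> A (\<lambda>v. c * x v) = (\<lambda>v. c * A x v)"
  by (simp add: bounded_op_ell2_def)

lemma bounded_op_ell2_lincomb: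
  assumes "bounded_op_ell2 V A" "x \<in> ell2 V" "y \<in> ell2 V"
  shows "A (\<lambda>v. a * x v + b * y v) = (\<lambda>v. a * A x v + b * A y v)"
  using bounded_op_ell2_add[OF assms(1), of "\<lambda>v. a * x v" "\<lambda>v. b * y v"] assms
  by (simp add: bounded_op_ell2_scale ell2_scale)

lemma bounded_op_ell2_bound:
  assumes "bounded_op_ell2 V A"
  obtains C where "C > 0" "\<And>x. x \<in> ell2 V \<Longrightarrow> ell2_norm V (A x) \<le> C * ell2_norm V x"
proof -
  obtain C where C: "\<forall>x\<in>ell2 V. ell2_norm V (A x) \<le> C * ell2_norm V x"
    using assms by (auto simp: bounded_op_ell2_def)
  have "ell2_norm V (A x) \<le> (\<bar>C\<bar> + 1) * ell2_norm V x" if "x \<in> ell2 V" for x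
  proof -
    have "C * ell2_norm V x \<le> (\<bar>C\<bar> + 1) * ell2_norm V x" by (intro mult_right_mono) auto
    then show ?thesis using C that by force
  qed
  then show thesis by (intro that[of "\<bar>C\<bar> + 1"]) auto
qed

lemma bounded_op_ell2_lincomb_op:
  assumes A: "bounded_op_ell2 V A" and B: "bounded_op_ell2 V B"
  shows "bounded_op_ell2 V (\<lambda>x v. a * A x v + b * B x v)"
proof -
  obtain C where C: "C > 0" "\<And>x. x \<in> ell2 V \<Longrightarrow> ell2_norm V (A x) \<le> C * ell2_norm V x"
    using bounded_op_ell2_bound[OF A] by blast
  obtain D where D: "D > 0" "\<And>x. x \<in> ell2 V \<Longrightarrow> ell2_norm V (B x) \<le> D * ell2_norm V x"
    using bounded_op_ell2_bound[OF B] by blast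
  show ?thesis
  proof (rule bounded_op_ell2_I)
    fix x assume x: "x \<in> ell2 V"
    have "ell2_norm V (\<lambda>v. a * A x v + b * B x v) \<le> ell2_norm V (\<lambda>v. a * A x v) + ell2_norm V (\<lambda>v. b * B x v)"
      using A B x by (intro conjunct2[OF ell2_add]) (auto simp: ell2_scale bounded_op_ell2_in)
    also have "\<dots> \<le> cmod a * ell2_norm V (A x) + cmod b * ell2_norm V (B x)"
      using A B x by (intro add_mono) (auto simp: ell2_scale bounded_op_ell2_in)
    also have "\<dots> \<le> cmod a * (C * ell2_norm V x) + cmod b * (D * ell2_norm V x)"
      using C D x by (intro add_mono mult_left_mono) auto
    finally show "(\<lambda>v. a * A x v + b * B x v) \<in> ell2 V \<and>
      ell2_norm V (\<lambda>v. a * A x v + b * B x v) \<le> (cmod a * C + cmod b * D) * ell2_norm V x"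
      using A B x by (simp add: algebra_simps ell2_lincomb bounded_op_ell2_in)
  next
    fix x y assume "x \<in> ell2 V" "y \<in> ell2 V"
    then show "(\<lambda>v. a * A (\<lambda>v. x v + y v) v + b * B (\<lambda>v. x v + y v) v) =
      (\<lambda>v. (a * A x v + b * B x v) + (a * A y v + b * B y v))"
      using A B by (simp add: bounded_op_ell2_add algebra_simps)
  next
    fix c x assume "x \<in> ell2 V"
    then show "(\<lambda>v. a * A (\<lambda>v. c * x v) v + b * B (\<lambda>v. c * x v) v) =
      (\<lambda>v. c * (a * A x v + b * B x v))"
      using A B by (simp add: bounded_op_ell2_scale algebra_simps)
  qed
qed

lemma bounded_op_ell2_id: "bounded_op_ell2 V (\<lambda>x. x)"
  by (rule bounded_op_ell2_I[of _ _ 1]) auto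

lemma bounded_op_ell2_scale_op:
  assumes "bounded_op_ell2 V A"
  shows "bounded_op_ell2 V (\<lambda>x v. a * A x v)"
  using bounded_op_ell2_lincomb_op[OF assms assms, of a 0] by simp

lemma bounded_op_ell2_comp:
  assumes A: "bounded_op_ell2 V A" and B: "bounded_op_ell2 V B"
  shows "bounded_op_ell2 V (\<lambda>x. A (B x))"
proof -
  obtain C where C: "C > 0" "\<And>x. x \<in> ell2 V \<Longrightarrow> ell2_norm V (A x) \<le> C * ell2_norm V x"
    using bounded_op_ell2_bound[OF A] by blast
  obtain D where D: "D > 0" "\<And>x. x \<in> ell2 V \<Longrightarrow> ell2_norm V (B x) \<le> D * ell2_norm V x"
    using bounded_op_ell2_bound[OF B] by blast
  show ?thesis
  proof (rule bounded_op_ell2_I)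
    fix x assume x: "x \<in> ell2 V"
    have "ell2_norm V (A (B x)) \<le> C * ell2_norm V (B x)" using C B x by (simp add: bounded_op_ell2_in)
    also have "\<dots> \<le> C * (D * ell2_norm V x)" using C(1) D(2)[OF x] by (intro mult_left_mono) auto
    finally show "A (B x) \<in> ell2 V \<and> ell2_norm V (A (B x)) \<le> (C * D) * ell2_norm V x"
      using A B x by (simp add: mult.assoc bounded_op_ell2_in)
  qed (use A B in \<open>simp_all add: bounded_op_ell2_in bounded_op_ell2_add bounded_op_ell2_scale\<close>)
qed

text \<open>Composition with a partial injection of \<open>V\<close>. All operators on the orbit are sums of such operators.\<close>

lemma bounded_op_ell2_partial_comp:
  assumes "\<And>v. v \<in> V \<Longrightarrow> P v \<Longrightarrow> p v \<in> V" "inj_on p {v \<in> V. P v}" "\<And>v. v \<notin> V \<Longrightarrow> P v \<Longrightarrow> p v \<notin> V"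
  shows "bounded_op_ell2 V (\<lambda>x v. if P v then x (p v) else 0)"
proof (rule bounded_op_ell2_I)
  fix x assume x: "x \<in> ell2 V"
  have "(\<lambda>v. if P v then x (p v) else 0) \<in> ell2 V \<and>
    ell2_norm V (\<lambda>v. if P v then x (p v) else 0) \<le> ell2_norm V x"
  proof (rule ell2_boundI)
    fix F assume F: "finite F" "F \<subseteq> V"
    let ?F = "{v \<in> F. P v}"
    have "(\<Sum>v\<in>F. (cmod (if P v then x (p v) else 0))\<^sup>2) = (\<Sum>v\<in>?F. (cmod (x (p v)))\<^sup>2)"
      using F(1) by (simp add: sum.inter_filter) (intro sum.cong, auto)
    also have "\<dots> = (\<Sum>u\<in>p ` ?F. (cmod (x u))\<^sup>2)"
      using inj_on_subset[OF assms(2)] F(2) by (subst sum.reindex) (auto simp: inj_on_def)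
    finally have "L2_set (\<lambda>v. cmod (if P v then x (p v) else 0)) F = L2_set (\<lambda>u. cmod (x u)) (p ` ?F)"
      by (simp add: L2_set_def)
    also have "\<dots> \<le> ell2_norm V x"
      using F assms(1) by (intro L2_set_le_ell2_norm x) auto
    finally show "L2_set (\<lambda>v. cmod (if P v then x (p v) else 0)) F \<le> ell2_norm V x" .
  qed (use x assms(3) in \<open>auto simp: ell2_outside\<close>)
  then show "(\<lambda>v. if P v then x (p v) else 0) \<in> ell2 V \<and>
    ell2_norm V (\<lambda>v. if P v then x (p v) else 0) \<le> 1 * ell2_norm V x" by simp
qed auto

subsection \<open>The Neumann series\<close>

text \<open>The inverse is given pointwise by the series of the powers of \<open>A\<close>, which converges absolutely at
  each point; the bound on the norms of the partial sums passes to the sum on each finite set.\<close>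

lemma neumann_series:
  assumes A: "bounded_op_ell2 V A"
    and q: "0 \<le> q" "q < 1" "\<And>x. x \<in> ell2 V \<Longrightarrow> ell2_norm V (A x) \<le> q * ell2_norm V x"
  shows "\<exists>R. bounded_op_ell2 V R \<and>
    (\<forall>x\<in>ell2 V. R (\<lambda>v. x v - A x v) = x \<and> (\<lambda>v. R x v - A (R x) v) = x)"
proof -
  define R where "R x = (\<lambda>v. \<Sum>k. (A ^^ k) x v)" for x
  define S where "S n x = (\<lambda>v. \<Sum>k<n. (A ^^ k) x v)" for n :: nat and x
  have pow_in: "(A ^^ k) x \<in> ell2 V" if "x \<in> ell2 V" for k x
    using that by (induction k) (auto simp: bounded_op_ell2_in[OF A])
  have pow_norm: "ell2_norm V ((A ^^ k) x) \<le> q ^ k * ell2_norm V x" if "x \<in> ell2 V" for k x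
  proof (induction k)
    case (Suc k)
    have "ell2_norm V ((A ^^ Suc k) x) \<le> q * ell2_norm V ((A ^^ k) x)"
      using q(3)[OF pow_in[OF that, of k]] by simp
    also have "\<dots> \<le> q * (q ^ k * ell2_norm V x)" using Suc q(1) by (intro mult_left_mono)
    finally show ?case by (simp add: mult.assoc)
  qed simp
  have pow_pt: "cmod ((A ^^ k) x v) \<le> q ^ k * ell2_norm V x" if "x \<in> ell2 V" for k x v
    using norm_le_ell2_norm[OF pow_in[OF that]] pow_norm[OF that] by (rule order_trans)
  have summ: "summable (\<lambda>k. (A ^^ k) x v)" if "x \<in> ell2 V" for x v
    using q(1,2) by (intro summable_comparison_test'[OF _ pow_pt[OF that]] summable_mult2 summable_geometric) auto
  have S_in: "S n x \<in> ell2 V \<and> ell2_norm V (S n x) \<le> (\<Sum>k<n. q ^ k) * ell2_norm V x" if x: "x \<in> ell2 V" for n x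
  proof (induction n)
    case 0
    show ?case using ell2_zero[of V] by (simp add: S_def ell2_norm_def)
  next
    case (Suc n)
    have eq: "S (Suc n) x = (\<lambda>v. S n x v + (A ^^ n) x v)" by (simp add: S_def)
    have "ell2_norm V (S (Suc n) x) \<le> ell2_norm V (S n x) + ell2_norm V ((A ^^ n) x)"
      unfolding eq using Suc pow_in[OF x] by (intro conjunct2[OF ell2_add]) auto
    also have "\<dots> \<le> (\<Sum>k<Suc n. q ^ k) * ell2_norm V x"
      using Suc pow_norm[OF x, of n] by (simp add: algebra_simps)
    finally show ?case using Suc pow_in[OF x, of n] unfolding eq by (simp add: ell2_add)
  qed
  have S_norm: "ell2_norm V (S n x) \<le> 1 / (1 - q) * ell2_norm V x" if x: "x \<in> ell2 V" for n x
  proof -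
    have "(\<Sum>k<n. q ^ k) \<le> (\<Sum>k. q ^ k)"
      using q by (intro sum_le_suminf summable_geometric) auto
    also have "\<dots> = 1 / (1 - q)" using q by (intro suminf_geometric) auto
    finally have "(\<Sum>k<n. q ^ k) * ell2_norm V x \<le> 1 / (1 - q) * ell2_norm V x"
      by (intro mult_right_mono) auto
    then show ?thesis using S_in[OF x, of n] by linarith
  qed
  have S_lim: "(\<lambda>n. S n x v) \<longlonglongrightarrow> R x v" if "x \<in> ell2 V" for x v
    unfolding S_def R_def using summ[OF that] by (rule summable_LIMSEQ)
  have R_in: "R x \<in> ell2 V \<and> ell2_norm V (R x) \<le> 1 / (1 - q) * ell2_norm V x" if x: "x \<in> ell2 V" for x
  proof (rule ell2_boundI)
    fix v assume "v \<notin> V"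
    then show "R x v = 0" using ell2_outside[OF pow_in[OF x]] by (simp add: R_def)
  next
    fix F assume F: "finite F" "F \<subseteq> V"
    have "(\<lambda>n. L2_set (\<lambda>v. cmod (S n x v)) F) \<longlonglongrightarrow> L2_set (\<lambda>v. cmod (R x v)) F"
      unfolding L2_set_def by (intro tendsto_intros S_lim x)
    moreover have "L2_set (\<lambda>v. cmod (S n x v)) F \<le> 1 / (1 - q) * ell2_norm V x" for n
      using L2_set_le_ell2_norm[OF conjunct1[OF S_in[OF x]] F] S_norm[OF x] by (rule order_trans)
    ultimately show "L2_set (\<lambda>v. cmod (R x v)) F \<le> 1 / (1 - q) * ell2_norm V x"
      by (intro LIMSEQ_le_const2) auto
  qed
  have pow_add: "(A ^^ k) (\<lambda>v. x v + y v) = (\<lambda>v. (A ^^ k) x v + (A ^^ k) y v)"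
    if "x \<in> ell2 V" "y \<in> ell2 V" for k x y
    using that by (induction k) (simp_all add: bounded_op_ell2_add[OF A pow_in pow_in])
  have pow_scale: "(A ^^ k) (\<lambda>v. c * x v) = (\<lambda>v. c * (A ^^ k) x v)" if "x \<in> ell2 V" for k c x
    using that by (induction k) (simp_all add: bounded_op_ell2_scale[OF A pow_in])
  have BR: "bounded_op_ell2 V R"
  proof (rule bounded_op_ell2_I[OF R_in])
    fix x y assume xy: "x \<in> ell2 V" "y \<in> ell2 V"
    show "R (\<lambda>v. x v + y v) = (\<lambda>v. R x v + R y v)"
      unfolding R_def pow_add[OF xy] using suminf_add[OF summ[OF xy(1)] summ[OF xy(2)]] by simp
  next
    fix c x assume x: "x \<in> ell2 V"
    show "R (\<lambda>v. c * x v) = (\<lambda>v. c * R x v)"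
      unfolding R_def pow_scale[OF x] using suminf_mult[OF summ[OF x]] by simp
  qed
  have pow_lim: "(\<lambda>k. (A ^^ k) x v) \<longlonglongrightarrow> 0" if "x \<in> ell2 V" for x v
    using summ[OF that] by (rule summable_LIMSEQ_zero)
  have left: "R (\<lambda>v. x v - A x v) = x" if x: "x \<in> ell2 V" for x
  proof
    fix v
    have "(A ^^ k) (\<lambda>v. x v - A x v) = (\<lambda>v. (A ^^ k) x v - (A ^^ Suc k) x v)" for k
    proof -
      have "(\<lambda>v. x v - A x v) = (\<lambda>v. x v + (-1) * A x v)" by simp
      then have "(A ^^ k) (\<lambda>v. x v - A x v) = (\<lambda>v. (A ^^ k) x v + (-1) * (A ^^ k) (A x) v)"
        using x by (simp only: pow_add pow_scale ell2_scale bounded_op_ell2_in[OF A])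
      then show ?thesis by (simp add: funpow_swap1)
    qed
    then have "R (\<lambda>v. x v - A x v) v = (\<Sum>k. (A ^^ k) x v - (A ^^ Suc k) x v)"
      by (simp add: R_def)
    also have "\<dots> = (A ^^ 0) x v - 0"
      using telescope_sums'[OF pow_lim[OF x, of v]] by (rule sums_unique[symmetric])
    finally show "R (\<lambda>v. x v - A x v) v = x v" by simp
  qed
  have right: "(\<lambda>v. R x v - A (R x) v) = x" if x: "x \<in> ell2 V" for x
  proof
    fix v
    \<comment> \<open>Continuity of \<open>A\<close> enters through the tail \<open>R (A^n x)\<close>, whose norm tends to 0.\<close>
    have split: "R x = (\<lambda>v. S n x v + R ((A ^^ n) x) v)" for n
    proof
      fix v
      show "R x v = S n x v + R ((A ^^ n) x) v"
        unfolding R_def S_def using suminf_split_initial_segment[OF summ[OF x], of v n]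
        by (simp add: funpow_add add.commute)
    qed
    have AS: "A (S n x) v = S (Suc n) x v - x v" for n
    proof (induction n)
      case 0
      have "A (\<lambda>v. 0 * x v) = (\<lambda>v. 0 * A x v)" by (rule bounded_op_ell2_scale[OF A x])
      then show ?case by (simp add: S_def)
    next
      case (Suc n)
      have eq: "S (Suc n) x = (\<lambda>v. S n x v + (A ^^ n) x v)" for n by (simp add: S_def)
      have "A (S (Suc n) x) v = A (S n x) v + (A ^^ Suc n) x v"
        unfolding eq[of n] using bounded_op_ell2_add[OF A conjunct1[OF S_in[OF x]] pow_in[OF x], of n n] by simp
      then show ?case using Suc eq[of "Suc n"] by simp
    qed
    have "A (R x) v = S (Suc n) x v - x v + A (R ((A ^^ n) x)) v" for n
    proof -
      have "A (R x) = (\<lambda>v. A (S n x) v + A (R ((A ^^ n) x)) v)"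
        by (subst split[of n]) (intro bounded_op_ell2_add[OF A] conjunct1[OF S_in] conjunct1[OF R_in] x pow_in)
      then show ?thesis by (simp add: AS)
    qed
    then have err: "A (R ((A ^^ n) x)) v = A (R x) v - (S (Suc n) x v - x v)" for n
      by (simp add: algebra_simps)
    have "cmod (A (R ((A ^^ n) x)) v) \<le> q ^ n * (q * (1 / (1 - q)) * ell2_norm V x)" for n
    proof -
      have "cmod (A (R ((A ^^ n) x)) v) \<le> ell2_norm V (A (R ((A ^^ n) x)))"
        by (intro norm_le_ell2_norm bounded_op_ell2_in[OF A] conjunct1[OF R_in] pow_in x)
      also have "\<dots> \<le> q * ell2_norm V (R ((A ^^ n) x))"
        by (intro q(3) conjunct1[OF R_in] pow_in x)
      also have "\<dots> \<le> q * (1 / (1 - q) * ell2_norm V ((A ^^ n) x))"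
        using q(1) by (intro mult_left_mono conjunct2[OF R_in] pow_in x)
      also have "\<dots> \<le> q * (1 / (1 - q) * (q ^ n * ell2_norm V x))"
        using q by (intro mult_left_mono pow_norm x) auto
      finally show ?thesis by (simp add: mult_ac)
    qed
    moreover have "(\<lambda>n. q ^ n * (q * (1 / (1 - q)) * ell2_norm V x)) \<longlonglongrightarrow> 0"
      using q by (intro tendsto_mult_left_zero LIMSEQ_power_zero) auto
    ultimately have "(\<lambda>n. A (R ((A ^^ n) x)) v) \<longlonglongrightarrow> 0"
      by (rule Lim_null_comparison[OF always_eventually[OF allI]])
    moreover have "(\<lambda>n. A (R ((A ^^ n) x)) v) \<longlonglongrightarrow> A (R x) v - (R x v - x v)"
      unfolding err by (intro tendsto_intros LIMSEQ_Suc[OF S_lim[OF x]])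
    ultimately have "A (R x) v - (R x v - x v) = 0" using LIMSEQ_unique by blast
    then show "R x v - A (R x) v = x v" by (simp add: algebra_simps)
  qed
  from BR left right show ?thesis by blast
qed

lemma spectrum_ell2_bounded:
  assumes A: "bounded_op_ell2 V A" and C: "\<And>x. x \<in> ell2 V \<Longrightarrow> ell2_norm V (A x) \<le> C * ell2_norm V x"
    and z: "C < cmod z" and C0: "0 \<le> C"
  shows "z \<notin> spectrum_ell2 V A"
proof -
  have z0: "z \<noteq> 0" using z C0 by auto
  have BA: "bounded_op_ell2 V (\<lambda>x v. 1 / z * A x v)" by (rule bounded_op_ell2_scale_op[OF A])
  have norm: "ell2_norm V (\<lambda>v. 1 / z * A x v) \<le> (C / cmod z) * ell2_norm V x" if "x \<in> ell2 V" for x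
  proof -
    have "ell2_norm V (\<lambda>v. 1 / z * A x v) \<le> cmod (1 / z) * ell2_norm V (A x)"
      using that by (intro conjunct2[OF ell2_scale] bounded_op_ell2_in[OF A])
    also have "\<dots> \<le> cmod (1 / z) * (C * ell2_norm V x)"
      using C that by (intro mult_left_mono) auto
    finally show ?thesis by (simp add: norm_divide)
  qed
  have "0 \<le> C / cmod z" "C / cmod z < 1" using z C0 z0 by (auto simp: field_simps)
  from neumann_series[OF BA this norm] obtain R where R: "bounded_op_ell2 V R"
    "\<And>x. x \<in> ell2 V \<Longrightarrow> R (\<lambda>v. x v - 1 / z * A x v) = x"
    "\<And>x. x \<in> ell2 V \<Longrightarrow> (\<lambda>v. R x v - 1 / z * A (R x) v) = x" by blast
  have "(\<lambda>v. 1 / z * R (\<lambda>v. z * x v - A x v) v) = x" if x: "x \<in> ell2 V" for x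
  proof -
    have "(\<lambda>v. z * x v - A x v) = (\<lambda>v. z * (x v - 1 / z * A x v))"
      using z0 by (simp add: algebra_simps)
    moreover have "(\<lambda>v. x v - 1 / z * A x v) \<in> ell2 V"
      using ell2_lincomb[OF x bounded_op_ell2_in[OF A x], of 1 "- 1 / z"] by simp
    ultimately have "R (\<lambda>v. z * x v - A x v) = (\<lambda>v. z * R (\<lambda>v. x v - 1 / z * A x v) v)"
      using bounded_op_ell2_scale[OF R(1)] by simp
    then show ?thesis using z0 R(2)[OF x] by simp
  qed
  moreover have "(\<lambda>v. z * (1 / z * R x v) - A (\<lambda>v. 1 / z * R x v) v) = x" if x: "x \<in> ell2 V" for x
  proof -
    have "A (\<lambda>v. 1 / z * R x v) = (\<lambda>v. 1 / z * A (R x) v)"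
      by (rule bounded_op_ell2_scale[OF A bounded_op_ell2_in[OF R(1) x]])
    then show ?thesis using R(3)[OF x] z0 by simp
  qed
  moreover have "bounded_op_ell2 V (\<lambda>x v. 1 / z * R x v)" by (rule bounded_op_ell2_scale_op[OF R(1)])
  ultimately show ?thesis unfolding spectrum_ell2_def by blast
qed

lemma closed_spectrum_ell2:
  assumes A: "bounded_op_ell2 V A"
  shows "closed (spectrum_ell2 V A)"
proof -
  have "open (- spectrum_ell2 V A)"
    unfolding open_dist
  proof
    fix z0 assume "z0 \<in> - spectrum_ell2 V A"
    then obtain R where R: "bounded_op_ell2 V R"
      "\<And>x. x \<in> ell2 V \<Longrightarrow> R (\<lambda>v. z0 * x v - A x v) = x"
      "\<And>x. x \<in> ell2 V \<Longrightarrow> (\<lambda>v. z0 * R x v - A (R x) v) = x"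
      unfolding spectrum_ell2_def by blast
    obtain K where K: "K > 0" "\<And>x. x \<in> ell2 V \<Longrightarrow> ell2_norm V (R x) \<le> K * ell2_norm V x"
      using bounded_op_ell2_bound[OF R(1)] by blast
    have "z \<in> - spectrum_ell2 V A" if "dist z z0 < 1 / K" for z
    proof -
      define e where "e = z0 - z"
      have e: "cmod e * K < 1" using that K(1) by (simp add: e_def dist_norm norm_minus_commute field_simps)
      have BE: "bounded_op_ell2 V (\<lambda>x v. e * R x v)" by (rule bounded_op_ell2_scale_op[OF R(1)])
      have norm: "ell2_norm V (\<lambda>v. e * R x v) \<le> (cmod e * K) * ell2_norm V x" if "x \<in> ell2 V" for x
      proof -
        have "ell2_norm V (\<lambda>v. e * R x v) \<le> cmod e * ell2_norm V (R x)"
          using that by (intro conjunct2[OF ell2_scale] bounded_op_ell2_in[OF R(1)])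
        also have "\<dots> \<le> cmod e * (K * ell2_norm V x)"
          using K that by (intro mult_left_mono) auto
        finally show ?thesis by simp
      qed
      have "0 \<le> cmod e * K" using K(1) by simp
      from neumann_series[OF BE this e norm] obtain N where N: "bounded_op_ell2 V N"
        "\<And>x. x \<in> ell2 V \<Longrightarrow> N (\<lambda>v. x v - e * R x v) = x"
        "\<And>x. x \<in> ell2 V \<Longrightarrow> (\<lambda>v. N x v - e * R (N x) v) = x" by blast
      have "(\<lambda>v. z * R (N x) v - A (R (N x)) v) = x" if x: "x \<in> ell2 V" for x
      proof
        fix v
        have "z0 * R (N x) v - A (R (N x)) v = N x v"
          using fun_cong[OF R(3)[OF bounded_op_ell2_in[OF N(1) x]], of v] .
        moreover have "N x v - e * R (N x) v = x v" using fun_cong[OF N(3)[OF x], of v] .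
        ultimately show "z * R (N x) v - A (R (N x)) v = x v" by (simp add: e_def algebra_simps)
      qed
      moreover have "R (N (\<lambda>v. z * x v - A x v)) = x" if x: "x \<in> ell2 V" for x
      proof -
        define w where "w = (\<lambda>v. z0 * x v - A x v)"
        have w: "w \<in> ell2 V"
          using ell2_lincomb[OF x bounded_op_ell2_in[OF A x], of z0 "-1"] by (simp add: w_def)
        have Rw: "R w = x" unfolding w_def by (rule R(2)[OF x])
        have "(\<lambda>v. z * x v - A x v) = (\<lambda>v. w v - e * R w v)"
          unfolding Rw by (simp add: w_def e_def algebra_simps)
        then show ?thesis using N(2)[OF w] Rw by simp
      qed
      moreover have "bounded_op_ell2 V (\<lambda>x. R (N x))" by (rule bounded_op_ell2_comp[OF R(1) N(1)])
      ultimately show ?thesis unfolding spectrum_ell2_def by blast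
    qed
    then show "\<exists>e>0. \<forall>y. dist y z0 < e \<longrightarrow> y \<in> - spectrum_ell2 V A"
      using K(1) by (intro exI[of _ "1 / K"]) auto
  qed
  then show ?thesis by (simp add: closed_def)
qed

lemma eigenvalue_in_spectrum_ell2:
  assumes x: "x \<in> ell2 V" "x \<noteq> (\<lambda>_. 0)" and eig: "A x = (\<lambda>v. z * x v)"
  shows "z \<in> spectrum_ell2 V A"
proof (rule ccontr)
  assume "z \<notin> spectrum_ell2 V A"
  then obtain R where R: "bounded_op_ell2 V R" "R (\<lambda>v. z * x v - A x v) = x"
    using x(1) unfolding spectrum_ell2_def by blast
  have "R (\<lambda>v. 0 * x v) = (\<lambda>v. 0 * R x v)" by (rule bounded_op_ell2_scale[OF R(1) x(1)])
  then have "R (\<lambda>v. z * x v - A x v) = (\<lambda>_. 0)" by (simp add: eig)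
  with R(2) x(2) show False by simp
qed

section \<open>The spectrum of the infinite Schreier graph\<close>

subsection \<open>Spectral decimation\<close>

text \<open>The resolvent form of the spectral decimation, by the Woodbury identity. In terms of \<open>G = (y - P)^-1\<close>, a resolvent \<open>S\<close> at
  \<open>f(z)\<close> gives the resolvent \<open>G + d G U S W G\<close> at \<open>z\<close>, and a resolvent \<open>R\<close> at \<open>z\<close> gives \<open>(1 + W R U) / d\<close> at \<open>f(z)\<close>;
  here \<open>W\<close> plays the role of the adjoint of \<open>U\<close>.\<close>

lemma spectral_decimation:
  fixes U W P T :: "('v \<Rightarrow> complex) \<Rightarrow> ('v \<Rightarrow> complex)"
  assumes U: "bounded_op_ell2 V U" and W: "bounded_op_ell2 V W" and P: "bounded_op_ell2 V P"
    and T: "bounded_op_ell2 V T"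
    and WU: "\<And>x. x \<in> ell2 V \<Longrightarrow> W (U x) = (\<lambda>v. 3 * x v)"
    and PP: "\<And>x. x \<in> ell2 V \<Longrightarrow> P (P x) = x"
    and WPU: "\<And>x. x \<in> ell2 V \<Longrightarrow> W (P (U x)) = T x"
    and T_eq: "\<And>x. x \<in> ell2 V \<Longrightarrow> T x = (\<lambda>v. U (W x) v - x v + P x v)"
    and z: "z \<noteq> 0" "z \<noteq> -2"
  shows "z \<in> spectrum_ell2 V T \<longleftrightarrow> hanoi_poly z \<in> spectrum_ell2 V T"
proof -
  define y where "y = z + 1"
  define d where "d = y\<^sup>2 - 1"
  define f where "f = hanoi_poly z"
  have "d = z * (z + 2)" by (simp add: d_def y_def power2_eq_square algebra_simps)
  then have d0: "d \<noteq> 0" using z by (simp add: eq_neg_iff_add_eq_0)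
  have f: "f = d - 3 * y" by (simp add: f_def d_def y_def hanoi_poly_def power2_eq_square algebra_simps)
  define G where "G x = (\<lambda>v. (y / d) * x v + (1 / d) * P x v)" for x
  have G: "bounded_op_ell2 V G"
    unfolding G_def[abs_def] by (rule bounded_op_ell2_lincomb_op[OF bounded_op_ell2_id P])
  note ins = bounded_op_ell2_in[OF U] bounded_op_ell2_in[OF W] bounded_op_ell2_in[OF P]
    bounded_op_ell2_in[OF T] bounded_op_ell2_in[OF G]
  have PG: "P (G x) = (\<lambda>v. (y / d) * P x v + (1 / d) * x v)" if x: "x \<in> ell2 V" for x
    unfolding G_def using bounded_op_ell2_lincomb[OF P x ins(3)[OF x], of "y / d" "1 / d"]
    by (simp add: PP[OF x])
  have C1: "y * G x v - P (G x) v = x v" if x: "x \<in> ell2 V" for x v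
  proof -
    have "y * G x v - P (G x) v = ((y\<^sup>2 - 1) / d) * x v"
      unfolding PG[OF x] by (simp add: G_def power2_eq_square field_simps d0)
    then show ?thesis using d0 by (simp add: d_def)
  qed
  have C2: "G (\<lambda>v. y * x v - P x v) = x" if x: "x \<in> ell2 V" for x
  proof
    fix v
    have "G (\<lambda>v. y * x v + (-1) * P x v) = (\<lambda>v. y * G x v + (-1) * G (P x) v)"
      by (rule bounded_op_ell2_lincomb[OF G x ins(3)[OF x]])
    moreover have "G (P x) = P (G x)"
      unfolding PG[OF x] by (simp add: G_def PP[OF x])
    ultimately show "G (\<lambda>v. y * x v - P x v) v = x v" using C1[OF x, of v] by simp
  qed
  have D: "W (G (U t)) = (\<lambda>v. (3 * y / d) * t v + (1 / d) * T t v)" if t: "t \<in> ell2 V" for t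
  proof -
    have "W (G (U t)) = (\<lambda>v. (y / d) * W (U t) v + (1 / d) * W (P (U t)) v)"
      unfolding G_def by (rule bounded_op_ell2_lincomb[OF W ins(1)[OF t] ins(3)[OF ins(1)[OF t]]])
    then show ?thesis by (simp add: WU[OF t] WPU[OF t] mult_ac)
  qed
  have zT: "z * x v - T x v = y * x v - P x v - U (W x) v" if x: "x \<in> ell2 V" for x v
    unfolding T_eq[OF x] by (simp add: y_def algebra_simps)
  have E: "z * G r v - T (G r) v = r v - U (W (G r)) v" if r: "r \<in> ell2 V" for r v
    using zT[OF ins(5)[OF r], of v] C1[OF r, of v] by simp
  have forward: "z \<notin> spectrum_ell2 V T" if "f \<notin> spectrum_ell2 V T"
  proof -
    from that obtain S where S: "bounded_op_ell2 V S"
      and SL: "\<And>t. t \<in> ell2 V \<Longrightarrow> S (\<lambda>v. f * t v - T t v) = t"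
      and SR: "\<And>t. t \<in> ell2 V \<Longrightarrow> (\<lambda>v. f * S t v - T (S t) v) = t"
      unfolding spectrum_ell2_def by blast
    note insS = bounded_op_ell2_in[OF S]
    define R where "R x = (\<lambda>v. 1 * G x v + d * G (U (S (W (G x)))) v)" for x
    have R: "bounded_op_ell2 V R"
      unfolding R_def[abs_def] 
      by (rule bounded_op_ell2_lincomb_op[OF G bounded_op_ell2_comp[OF G bounded_op_ell2_comp[OF U
            bounded_op_ell2_comp[OF S bounded_op_ell2_comp[OF W G]]]]])
    have "(\<lambda>v. z * R x v - T (R x) v) = x" if x: "x \<in> ell2 V" for x
    proof
      fix v
      define q where "q = W (G x)"
      have q: "q \<in> ell2 V" using x by (simp add: q_def ins)
      define s where "s = S q"
      have s: "s \<in> ell2 V" using q by (simp add: s_def insS)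
      define r where "r = (\<lambda>v. 1 * x v + d * U s v)"
      have r: "r \<in> ell2 V" unfolding r_def by (rule ell2_lincomb[OF x ins(1)[OF s]])
      have Gr: "G r = (\<lambda>v. 1 * G x v + d * G (U s) v)"
        unfolding r_def by (rule bounded_op_ell2_lincomb[OF G x ins(1)[OF s]])
      have R: "R x = G r" unfolding Gr by (simp add: R_def s_def q_def)
      have fs: "f * s v - T s v = q v" for v using fun_cong[OF SR[OF q], of v] by (simp add: s_def)
      have "W (G r) = (\<lambda>v. 1 * q v + d * W (G (U s)) v)"
        unfolding Gr q_def by (rule bounded_op_ell2_lincomb[OF W ins(5)[OF x] ins(5)[OF ins(1)[OF s]]])
      also have "\<dots> = (\<lambda>v. d * s v)"
        unfolding D[OF s] using d0 by (auto simp: fs[symmetric] f algebra_simps)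
      finally have "U (W (G r)) = (\<lambda>v. d * U s v)" by (simp add: bounded_op_ell2_scale[OF U s])
      then show "z * R x v - T (R x) v = x v" unfolding R E[OF r] by (simp add: r_def)
    qed
    moreover have "R (\<lambda>v. z * x v - T x v) = x" if x: "x \<in> ell2 V" for x
    proof -
      define t where "t = W x"
      have t: "t \<in> ell2 V" using x by (simp add: t_def ins)
      have Cx: "(\<lambda>v. y * x v - P x v) \<in> ell2 V"
        using ell2_lincomb[OF x ins(3)[OF x], of y "-1"] by simp
      define x' where "x' = (\<lambda>v. 1 * (y * x v - P x v) + (-1) * U t v)"
      have x': "(\<lambda>v. z * x v - T x v) = x'"
        using zT[OF x] by (simp add: x'_def t_def)
      have "G x' = (\<lambda>v. 1 * G (\<lambda>v. y * x v - P x v) v + (-1) * G (U t) v)"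
        unfolding x'_def by (rule bounded_op_ell2_lincomb[OF G Cx ins(1)[OF t]])
      then have Gx': "G x' = (\<lambda>v. 1 * x v + (-1) * G (U t) v)" by (simp add: C2[OF x])
      have ft: "(\<lambda>v. f * t v - T t v) \<in> ell2 V"
        using ell2_lincomb[OF t ins(4)[OF t], of f "-1"] by simp
      have "W (G x') = (\<lambda>v. 1 * t v + (-1) * W (G (U t)) v)"
        unfolding Gx' t_def using t
        by (intro bounded_op_ell2_lincomb[OF W x ins(5)[OF ins(1)]]) (simp add: t_def)
      also have "\<dots> = (\<lambda>v. (1 / d) * (f * t v - T t v))"
        unfolding D[OF t] using d0 by (auto simp: f field_simps)
      finally have "S (W (G x')) = (\<lambda>v. (1 / d) * t v)"
        by (simp only: bounded_op_ell2_scale[OF S ft] SL[OF t])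
      then have "U (S (W (G x'))) = (\<lambda>v. (1 / d) * U t v)"
        by (simp only: bounded_op_ell2_scale[OF U t])
      then have "G (U (S (W (G x')))) = (\<lambda>v. (1 / d) * G (U t) v)"
        by (simp only: bounded_op_ell2_scale[OF G ins(1)[OF t]])
      then have "R x' = x" using d0 by (simp add: R_def Gx')
      then show ?thesis by (simp add: x')
    qed
    ultimately show ?thesis using R unfolding spectrum_ell2_def by blast
  qed
  have backward: "f \<notin> spectrum_ell2 V T" if "z \<notin> spectrum_ell2 V T"
  proof -
    from that obtain R where R: "bounded_op_ell2 V R"
      and RL: "\<And>t. t \<in> ell2 V \<Longrightarrow> R (\<lambda>v. z * t v - T t v) = t"
      and RR: "\<And>t. t \<in> ell2 V \<Longrightarrow> (\<lambda>v. z * R t v - T (R t) v) = t"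
      unfolding spectrum_ell2_def by blast
    note insR = bounded_op_ell2_in[OF R]
    define S where "S t = (\<lambda>v. (1 / d) * t v + (1 / d) * W (R (U t)) v)" for t
    have S: "bounded_op_ell2 V S"
      unfolding S_def[abs_def] 
      by (rule bounded_op_ell2_lincomb_op[OF bounded_op_ell2_id bounded_op_ell2_comp[OF W
            bounded_op_ell2_comp[OF R U]]])
    have aux: "p = d * q" if "1 / d * p = q" for p q
      using that d0 by (auto simp: field_simps)
    have "S (\<lambda>v. f * t v - T t v) = t" if t: "t \<in> ell2 V" for t
    proof -
      have Ut: "U t \<in> ell2 V" and Tt: "T t \<in> ell2 V" and GUt: "G (U t) \<in> ell2 V"
        using t by (simp_all add: ins)
      have UT: "U (\<lambda>v. a * t v + b * T t v) = (\<lambda>v. a * U t v + b * U (T t) v)" for a b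
        by (rule bounded_op_ell2_lincomb[OF U t Tt])
      have "(\<lambda>v. z * G (U t) v - T (G (U t)) v) = (\<lambda>v. (1 / d) * U (\<lambda>v. f * t v + (-1) * T t v) v)"
        unfolding E[OF Ut] D[OF t] UT using d0 by (auto simp: f field_simps)
      then have 1: "R (\<lambda>v. (1 / d) * U (\<lambda>v. f * t v + (-1) * T t v) v) = G (U t)"
        using RL[OF GUt] by simp
      have "U (\<lambda>v. f * t v + (-1) * T t v) \<in> ell2 V"
        by (intro ins(1) ell2_lincomb t Tt)
      from bounded_op_ell2_scale[OF R this, of "1 / d"] 1
      have eq: "(\<lambda>v. 1 / d * R (U (\<lambda>v. f * t v + (-1) * T t v)) v) = G (U t)" by (simp only:)
      have "1 / d * R (U (\<lambda>v. f * t v + (-1) * T t v)) v = G (U t) v" for v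
        using eq by (rule fun_cong)
      then have "R (U (\<lambda>v. f * t v + (-1) * T t v)) = (\<lambda>v. d * G (U t) v)"
        by (intro ext aux)
      then have "W (R (U (\<lambda>v. f * t v + (-1) * T t v))) = (\<lambda>v. 3 * y * t v + T t v)"
        using d0 by (simp only: bounded_op_ell2_scale[OF W GUt] D[OF t]) (simp add: algebra_simps)
      then have "S (\<lambda>v. f * t v + (-1) * T t v) = t"
        using d0 by (simp only: S_def) (auto simp: f field_simps)
      then show ?thesis by simp
    qed
    moreover have "(\<lambda>v. f * S t v - T (S t) v) = t" if t: "t \<in> ell2 V" for t
    proof
      fix v
      define w where "w = R (U t)"
      have w: "w \<in> ell2 V" using t by (simp add: w_def ins insR)
      have Ww: "W w \<in> ell2 V" using w by (simp add: ins)
      define s where "s = S t"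
      have s: "s \<in> ell2 V" using t bounded_op_ell2_in[OF S] by (simp add: s_def)
      have s_eq: "s = (\<lambda>v. (1 / d) * t v + (1 / d) * W w v)" by (simp add: s_def S_def w_def)
      have "y * w v - P w v = U t v + U (W w) v" for v
        using fun_cong[OF RR[OF ins(1)[OF t]], of v] zT[OF w, of v] by (simp add: w_def)
      then have "(\<lambda>v. y * w v - P w v) = (\<lambda>v. d * U s v)"
        unfolding s_eq bounded_op_ell2_lincomb[OF U t Ww] using d0 by (auto simp: field_simps)
      then have "w = G (\<lambda>v. d * U s v)" using C2[OF w] by simp
      then have "w = (\<lambda>v. d * G (U s) v)" by (simp only: bounded_op_ell2_scale[OF G ins(1)[OF s]])
      then have "W w = (\<lambda>v. d * W (G (U s)) v)"
        using bounded_op_ell2_scale[OF W ins(5)[OF ins(1)[OF s]], of d] by simp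
      then have Ww_eq: "W w = (\<lambda>v. 3 * y * s v + T s v)"
        unfolding D[OF s] using d0 by (simp add: algebra_simps)
      have "d * s v = t v + W w v" unfolding s_eq using d0 by (simp add: field_simps)
      then have "f * s v - T s v = t v" unfolding f Ww_eq by (simp add: algebra_simps)
      then show "f * S t v - T (S t) v = t v" by (simp add: s_def)
    qed
    ultimately show ?thesis using S unfolding spectrum_ell2_def by blast
  qed
  show ?thesis using forward backward unfolding f_def by blast
qed

subsection \<open>The orbit of the zero sequence\<close>

lemma hanoi_move_inf_SCons [simp]:
  "hanoi_move_inf i j (k ## u) =
    (if k = i then j ## u else if k = j then i ## u else k ## hanoi_move_inf i j u)"
  by (subst hanoi_move_inf.code) simp

lemma hanoi_move_inf_involutive [simp]: "hanoi_move_inf i j (hanoi_move_inf i j w) = w"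
proof (coinduction arbitrary: w rule: stream.coinduct_strong)
  case (Eq_stream w)
  show ?case by (cases w) auto
qed

lemma inv_hanoi_move_inf [simp]: "inv_into UNIV (hanoi_move_inf i j) = hanoi_move_inf i j"
  by (rule inv_equality) simp_all

text \<open>The three generators, acting on infinite words.\<close>

abbreviation hanoi_gens :: "(nat stream \<Rightarrow> nat stream) set" where
  "hanoi_gens \<equiv> {hanoi_move_inf 0 1, hanoi_move_inf 0 2, hanoi_move_inf 1 2}"

text \<open>The vertex set of the infinite Schreier graph.\<close>

definition orbit_000 :: "nat stream set" where
  "orbit_000 = hanoi_orbit (sconst 0)"

lemma spectrum_000_alt: "spectrum_000 = spectrum_ell2 orbit_000 schreier_op"
  by (simp only: spectrum_000_def orbit_000_def)

lemma hanoi_move_inf_Bij: "hanoi_move_inf i j \<in> Bij UNIV"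
proof -
  have "bij (hanoi_move_inf i j)" by (rule o_bij[of "hanoi_move_inf i j"]) auto
  then show ?thesis by (simp add: Bij_def)
qed

lemma hanoi_gens_Bij: "hanoi_gens \<subseteq> carrier (BijGroup UNIV)"
  using hanoi_move_inf_Bij by (simp add: BijGroup_def)

lemma BijGroup_mult_apply:
  "g \<in> carrier (BijGroup UNIV) \<Longrightarrow> h \<in> carrier (BijGroup UNIV) \<Longrightarrow> (g \<otimes>\<^bsub>BijGroup UNIV\<^esub> h) w = g (h w)"
  by (simp add: BijGroup_def compose_def)

lemma hanoi_group_carrier: "g \<in> hanoi_group \<Longrightarrow> g \<in> carrier (BijGroup UNIV)"
  unfolding hanoi_group_def using group.generate_in_carrier[OF group_BijGroup hanoi_gens_Bij] .

lemma stl_sconst: "stl (sconst k) = sconst k"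
  by (simp only: siterate.simps id_apply)

lemma sconst_unfold: "k ## sconst k = sconst k"
  by (metis siterate.simps(1) stl_sconst stream.collapse)

lemma sconst_in_orbit_000: "sconst 0 \<in> orbit_000"
proof -
  have "\<one>\<^bsub>BijGroup UNIV\<^esub> \<in> hanoi_group" unfolding hanoi_group_def by (rule generate.one)
  moreover have "\<one>\<^bsub>BijGroup UNIV\<^esub> (sconst 0) = (sconst 0 :: nat stream)" by (simp add: BijGroup_def)
  ultimately show ?thesis unfolding orbit_000_def hanoi_orbit_def by (metis (mono_tags, lifting) mem_Collect_eq)
qed

lemma orbit_000_step:
  assumes "s \<in> hanoi_gens" "v \<in> orbit_000"
  shows "s v \<in> orbit_000"
proof -
  obtain g where g: "g \<in> hanoi_group" "v = g (sconst 0)" using assms(2) by (auto simp: orbit_000_def hanoi_orbit_def)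
  have "s \<otimes>\<^bsub>BijGroup UNIV\<^esub> g \<in> hanoi_group"
    using g(1) unfolding hanoi_group_def by (rule generate.eng[OF generate.incl[OF assms(1)]])
  moreover have "(s \<otimes>\<^bsub>BijGroup UNIV\<^esub> g) (sconst 0) = s v"
    using assms(1) hanoi_gens_Bij hanoi_group_carrier[OF g(1)] g(2) by (subst BijGroup_mult_apply) auto
  ultimately show ?thesis unfolding orbit_000_def hanoi_orbit_def by (metis (mono_tags, lifting) mem_Collect_eq)
qed

lemma inv_hanoi_gen:
  assumes "h \<in> hanoi_gens"
  shows "inv\<^bsub>BijGroup UNIV\<^esub> h = h"
proof (rule group.inv_equality[OF group_BijGroup])
  show h: "h \<in> carrier (BijGroup UNIV)" "h \<in> carrier (BijGroup UNIV)" using assms hanoi_gens_Bij by auto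
  show "h \<otimes>\<^bsub>BijGroup UNIV\<^esub> h = \<one>\<^bsub>BijGroup UNIV\<^esub>"
  proof
    fix w
    show "(h \<otimes>\<^bsub>BijGroup UNIV\<^esub> h) w = \<one>\<^bsub>BijGroup UNIV\<^esub> w"
      unfolding BijGroup_mult_apply[OF h] using assms by (auto simp: BijGroup_def)
  qed
qed

text \<open>The orbit is the least set that contains the zero sequence and is closed under the generators, which are their own
  inverses.\<close>

lemma orbit_000_induct [consumes 1, case_names base step]:
  assumes "v \<in> orbit_000" and base: "Q (sconst 0)"
    and step: "\<And>s v. s \<in> hanoi_gens \<Longrightarrow> v \<in> orbit_000 \<Longrightarrow> Q v \<Longrightarrow> Q (s v)"
  shows "Q v"
proof -
  obtain g where g: "g \<in> hanoi_group" "v = g (sconst 0)" using assms(1) by (auto simp: orbit_000_def hanoi_orbit_def)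
  have "w \<in> orbit_000 \<and> Q w \<Longrightarrow> g w \<in> orbit_000 \<and> Q (g w)" for w
    using g(1) unfolding hanoi_group_def
  proof (induction g arbitrary: w rule: generate.induct)
    case one
    then show ?case by (simp add: BijGroup_def)
  next
    case (incl h)
    then show ?case using orbit_000_step step by blast
  next
    case (inv h)
    then show ?case unfolding inv_hanoi_gen[OF inv(1)] using orbit_000_step step by blast
  next
    case (eng h1 h2)
    have "h1 \<in> carrier (BijGroup UNIV)" "h2 \<in> carrier (BijGroup UNIV)"
      using eng.hyps group.generate_in_carrier[OF group_BijGroup hanoi_gens_Bij] by blast+
    then show ?case using eng by (simp add: BijGroup_mult_apply)
  qed
  from this[of "sconst 0"] show ?thesis using base sconst_in_orbit_000 g(2) by blast
qed

lemma orbit_000_step_iff: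
  assumes "s \<in> hanoi_gens"
  shows "s v \<in> orbit_000 \<longleftrightarrow> v \<in> orbit_000"
proof -
  have "s (s v) = v" using assms by auto
  then show ?thesis using orbit_000_step[OF assms] by metis
qed

lemma hanoi_move_inf_in_orbit_000 [simp]:
  "hanoi_move_inf 0 1 v \<in> orbit_000 \<longleftrightarrow> v \<in> orbit_000"
  "hanoi_move_inf 0 (Suc 0) v \<in> orbit_000 \<longleftrightarrow> v \<in> orbit_000"
  "hanoi_move_inf 0 2 v \<in> orbit_000 \<longleftrightarrow> v \<in> orbit_000"
  "hanoi_move_inf 1 2 v \<in> orbit_000 \<longleftrightarrow> v \<in> orbit_000"
  "hanoi_move_inf (Suc 0) 2 v \<in> orbit_000 \<longleftrightarrow> v \<in> orbit_000"
  using orbit_000_step_iff[of "hanoi_move_inf 0 1" v] orbit_000_step_iff[of "hanoi_move_inf 0 2" v]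
    orbit_000_step_iff[of "hanoi_move_inf 1 2" v] by (simp_all only: insert_iff simp_thms One_nat_def)

lemma SCons_in_orbit_000_change:
  assumes "k ## u \<in> orbit_000" "k \<in> {0, 1, 2}" "l \<in> {0, 1, 2}"
  shows "l ## u \<in> orbit_000"
proof (cases "k = l")
  case False
  have "hanoi_move_inf 0 1 (k ## u) \<in> orbit_000" "hanoi_move_inf 0 2 (k ## u) \<in> orbit_000"
    "hanoi_move_inf 1 2 (k ## u) \<in> orbit_000"
    using assms(1) by (simp_all only: hanoi_move_inf_in_orbit_000)
  then show ?thesis using False assms(2,3) by (auto split: if_splits)
qed (use assms in simp)

text \<open>The orbit is self-similar. To prepend letters: if \<open>k\<close> is the letter that the generator \<open>s\<close> does not
  move, then \<open>s\<close> maps \<open>ku\<close> to \<open>k s(u)\<close>; and first letters can be changed at will.\<close>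

lemma SCons_in_orbit_000_iff: "k ## u \<in> orbit_000 \<longleftrightarrow> k \<in> {0, 1, 2} \<and> u \<in> orbit_000"
proof
  have "shd v \<in> {0, 1, 2} \<and> stl v \<in> orbit_000" if "v \<in> orbit_000" for v
    using that
  proof (induction rule: orbit_000_induct)
    case base
    have "shd (sconst (0::nat)) = 0" by simp
    then show ?case using sconst_in_orbit_000 by (simp only: stl_sconst insert_iff simp_thms)
  next
    case (step s v)
    obtain k u where v: "v = k ## u" by (cases v)
    have u: "k \<in> {0, 1, 2}" "u \<in> orbit_000" using step.IH by (simp_all add: v)
    have "hanoi_move_inf 0 1 u \<in> orbit_000" "hanoi_move_inf 0 2 u \<in> orbit_000"
      "hanoi_move_inf 1 2 u \<in> orbit_000"
      using u(2) by (simp_all only: hanoi_move_inf_in_orbit_000)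
    then show ?case using step.hyps(1) u unfolding v by auto
  qed
  from this[of "k ## u"] show "k ## u \<in> orbit_000 \<Longrightarrow> k \<in> {0, 1, 2} \<and> u \<in> orbit_000"
    by (simp only: stream.sel)
next
  have "\<forall>k\<in>{0, 1, 2}. k ## u \<in> orbit_000" if "u \<in> orbit_000" for u
    using that
  proof (induction rule: orbit_000_induct)
    case base
    have "0 ## sconst 0 \<in> orbit_000" using sconst_in_orbit_000 by (simp only: sconst_unfold)
    then show ?case using SCons_in_orbit_000_change by blast
  next
    case (step s u)
    have "\<exists>k\<in>{0, 1, 2}. s (k ## u) = k ## s u"
      using step.hyps(1) by auto
    then obtain k where k: "k \<in> {0, 1, 2}" "s (k ## u) = k ## s u" by blast
    have "s (k ## u) \<in> orbit_000" using step.IH k(1) orbit_000_step[OF step.hyps(1), of "k ## u"] by blast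
    then show ?case using SCons_in_orbit_000_change k by metis
  qed
  then show "k \<in> {0, 1, 2} \<and> u \<in> orbit_000 \<Longrightarrow> k ## u \<in> orbit_000" by blast
qed

subsection \<open>Self-similarity of the adjacency operator\<close>

text \<open>The analogues for infinite words of \<open>opposite_move\<close> and \<open>tail_move\<close>.\<close>

definition opposite_move_inf :: "nat \<Rightarrow> nat stream \<Rightarrow> nat stream" where
  "opposite_move_inf k =
    (if k = 0 then hanoi_move_inf 1 2 else if k = 1 then hanoi_move_inf 0 2 else hanoi_move_inf 0 1)"

definition tail_move_inf :: "nat stream \<Rightarrow> nat stream" where
  "tail_move_inf w = shd w ## opposite_move_inf (shd w) (stl w)"

lemma opposite_move_inf_involutive [simp]: "opposite_move_inf k (opposite_move_inf k u) = u"
  by (simp add: opposite_move_inf_def)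

lemma tail_move_inf_SCons [simp]: "tail_move_inf (k ## u) = k ## opposite_move_inf k u"
  by (simp add: tail_move_inf_def)

lemma tail_move_inf_involutive [simp]: "tail_move_inf (tail_move_inf w) = w"
  by (cases w) simp

lemma opposite_move_inf_in_orbit [simp]: "opposite_move_inf k u \<in> orbit_000 \<longleftrightarrow> u \<in> orbit_000"
  by (simp add: opposite_move_inf_def)

lemma tail_move_inf_in_orbit [simp]: "tail_move_inf w \<in> orbit_000 \<longleftrightarrow> w \<in> orbit_000"
  by (cases w) (simp add: SCons_in_orbit_000_iff)

text \<open>The operators \<open>U\<close>, \<open>U*\<close> and \<open>P\<close> on functions on the orbit. The first is cut off outside of the orbit, where a letter
  above 2 may precede a word in the orbit.\<close>

definition lift_op :: "(nat stream \<Rightarrow> complex) \<Rightarrow> nat stream \<Rightarrow> complex" where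
  "lift_op x w = (if w \<in> orbit_000 then x (stl w) else 0)"

definition fold_op :: "(nat stream \<Rightarrow> complex) \<Rightarrow> nat stream \<Rightarrow> complex" where
  "fold_op x u = x (0 ## u) + x (1 ## u) + x (2 ## u)"

definition tail_op :: "(nat stream \<Rightarrow> complex) \<Rightarrow> nat stream \<Rightarrow> complex" where
  "tail_op x w = x (tail_move_inf w)"

lemma bounded_op_ell2_sum3:
  assumes "bounded_op_ell2 V A" "bounded_op_ell2 V B" "bounded_op_ell2 V C"
  shows "bounded_op_ell2 V (\<lambda>x v. A x v + B x v + C x v)"
  using bounded_op_ell2_lincomb_op[OF bounded_op_ell2_lincomb_op[OF assms(1,2), of 1 1] assms(3), of 1 1]
  by simp

lemma bounded_lift_op: "bounded_op_ell2 orbit_000 lift_op"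
proof -
  have b: "bounded_op_ell2 orbit_000 (\<lambda>x w. if w \<in> orbit_000 \<and> shd w = k then x (stl w) else 0)" for k
  proof (rule bounded_op_ell2_partial_comp)
    fix v assume "v \<in> orbit_000" then show "stl v \<in> orbit_000"
      by (cases v) (simp add: SCons_in_orbit_000_iff)
  next
    show "inj_on stl {v \<in> orbit_000. v \<in> orbit_000 \<and> shd v = k}"
      by (auto simp: inj_on_def intro: stream.expand)
  qed simp
  have "lift_op = (\<lambda>x w. (if w \<in> orbit_000 \<and> shd w = 0 then x (stl w) else 0) +
     (if w \<in> orbit_000 \<and> shd w = 1 then x (stl w) else 0) +
     (if w \<in> orbit_000 \<and> shd w = 2 then x (stl w) else 0))"
  proof (intro ext)
    fix x w
    show "lift_op x w = (if w \<in> orbit_000 \<and> shd w = 0 then x (stl w) else 0) +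
     (if w \<in> orbit_000 \<and> shd w = 1 then x (stl w) else 0) +
     (if w \<in> orbit_000 \<and> shd w = 2 then x (stl w) else 0)"
      by (cases w) (auto simp: lift_op_def SCons_in_orbit_000_iff)
  qed
  then show ?thesis using bounded_op_ell2_sum3[OF b b b, of 0 1 2] by simp
qed

lemma bounded_fold_op: "bounded_op_ell2 orbit_000 fold_op"
proof -
  have b: "bounded_op_ell2 orbit_000 (\<lambda>x u. x (k ## u))" if "k \<in> {0, 1, 2}" for k
    using bounded_op_ell2_partial_comp[of orbit_000 "\<lambda>_. True" "\<lambda>u. k ## u"] that
    by (simp add: SCons_in_orbit_000_iff inj_on_def)
  show ?thesis unfolding fold_op_def[abs_def] by (intro bounded_op_ell2_sum3 b) auto
qed

lemma bounded_involution_op: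
  assumes "\<And>v. p (p v) = v" "\<And>v. p v \<in> V \<longleftrightarrow> v \<in> V"
  shows "bounded_op_ell2 V (\<lambda>x v. x (p v))"
proof -
  have "inj p" by (metis assms(1) injI)
  then show ?thesis
    using bounded_op_ell2_partial_comp[of V "\<lambda>_. True" p] assms(2)
    by (simp add: inj_on_def)
qed

lemma bounded_tail_op: "bounded_op_ell2 orbit_000 tail_op"
  unfolding tail_op_def[abs_def] by (rule bounded_involution_op) auto

lemma schreier_op_apply:
  "schreier_op x v = x (hanoi_move_inf 0 1 v) + x (hanoi_move_inf 0 2 v) + x (hanoi_move_inf 1 2 v)"
  by (simp add: schreier_op_def perm_op_def)

lemma bounded_schreier_op: "bounded_op_ell2 orbit_000 schreier_op"
  unfolding schreier_op_apply[abs_def]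
  by (intro bounded_op_ell2_sum3 bounded_involution_op) simp_all

lemma fold_lift_op:
  assumes "x \<in> ell2 orbit_000"
  shows "fold_op (lift_op x) = (\<lambda>v. 3 * x v)"
  using ell2_outside[OF assms] by (intro ext) (auto simp: fold_op_def lift_op_def SCons_in_orbit_000_iff)

lemma tail_tail_op: "tail_op (tail_op x) = x"
  by (simp add: tail_op_def[abs_def])

lemma fold_tail_lift_op:
  assumes "x \<in> ell2 orbit_000"
  shows "fold_op (tail_op (lift_op x)) = schreier_op x"
proof
  fix v
  show "fold_op (tail_op (lift_op x)) v = schreier_op x v"
  proof (cases "v \<in> orbit_000")
    case True
    then show ?thesis
      by (simp add: fold_op_def tail_op_def lift_op_def SCons_in_orbit_000_iff schreier_op_apply)
        (simp add: opposite_move_inf_def)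
  next
    case False
    then have "schreier_op x v = 0"
      using ell2_outside[OF assms] by (simp add: schreier_op_apply)
    with False show ?thesis
      by (simp add: fold_op_def tail_op_def lift_op_def SCons_in_orbit_000_iff)
  qed
qed

lemma schreier_op_decomposition:
  assumes "x \<in> ell2 orbit_000"
  shows "schreier_op x = (\<lambda>v. lift_op (fold_op x) v - x v + tail_op x v)"
proof
  fix v
  show "schreier_op x v = lift_op (fold_op x) v - x v + tail_op x v"
  proof (cases "v \<in> orbit_000")
    case True
    obtain k u where v: "v = k ## u" by (cases v)
    then have "k \<in> {0, 1, 2}" "lift_op (fold_op x) v = fold_op x u"
      using True by (auto simp: SCons_in_orbit_000_iff lift_op_def)
    then show ?thesis
      by (auto simp: v schreier_op_apply tail_op_def fold_op_def opposite_move_inf_def)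
  next
    case False
    then have "schreier_op x v = 0" "x v = 0" "tail_op x v = 0"
      using ell2_outside[OF assms] by (simp_all add: schreier_op_apply tail_op_def)
    with False show ?thesis by (simp add: lift_op_def)
  qed
qed

lemma spectrum_000_decimation:
  assumes "z \<noteq> 0" "z \<noteq> -2"
  shows "z \<in> spectrum_000 \<longleftrightarrow> hanoi_poly z \<in> spectrum_000"
  unfolding spectrum_000_alt
  by (rule spectral_decimation[OF bounded_lift_op bounded_fold_op bounded_tail_op bounded_schreier_op])
    (use assms in \<open>simp_all add: fold_lift_op tail_tail_op fold_tail_lift_op schreier_op_decomposition\<close>)

subsection \<open>The spectrum as a closure\<close>

text \<open>An eigenvector for the eigenvalue 0, supported on the words \<open>kl000...\<close>. It sums to 0 over each triangle and is
  invariant under \<open>P\<close>; the words \<open>11000...\<close> and \<open>22000...\<close>, which \<open>P\<close> moves out of this set, carry the value 0.\<close>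

definition kernel_values :: "nat \<Rightarrow> nat \<Rightarrow> complex" where
  "kernel_values k l =
    (if k = 0 \<and> l = 0 then 2 else if (k, l) \<in> {(0, 1), (0, 2)} then 1
     else if (k, l) \<in> {(1, 0), (1, 2), (2, 0), (2, 1)} then -1 else 0)"

definition kernel_vector :: "nat stream \<Rightarrow> complex" where
  "kernel_vector v = (if stl (stl v) = sconst 0 then kernel_values (shd v) (shd (stl v)) else 0)"

lemma kernel_vector_SCons: "kernel_vector (k ## l ## t) = (if t = sconst 0 then kernel_values k l else 0)"
  by (simp add: kernel_vector_def)

lemma kernel_vector_in_ell2: "kernel_vector \<in> ell2 orbit_000"
proof -
  have supp: "\<exists>k\<in>{0, 1, 2}. \<exists>l\<in>{0, 1, 2}. v = k ## l ## sconst 0" if "kernel_vector v \<noteq> 0" for v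
  proof -
    obtain k l t where v: "v = k ## l ## t" by (metis stream.collapse)
    show ?thesis using that unfolding v
      by (auto simp: kernel_vector_SCons kernel_values_def split: if_splits)
  qed
  have "{v \<in> orbit_000. (cmod (kernel_vector v))\<^sup>2 \<noteq> 0} \<subseteq> (\<lambda>(k, l). k ## l ## sconst 0) ` ({0, 1, 2} \<times> {0, 1, 2})"
    using supp by force
  then have "finite {v \<in> orbit_000. (cmod (kernel_vector v))\<^sup>2 \<noteq> 0}" by (rule finite_subset) auto
  then have "(\<lambda>v. (cmod (kernel_vector v))\<^sup>2) summable_on orbit_000"
    by (rule finite_nonzero_values_imp_summable_on)
  moreover have "kernel_vector v = 0" if "v \<notin> orbit_000" for v
    using supp that sconst_in_orbit_000 by (metis SCons_in_orbit_000_iff)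
  ultimately show ?thesis by (simp add: ell2_def)
qed

lemma fold_kernel_vector: "fold_op kernel_vector = (\<lambda>_. 0)"
proof
  fix u :: "nat stream"
  obtain l t where u: "u = l ## t" by (cases u)
  show "fold_op kernel_vector u = 0"
    unfolding u fold_op_def kernel_vector_SCons by (auto simp: kernel_values_def)
qed

lemma hanoi_move_inf_sconst:
  assumes "i \<noteq> k" "j \<noteq> k"
  shows "hanoi_move_inf i j (sconst k) = sconst k"
proof -
  let ?h = "hanoi_move_inf i j (sconst k)"
  have "?h = hanoi_move_inf i j (k ## sconst k)" by (simp only: sconst_unfold)
  also have "\<dots> = k ## ?h" using assms by (simp del: siterate.simps)
  finally have h: "?h = k ## ?h" .
  have hs: "shd ?h = k" "stl ?h = ?h" by (subst h, simp only: stream.sel)+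
  have ss: "shd (sconst k) = k" by simp
  show ?thesis
    by (rule stream.coinduct[of "\<lambda>x y. x = ?h \<and> y = sconst k"])
      (simp_all only: hs ss stl_sconst simp_thms)
qed

lemma tail_kernel_vector: "tail_op kernel_vector = kernel_vector"
proof
  fix v :: "nat stream"
  obtain k l t where v: "v = k ## l ## t" by (metis stream.collapse)
  have "hanoi_move_inf 1 2 t = sconst 0 \<longleftrightarrow> t = sconst 0"
    by (metis hanoi_move_inf_sconst hanoi_move_inf_involutive zero_neq_one zero_neq_numeral)
  then show "tail_op kernel_vector v = kernel_vector v"
    unfolding v tail_op_def tail_move_inf_SCons opposite_move_inf_def
    by (auto simp: kernel_vector_SCons kernel_values_def)
qed

lemma zero_in_spectrum_000: "0 \<in> spectrum_000"
  unfolding spectrum_000_alt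
proof (rule eigenvalue_in_spectrum_ell2[OF kernel_vector_in_ell2])
  have "kernel_vector (0 ## 0 ## sconst 0) = 2"
    unfolding kernel_vector_SCons by (simp add: kernel_values_def)
  then show "kernel_vector \<noteq> (\<lambda>_. 0)" by (metis zero_neq_numeral)
  show "schreier_op kernel_vector = (\<lambda>v. 0 * kernel_vector v)"
    unfolding schreier_op_decomposition[OF kernel_vector_in_ell2] fold_kernel_vector tail_kernel_vector
    by (simp add: lift_op_def)
qed

text \<open>A point of the spectrum whose orbit avoids 0 and -2 has its whole forward orbit in the bounded
  spectrum, so it does not escape; an orbit through -2 does not escape either.\<close>

lemma spectrum_000_eq: "spectrum_000 = closure hanoi_zeros"
proof
  show "closure hanoi_zeros \<subseteq> spectrum_000"
  proof (rule closure_minimal)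
    show "closed spectrum_000"
      unfolding spectrum_000_alt by (rule closed_spectrum_ell2[OF bounded_schreier_op])
    have "z \<in> spectrum_000" if "(hanoi_poly ^^ i) z = 0" for i z
      using that
    proof (induction i arbitrary: z)
      case 0
      then show ?case using zero_in_spectrum_000 by simp
    next
      case (Suc i)
      have "z \<noteq> 0" using hanoi_poly_iter_0_complex[of 0 i] Suc.prems by auto
      moreover have "z \<noteq> -2" using hanoi_poly_iter_minus2[of i, where 'a = complex] Suc.prems by auto
      moreover have "hanoi_poly z \<in> spectrum_000"
        using Suc.prems by (intro Suc.IH) (simp only: funpow_Suc_right o_apply)
      ultimately show ?case using spectrum_000_decimation by blast
    qed
    then show "hanoi_zeros \<subseteq> spectrum_000" by (auto simp: hanoi_zeros_def)
  qed
next
  obtain C where C: "C > 0"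
    "\<And>x. x \<in> ell2 orbit_000 \<Longrightarrow> ell2_norm orbit_000 (schreier_op x) \<le> C * ell2_norm orbit_000 x"
    using bounded_op_ell2_bound[OF bounded_schreier_op] by blast
  have bounded: "cmod z \<le> C" if "z \<in> spectrum_000" for z
  proof (rule ccontr)
    assume "\<not> cmod z \<le> C"
    then have "z \<notin> spectrum_ell2 orbit_000 schreier_op"
      using C by (intro spectrum_ell2_bounded[OF bounded_schreier_op, of C]) auto
    with that show False by (simp add: spectrum_000_alt)
  qed
  show "spectrum_000 \<subseteq> closure hanoi_zeros"
  proof
    fix z assume z: "z \<in> spectrum_000"
    show "z \<in> closure hanoi_zeros"
    proof (rule ccontr)
      assume "z \<notin> closure hanoi_zeros"
      then have nz: "z \<notin> hanoi_zeros" and nK: "z \<notin> hanoi_filled_julia"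
        by (auto simp: closure_hanoi_zeros)
      have "(hanoi_poly ^^ n) z \<in> spectrum_000" for n
      proof (induction n)
        case (Suc n)
        have "(hanoi_poly ^^ n) z \<noteq> 0" using nz by (auto simp: hanoi_zeros_def)
        moreover have "(hanoi_poly ^^ n) z \<noteq> -2"
          using nK minus2_preimage_in_hanoi_filled_julia by blast
        ultimately show ?case using spectrum_000_decimation Suc by simp
      qed (use z in simp)
      then have "cmod ((hanoi_poly ^^ n) z) \<le> C" for n by (intro bounded)
      moreover obtain n where "C < cmod ((hanoi_poly ^^ n) z)"
        using hanoi_escape_unbounded[OF nK] by blast
      ultimately show False by (meson not_le)
    qed
  qed
qed

section \<open>Spectra of the Hanoi Towers graphs\<close>

theorem theorem2p3:
  fixes f :: "complex \<Rightarrow> complex" and f_real :: "real \<Rightarrow> real" and a b :: "nat \<Rightarrow> real"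
  defines "f \<equiv> hanoi_poly" and "f_real \<equiv> hanoi_poly"
    and "a \<equiv> \<lambda>i. (3 ^ (i - 1) + 3) / 2" and "b \<equiv> \<lambda>j. (3 ^ (j - 1) - 1) / 2"
  shows
    "(\<forall>n\<ge>1.
        card (spectrum (schreier_mat n)) = 3 * 2 ^ (n - 1) - 1 \<and>
        spectrum (schreier_mat n) =
          {3} \<union> (\<Union>i\<in>{..<n}. (f ^^ i) -` {0}) \<union> (\<Union>j\<in>{..<n - 1}. (f ^^ j) -` {-2}) \<and>
        (\<forall>i<n. card ((f ^^ i) -` {0}) = 2 ^ i \<and>
          (\<forall>x\<in>(f ^^ i) -` {0}. real (eig_mult n x) = a (n - i))) \<and>
        (\<forall>j<n - 1. card ((f ^^ j) -` {-2}) = 2 ^ j \<and>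
          (\<forall>x\<in>(f ^^ j) -` {-2}. real (eig_mult n x) = b (n - j)))) \<and>
     (spectrum_000 = closure ({3} \<union> (\<Union>i. (f ^^ i) -` {0, -2})) \<and>
      closure ({3} \<union> (\<Union>i. (f ^^ i) -` {0, -2})) = closure (\<Union>i. (f ^^ i) -` {0}) \<and>
      (let I = {x. x isolated_in spectrum_000}; J = {x. x islimpt spectrum_000} in
        spectrum_000 = I \<union> J \<and>
        I = (\<Union>i. (f ^^ i) -` {0}) \<and>
        J = julia_set f \<and>
        cantor_set J)) \<and>
     ((\<exists>!\<nu>. kns_measure \<nu>) \<and>
      (\<forall>\<nu>. kns_measure \<nu> \<longrightarrow>
        discrete_measure \<nu> \<and>
        emeasure \<nu> (UNIV - (\<Union>i. (f_real ^^ i) -` {0, -2})) = 0 \<and>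
        (\<forall>i. \<forall>x\<in>(f_real ^^ i) -` {0, -2}. measure \<nu> {x} = 1 / (6 * 3 ^ i))))"
proof -
  have preim: "card ((hanoi_poly ^^ i) -` {0 :: complex}) = 2 ^ i"
    "card ((hanoi_poly ^^ i) -` {-2 :: complex}) = 2 ^ i" for i
    using card_hanoi_poly_iter_vimage[of 0 i] card_hanoi_poly_iter_vimage[of "-2" i] by simp_all
  have part1: "card (spectrum (schreier_mat n)) = 3 * 2 ^ (n - 1) - 1 \<and>
        spectrum (schreier_mat n) =
          {3} \<union> (\<Union>i\<in>{..<n}. (f ^^ i) -` {0}) \<union> (\<Union>j\<in>{..<n - 1}. (f ^^ j) -` {-2}) \<and>
        (\<forall>i<n. card ((f ^^ i) -` {0}) = 2 ^ i \<and>
          (\<forall>x\<in>(f ^^ i) -` {0}. real (eig_mult n x) = a (n - i))) \<and>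
        (\<forall>j<n - 1. card ((f ^^ j) -` {-2}) = 2 ^ j \<and>
          (\<forall>x\<in>(f ^^ j) -` {-2}. real (eig_mult n x) = b (n - j)))" if "n \<ge> 1" for n
  proof (intro conjI allI impI ballI)
    show "card (spectrum (schreier_mat n)) = 3 * 2 ^ (n - 1) - 1"
      using that by (rule card_spectrum_schreier_mat)
    show "spectrum (schreier_mat n) =
          {3} \<union> (\<Union>i\<in>{..<n}. (f ^^ i) -` {0}) \<union> (\<Union>j\<in>{..<n - 1}. (f ^^ j) -` {-2})"
      unfolding f_def by (rule spectrum_schreier_mat_eq)
  next
    fix i x assume "i < n" "x \<in> (f ^^ i) -` {0}"
    then show "real (eig_mult n x) = a (n - i)"
      unfolding f_def a_def by (intro real_eig_mult_zero_orbit) auto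
  next
    fix j x assume "j < n - 1" "x \<in> (f ^^ j) -` {-2}"
    then show "real (eig_mult n x) = b (n - j)"
      unfolding f_def b_def by (intro real_eig_mult_minus2_orbit) auto
  qed (simp_all only: f_def preim)
  have zeros: "(\<Union>i. (f ^^ i) -` {0}) = hanoi_zeros" by (simp add: f_def hanoi_zeros_def)
  have limpt: "{x. x islimpt spectrum_000} = hanoi_filled_julia"
    by (simp add: spectrum_000_eq islimpt_closure_hanoi_zeros)
  have isolated: "{x. x isolated_in spectrum_000} = hanoi_zeros"
  proof -
    have "x isolated_in spectrum_000 \<longleftrightarrow> x \<notin> hanoi_filled_julia \<and> x \<in> hanoi_zeros \<union> hanoi_filled_julia" for x
      by (simp only: isolated_in_islimpt_iff spectrum_000_eq islimpt_closure_hanoi_zeros)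
        (simp only: closure_hanoi_zeros)
    then show ?thesis using hanoi_zeros_not_filled by auto
  qed
  have part2: "spectrum_000 = closure ({3} \<union> (\<Union>i. (f ^^ i) -` {0, -2})) \<and>
      closure ({3} \<union> (\<Union>i. (f ^^ i) -` {0, -2})) = closure (\<Union>i. (f ^^ i) -` {0}) \<and>
      (let I = {x. x isolated_in spectrum_000}; J = {x. x islimpt spectrum_000} in
        spectrum_000 = I \<union> J \<and>
        I = (\<Union>i. (f ^^ i) -` {0}) \<and>
        J = julia_set f \<and>
        cantor_set J)"
    unfolding Let_def isolated limpt zeros
    using cantor_set_hanoi_filled_julia
    by (simp add: f_def closure_hanoi_backward_orbits[unfolded Un_insert_left Un_empty_left]
        spectrum_000_eq closure_hanoi_zeros julia_set_hanoi_poly)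
  have levels: "(f_real ^^ i) -` {0, -2} = hanoi_level i" for i
    by (simp add: f_real_def hanoi_level_def)
  have part3: "(\<exists>!\<nu>. kns_measure \<nu>) \<and>
      (\<forall>\<nu>. kns_measure \<nu> \<longrightarrow>
        discrete_measure \<nu> \<and>
        emeasure \<nu> (UNIV - (\<Union>i. (f_real ^^ i) -` {0, -2})) = 0 \<and>
        (\<forall>i. \<forall>x\<in>(f_real ^^ i) -` {0, -2}. measure \<nu> {x} = 1 / (6 * 3 ^ i)))"
    unfolding levels kns_measure_iff
    using discrete_hanoi_kns emeasure_hanoi_kns_complement measure_hanoi_kns_singleton by blast
  from part1 part2 part3 show ?thesis by blast
qed

end
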